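(* Let $\mathcal{FBT}^*\subseteq 2^\omega$ be the set of atomic diagrams (under a fixed effective Gödel coding) of infinite finite-branching trees with domain $\omega$ in the language consisting of a unary function symbol $P$ (the predecessor function) together with unary branching predicates $B_n$ ($n>0$), where $B_n(a)$ holds iff $a$ has at least $n$ distinct immediate successors. Give $\mathcal{FBT}^*$ the subspace topology from Cantor space and $\mathcal{FBT}^*/\!\cong$ the quotient topology. Then $\mathcal{FBT}^*/\!\cong$ is homeomorphic to Baire space $\omega^\omega$. Consequently, $\mathcal{FBT}^*/\!\cong$ is not compact and is not homeomorphic to $\mathcal{ALG}_0^*/\!\cong$.
   Context: Trees: $P(r)=r$ for the root $r$, and for every other node $x$, $P(x)$ is its immediate predecessor; every node $x$ has some $n$ with $P^{n+1}(x)=P^n(x)$. A tree is finite-branching if $P^{-1}(x)$ is finite for each $x$. $\mathcal{ALG}_0^*$ is the set of atomic diagrams of fields with domain $\omega$ algebraic over $\mathbb{Q}$, in the language of fields expanded by $n$-ary root predicates $R_n$ ($n>1$), where $R_n(a_0,\dots,a_{n-1})$ holds iff $x^n+a_{n-1}x^{n-1}+\dots+a_0$ has a root in the field; $\mathcal{ALG}_0^*/\!\cong$ carries the quotient of the subspace topology from $2^\omega$. *)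

theory Defs
  imports "HOL-Analysis.Analysis" "HOL-Algebra.Algebraic_Closure" "HOL-Algebra.Generated_Fields"
begin

section \<open>First-order structures with domain \<open>\<omega>\<close> and their atomic diagrams\<close>

text \<open>
  Function and relation symbols are numbered by natural numbers; a signature assigns an arity to
  the symbols that belong to the language and \<open>None\<close> to all other numbers.
  Only the values of a structure on symbols of the signature and on argument lists of the right
  length are meaningful.
\<close>

record signature =
  fun_arity :: "nat \<Rightarrow> nat option"
  rel_arity :: "nat \<Rightarrow> nat option"

record struct =
  fun_int :: "nat \<Rightarrow> nat list \<Rightarrow> nat"
  rel_int :: "nat \<Rightarrow> nat list \<Rightarrow> bool"

text \<open>Closed terms and atomic sentences of the language expanded by a constant for every element
  of the domain \<open>\<omega>\<close>.\<close>

datatype cterm = Elem nat | App nat "cterm list"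

datatype atom = Eq cterm cterm | Rel nat "cterm list"

primrec wf_cterm :: "signature \<Rightarrow> cterm \<Rightarrow> bool" where
  "wf_cterm L (Elem a) \<longleftrightarrow> True"
| "wf_cterm L (App f ts) \<longleftrightarrow>
     fun_arity L f = Some (length ts) \<and> list_all id (map (wf_cterm L) ts)"

fun wf_atom :: "signature \<Rightarrow> atom \<Rightarrow> bool" where
  "wf_atom L (Eq s t) \<longleftrightarrow> wf_cterm L s \<and> wf_cterm L t"
| "wf_atom L (Rel r ts) \<longleftrightarrow> rel_arity L r = Some (length ts) \<and> (\<forall>t\<in>set ts. wf_cterm L t)"

primrec cterm_val :: "struct \<Rightarrow> cterm \<Rightarrow> nat" where
  "cterm_val A (Elem a) = a"
| "cterm_val A (App f ts) = fun_int A f (map (cterm_val A) ts)"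

fun holds :: "struct \<Rightarrow> atom \<Rightarrow> bool" where
  "holds A (Eq s t) \<longleftrightarrow> cterm_val A s = cterm_val A t"
| "holds A (Rel r ts) \<longleftrightarrow> rel_int A r (map (cterm_val A) ts)"

primrec cterm_code :: "cterm \<Rightarrow> nat" where
  "cterm_code (Elem a) = prod_encode (0, a)"
| "cterm_code (App f ts) = prod_encode (Suc f, list_encode (map cterm_code ts))"

fun atom_code :: "atom \<Rightarrow> nat" where
  "atom_code (Eq s t) = prod_encode (0, prod_encode (cterm_code s, cterm_code t))"
| "atom_code (Rel r ts) = prod_encode (Suc r, list_encode (map cterm_code ts))"

text \<open>Elements of \<open>2\<^sup>\<omega>\<close> are represented as characteristic functions.\<close>

definition atomic_diagram :: "signature \<Rightarrow> struct \<Rightarrow> nat \<Rightarrow> bool" where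
  "atomic_diagram L A c \<longleftrightarrow> (\<exists>\<phi>. wf_atom L \<phi> \<and> atom_code \<phi> = c \<and> holds A \<phi>)"

definition isomorphic_structs :: "signature \<Rightarrow> struct \<Rightarrow> struct \<Rightarrow> bool" where
  "isomorphic_structs L A B \<longleftrightarrow>
     (\<exists>h :: nat \<Rightarrow> nat. bij h \<and>
        (\<forall>f xs. fun_arity L f = Some (length xs) \<longrightarrow>
           h (fun_int A f xs) = fun_int B f (map h xs)) \<and>
        (\<forall>r xs. rel_arity L r = Some (length xs) \<longrightarrow>
           (rel_int A r xs \<longleftrightarrow> rel_int B r (map h xs))))"

definition diagrams :: "signature \<Rightarrow> struct set \<Rightarrow> (nat \<Rightarrow> bool) set" where
  "diagrams L K = atomic_diagram L ` K"

definition diagram_iso :: "signature \<Rightarrow> struct set \<Rightarrow> ((nat \<Rightarrow> bool) \<times> (nat \<Rightarrow> bool)) set" where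
  "diagram_iso L K =
     {(atomic_diagram L A, atomic_diagram L B) | A B. A \<in> K \<and> B \<in> K \<and> isomorphic_structs L A B}"

lemma inj_cterm_code: "inj cterm_code"
proof -
  have "\<forall>t. cterm_code s = cterm_code t \<longrightarrow> s = t" for s
  proof (induction s)
    case (Elem a)
    show ?case
    proof
      fix t show "cterm_code (Elem a) = cterm_code t \<longrightarrow> Elem a = t"
        by (cases t) auto
    qed
  next
    case (App f ts)
    show ?case
    proof
      fix t show "cterm_code (App f ts) = cterm_code t \<longrightarrow> App f ts = t"
      proof (cases t)
        case (App g us)
        have "ts = us" if "map cterm_code ts = map cterm_code us"
          using that App.IH
          by (intro nth_equalityI) (metis length_map, metis length_map nth_map nth_mem)
        then show ?thesis using App by (simp add: list_encode_eq)
      qed auto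
    qed
  qed
  then show ?thesis by (auto intro: injI)
qed

lemma inj_atom_code: "inj atom_code"
proof (rule injI)
  fix a b assume "atom_code a = atom_code b"
  then show "a = b"
    using inj_cterm_code by (cases a; cases b) (auto dest: injD simp: list_encode_eq inj_map_eq_map)
qed

lemma atomic_diagram_code:
  "wf_atom L \<phi> \<Longrightarrow> atomic_diagram L A (atom_code \<phi>) \<longleftrightarrow> holds A \<phi>"
  unfolding atomic_diagram_def using inj_atom_code by (auto dest: injD)

lemma atomic_diagram_eqD:
  assumes "atomic_diagram L A = atomic_diagram L B"
  shows "fun_arity L f = Some (length xs) \<Longrightarrow> fun_int A f xs = fun_int B f xs"
    and "rel_arity L r = Some (length xs) \<Longrightarrow> rel_int A r xs = rel_int B r xs"
proof -
  have *: "holds A \<phi> \<longleftrightarrow> holds B \<phi>" if "wf_atom L \<phi>" for \<phi>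
    using assms atomic_diagram_code[OF that] by metis
  have v: "map (cterm_val C) (map Elem xs) = xs" for C
    by (induction xs) auto
  have w: "list_all id (map (wf_cterm L) (map Elem xs))"
    by (induction xs) auto
  show "fun_int A f xs = fun_int B f xs" if "fun_arity L f = Some (length xs)"
    using *[of "Eq (App f (map Elem xs)) (Elem (fun_int A f xs))"] that v w by (simp del: map_map)
  show "rel_int A r xs = rel_int B r xs" if "rel_arity L r = Some (length xs)"
    using *[of "Rel r (map Elem xs)"] that v by (auto simp del: map_map)
qed

lemma isomorphic_structs_sym:
  assumes "isomorphic_structs L A B" shows "isomorphic_structs L B A"
proof -
  obtain h where h: "bij h"
    "\<And>f xs. fun_arity L f = Some (length xs) \<Longrightarrow> h (fun_int A f xs) = fun_int B f (map h xs)"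
    "\<And>r xs. rel_arity L r = Some (length xs) \<Longrightarrow> rel_int A r xs \<longleftrightarrow> rel_int B r (map h xs)"
    using assms unfolding isomorphic_structs_def by blast
  have hg: "map h (map (inv_into UNIV h) xs) = xs" for xs
    by (rule nth_equalityI) (simp_all add: surj_f_inv_f[OF bij_is_surj[OF h(1)]])
  show ?thesis
    unfolding isomorphic_structs_def
  proof (intro exI[of _ "inv_into UNIV h"] conjI allI impI)
    show "bij (inv_into UNIV h)" using h(1) by (rule bij_imp_bij_inv)
    show "inv_into UNIV h (fun_int B f xs) = fun_int A f (map (inv_into UNIV h) xs)"
      if "fun_arity L f = Some (length xs)" for f xs
      using h(2)[of f "map (inv_into UNIV h) xs"] that hg h(1) by (metis bij_inv_eq_iff length_map)
    show "rel_int B r xs \<longleftrightarrow> rel_int A r (map (inv_into UNIV h) xs)"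
      if "rel_arity L r = Some (length xs)" for r xs
      using h(3)[of r "map (inv_into UNIV h) xs"] that hg by (metis length_map)
  qed
qed

lemma isomorphic_structs_trans:
  assumes "isomorphic_structs L A B" "isomorphic_structs L B C"
  shows "isomorphic_structs L A C"
proof -
  obtain h where h: "bij h"
    "\<And>f xs. fun_arity L f = Some (length xs) \<Longrightarrow> h (fun_int A f xs) = fun_int B f (map h xs)"
    "\<And>r xs. rel_arity L r = Some (length xs) \<Longrightarrow> rel_int A r xs \<longleftrightarrow> rel_int B r (map h xs)"
    using assms(1) unfolding isomorphic_structs_def by blast
  obtain g where g: "bij g"
    "\<And>f xs. fun_arity L f = Some (length xs) \<Longrightarrow> g (fun_int B f xs) = fun_int C f (map g xs)"
    "\<And>r xs. rel_arity L r = Some (length xs) \<Longrightarrow> rel_int B r xs \<longleftrightarrow> rel_int C r (map g xs)"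
    using assms(2) unfolding isomorphic_structs_def by blast
  show ?thesis
    unfolding isomorphic_structs_def
    by (rule exI[of _ "g \<circ> h"]) (use h g in \<open>auto intro: bij_comp\<close>)
qed

lemma isomorphic_structs_if_eq_diagram:
  "atomic_diagram L A = atomic_diagram L B \<Longrightarrow> isomorphic_structs L A B"
  unfolding isomorphic_structs_def
  by (rule exI[of _ id]) (auto dest: atomic_diagram_eqD)

lemma equiv_diagram_iso: "equiv (diagrams L K) (diagram_iso L K)"
proof (rule equivI)
  show "diagram_iso L K \<subseteq> diagrams L K \<times> diagrams L K"
    by (auto simp: diagram_iso_def diagrams_def)
  show "refl_on (diagrams L K) (diagram_iso L K)"
    by (auto simp: refl_on_def diagram_iso_def diagrams_def
        intro: isomorphic_structs_if_eq_diagram)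
  show "sym (diagram_iso L K)"
    by (auto simp: sym_def diagram_iso_def dest: isomorphic_structs_sym)
  show "trans (diagram_iso L K)"
  proof (rule transI)
    fix x y z assume "(x, y) \<in> diagram_iso L K" "(y, z) \<in> diagram_iso L K"
    then obtain A B B' C where
      *: "x = atomic_diagram L A" "y = atomic_diagram L B" "y = atomic_diagram L B'"
      "z = atomic_diagram L C" "A \<in> K" "C \<in> K"
      "isomorphic_structs L A B" "isomorphic_structs L B' C"
      unfolding diagram_iso_def by blast
    then have "isomorphic_structs L A C"
      by (metis isomorphic_structs_if_eq_diagram isomorphic_structs_trans)
    with * show "(x, z) \<in> diagram_iso L K"
      unfolding diagram_iso_def by blast
  qed
qed


section \<open>Topologies\<close>

definition cantor_space :: "(nat \<Rightarrow> bool) topology" where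
  "cantor_space = product_topology (\<lambda>_. discrete_topology UNIV) UNIV"

definition baire_space :: "(nat \<Rightarrow> nat) topology" where
  "baire_space = product_topology (\<lambda>_. discrete_topology UNIV) UNIV"

text \<open>The quotient topology on the set of classes of a relation \<open>r\<close>, which is meant to be an
  equivalence relation on the underlying set of \<open>Y\<close>.\<close>

definition quotient_topology :: "'a topology \<Rightarrow> ('a \<times> 'a) set \<Rightarrow> 'a set topology" where
  "quotient_topology Y r =
     topology (\<lambda>U. U \<subseteq> topspace Y // r \<and> openin Y {x \<in> topspace Y. r `` {x} \<in> U})"

lemma openin_quotient_topology:
  "openin (quotient_topology Y r) U \<longleftrightarrow>
     U \<subseteq> topspace Y // r \<and> openin Y {x \<in> topspace Y. r `` {x} \<in> U}"
proof -
  have "istopology (\<lambda>U. U \<subseteq> topspace Y // r \<and> openin Y {x \<in> topspace Y. r `` {x} \<in> U})"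
    unfolding istopology_def
  proof (rule conjI; intro allI impI)
    fix S T
    assume *: "S \<subseteq> topspace Y // r \<and> openin Y {x \<in> topspace Y. r `` {x} \<in> S}"
      "T \<subseteq> topspace Y // r \<and> openin Y {x \<in> topspace Y. r `` {x} \<in> T}"
    have "{x \<in> topspace Y. r `` {x} \<in> S \<inter> T} =
        {x \<in> topspace Y. r `` {x} \<in> S} \<inter> {x \<in> topspace Y. r `` {x} \<in> T}"
      by auto
    then show "S \<inter> T \<subseteq> topspace Y // r \<and> openin Y {x \<in> topspace Y. r `` {x} \<in> S \<inter> T}"
      using * by (simp only: openin_Int) blast
  next
    fix \<U>
    assume *: "\<forall>K\<in>\<U>. K \<subseteq> topspace Y // r \<and> openin Y {x \<in> topspace Y. r `` {x} \<in> K}"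
    have "{x \<in> topspace Y. r `` {x} \<in> \<Union>\<U>} = (\<Union>K\<in>\<U>. {x \<in> topspace Y. r `` {x} \<in> K})"
      by auto
    moreover have "openin Y (\<Union>K\<in>\<U>. {x \<in> topspace Y. r `` {x} \<in> K})"
      using * by (intro openin_Union) blast
    ultimately show "\<Union>\<U> \<subseteq> topspace Y // r \<and> openin Y {x \<in> topspace Y. r `` {x} \<in> \<Union>\<U>}"
      using * by (simp only: Sup_le_iff) blast
  qed
  then show ?thesis
    unfolding quotient_topology_def by (simp add: topology_inverse')
qed

lemma topspace_quotient_topology: "topspace (quotient_topology Y r) = topspace Y // r"
proof -
  have "{x \<in> topspace Y. r `` {x} \<in> topspace Y // r} = topspace Y"
    by (auto intro: quotientI)
  then have "openin (quotient_topology Y r) (topspace Y // r)"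
    by (simp add: openin_quotient_topology)
  moreover have "topspace (quotient_topology Y r) \<subseteq> topspace Y // r"
    using openin_topspace[of "quotient_topology Y r"] unfolding openin_quotient_topology by blast
  ultimately show ?thesis
    by (blast dest: openin_subset)
qed

lemma quotient_map_quotient_topology:
  "quotient_map Y (quotient_topology Y r) (\<lambda>x. r `` {x})"
  unfolding quotient_map_def
proof (intro conjI allI impI)
  show "(\<lambda>x. r `` {x}) ` topspace Y = topspace (quotient_topology Y r)"
    by (auto simp: topspace_quotient_topology quotient_def)
qed (simp add: topspace_quotient_topology openin_quotient_topology)

definition iso_space :: "signature \<Rightarrow> struct set \<Rightarrow> (nat \<Rightarrow> bool) set topology" where
  "iso_space L K =
     quotient_topology (subtopology cantor_space (diagrams L K)) (diagram_iso L K)"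


section \<open>Finite-branching trees\<close>

text \<open>Function symbol 0 is the predecessor function, relation symbol \<open>n > 0\<close> is \<open>B\<^sub>n\<close>.\<close>

definition tree_sig :: signature where
  "tree_sig =
    \<lparr>fun_arity = (\<lambda>f. if f = 0 then Some 1 else None),
     rel_arity = (\<lambda>n. if n > 0 then Some 1 else None)\<rparr>"

definition is_tree :: "(nat \<Rightarrow> nat) \<Rightarrow> bool" where
  "is_tree P \<longleftrightarrow>
     (\<exists>r. P r = r \<and> (\<forall>x. x \<noteq> r \<longrightarrow> P x \<noteq> x)) \<and>
     (\<forall>x. \<exists>n. (P ^^ Suc n) x = (P ^^ n) x)"

definition finite_branching :: "(nat \<Rightarrow> nat) \<Rightarrow> bool" where
  "finite_branching P \<longleftrightarrow> (\<forall>x. finite (P -` {x}))"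

text \<open>The root \<open>r\<close> satisfies \<open>P r = r\<close> but is not an immediate successor of itself.\<close>

definition immediate_successors :: "(nat \<Rightarrow> nat) \<Rightarrow> nat \<Rightarrow> nat set" where
  "immediate_successors P a = {x. P x = a \<and> x \<noteq> a}"

definition tree_struct :: "(nat \<Rightarrow> nat) \<Rightarrow> struct" where
  "tree_struct P =
    \<lparr>fun_int = (\<lambda>_ xs. P (hd xs)),
     rel_int = (\<lambda>n xs. \<exists>S \<subseteq> immediate_successors P (hd xs). finite S \<and> card S = n)\<rparr>"

definition FBT_structs :: "struct set" where
  "FBT_structs = tree_struct ` {P. is_tree P \<and> finite_branching P}"

definition FBT_iso_space :: "(nat \<Rightarrow> bool) set topology" where
  "FBT_iso_space = iso_space tree_sig FBT_structs"


section \<open>Algebraic fields of characteristic 0\<close>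

text \<open>Function symbols 0, 1, 2, 3 are zero, one, addition and multiplication; relation symbol
  \<open>n > 1\<close> is the \<open>n\<close>-ary root predicate \<open>R\<^sub>n\<close>.\<close>

definition field_sig :: signature where
  "field_sig =
    \<lparr>fun_arity = [0 \<mapsto> 0, 1 \<mapsto> 0, 2 \<mapsto> 2, 3 \<mapsto> 2],
     rel_arity = (\<lambda>n. if n > 1 then Some n else None)\<rparr>"

text \<open>A field is algebraic over \<open>\<rat>\<close> if it has characteristic 0 and is algebraic over its prime
  field, which is the subfield generated by the empty set.\<close>

definition algebraic_over_rationals :: "('a, 'b) ring_scheme \<Rightarrow> bool" where
  "algebraic_over_rationals F \<longleftrightarrow>
     (\<forall>n::nat. n > 0 \<longrightarrow> add_pow F n \<one>\<^bsub>F\<^esub> \<noteq> \<zero>\<^bsub>F\<^esub>) \<and>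
     (\<forall>x\<in>carrier F. ((ring.algebraic F) over (generate_field F {})) x)"

text \<open>The argument list \<open>as\<close> holds the non-leading coefficients, constant term first.\<close>

definition has_monic_root :: "('a, 'b) ring_scheme \<Rightarrow> nat \<Rightarrow> 'a list \<Rightarrow> bool" where
  "has_monic_root F n as \<longleftrightarrow>
     (\<exists>x\<in>carrier F. x [^]\<^bsub>F\<^esub> n \<oplus>\<^bsub>F\<^esub> (\<Oplus>\<^bsub>F\<^esub>i\<in>{..<n}. (as ! i) \<otimes>\<^bsub>F\<^esub> x [^]\<^bsub>F\<^esub> i) = \<zero>\<^bsub>F\<^esub>)"

definition field_struct :: "nat ring \<Rightarrow> struct" where
  "field_struct F =
    \<lparr>fun_int = (\<lambda>f xs.
        if f = 0 then \<zero>\<^bsub>F\<^esub>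
        else if f = 1 then \<one>\<^bsub>F\<^esub>
        else if f = 2 then xs ! 0 \<oplus>\<^bsub>F\<^esub> xs ! 1
        else xs ! 0 \<otimes>\<^bsub>F\<^esub> xs ! 1),
     rel_int = has_monic_root F\<rparr>"

definition ALG0_structs :: "struct set" where
  "ALG0_structs = field_struct ` {F. field F \<and> carrier F = UNIV \<and> algebraic_over_rationals F}"

definition ALG0_iso_space :: "(nat \<Rightarrow> bool) set topology" where
  "ALG0_iso_space = iso_space field_sig ALG0_structs"

end

theory Submission
  imports Defs "HOL-Computational_Algebra.Fundamental_Theorem_Algebra"
begin

text \<open>
  A finite-branching tree is determined up to isomorphism by the isomorphism types of its finite
  truncations: a level-by-level matching of nodes with the same truncated subtrees can be chosen
  compatibly, because each node has only finitely many successors. Thanks to the predicates \<open>B\<^sub>n\<close>,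
  finitely many atomic facts pin down a truncation; conversely, any tree with the same truncation as
  \<open>P\<close> at level \<open>n\<close> has a copy that agrees with \<open>P\<close> up to level \<open>n\<close>. Every truncation of height \<open>n\<close>
  extends to infinitely many truncations of height \<open>n + 1\<close> (attach more nodes to one of level \<open>n\<close>), and
  every coherent sequence of truncations is realized, so the isomorphism classes are the branches of
  an infinitely branching tree of height \<open>\<omega>\<close>, that is, Baire space.

  For the fields, enumerate the algebraic numbers. The subfields form a closed subset of Cantor
  space, hence a compact one, and listing a subfield in increasing order depends continuously on it;
  the root predicates are continuous because a polynomial has only finitely many complex roots. Every
  algebraic field embeds into the complex numbers, so the space of isomorphism classes is a continuous
  image of a compact space. Baire space is not compact.
\<close>

section \<open>Quotients homeomorphic to Baire space\<close>

text \<open>The obstacle on the tree side is that a truncation constrains only finitely many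
  numbers, while every tree must have all of \<omega> as its domain. A copy that agrees with
  \<open>P\<close> up to a level is therefore obtained by extending a finite matching to a
  permutation of \<omega>, and a limit loses no node because each number is steered below a level
  fixed in advance. The comparison with Baire space is abstract: it asks for countable invariants
  \<open>t x n\<close> such that an isomorphism-invariant open set contains, with each point, all
  points sharing its invariant at some stage.

  On the field side no invariant is computed. Distinct conjugate subfields of the complex numbers
  are isomorphic, so the map from subfields to classes is not injective; compactness comes from its
  continuity and surjectivity. Embeddings are built as homomorphisms from subrings of the complex
  numbers into the field, with roots chosen on the complex side, where they always exist.\<close>

lemma openin_sequence_space:
  "openin (product_topology (\<lambda>_::nat. discrete_topology UNIV) UNIV) U \<longleftrightarrow>
    (\<forall>f\<in>U. \<exists>n. \<forall>g. (\<forall>i<n. g i = f i) \<longrightarrow> g \<in> U)" (is "openin ?X U \<longleftrightarrow> ?R")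
proof
  assume L: "openin ?X U"
  show ?R
  proof
    fix f assume "f \<in> U"
    then obtain V where V: "finite {i. V i \<noteq> UNIV}" "f \<in> Pi\<^sub>E UNIV V" "Pi\<^sub>E UNIV V \<subseteq> U"
      using L unfolding openin_product_topology_alt
      by (simp only: topspace_discrete_topology UNIV_I simp_thms) blast
    obtain n where "{i. V i \<noteq> UNIV} \<subseteq> {..<n}"
      using finite_nat_iff_bounded V(1) by blast
    then have n: "V i = UNIV" if "\<not> i < n" for i
      using that by blast
    have "f i \<in> V i" for i using V(2) by (simp add: PiE_UNIV_domain Pi_iff)
    then have "g i \<in> V i" if "\<forall>i<n. g i = f i" for g i
      using n[of i] that by (cases "i < n") (metis, simp)
    then have "g \<in> Pi\<^sub>E UNIV V" if "\<forall>i<n. g i = f i" for g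
      using that by (simp add: PiE_UNIV_domain Pi_iff)
    then have "g \<in> U" if "\<forall>i<n. g i = f i" for g
      using V(3) that by blast
    then show "\<exists>n. \<forall>g. (\<forall>i<n. g i = f i) \<longrightarrow> g \<in> U" by blast
  qed
next
  assume R: ?R
  show "openin ?X U"
    unfolding openin_product_topology_alt
  proof (intro ballI)
    fix f assume "f \<in> U"
    then obtain n where n: "\<And>g. (\<forall>i<n. g i = f i) \<Longrightarrow> g \<in> U" using R by blast
    let ?V = "\<lambda>i. if i < n then {f i} else UNIV"
    have "{i. ?V i \<noteq> UNIV} \<subseteq> {..<n}" by auto
    then have "finite {i. ?V i \<noteq> UNIV}" using finite_subset by blast
    moreover have "f \<in> Pi\<^sub>E UNIV ?V" by auto
    moreover have "Pi\<^sub>E UNIV ?V \<subseteq> U" using n by (auto simp: PiE_iff split: if_splits)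
    ultimately show "\<exists>V. finite {i \<in> UNIV. V i \<noteq> topspace (discrete_topology UNIV)} \<and>
        (\<forall>i\<in>UNIV. openin (discrete_topology UNIV) (V i)) \<and> f \<in> Pi\<^sub>E UNIV V \<and> Pi\<^sub>E UNIV V \<subseteq> U"
      by (intro exI[of _ ?V]) simp
  qed
qed

lemma openin_subtopology_sequence_space:
  "openin (subtopology (product_topology (\<lambda>_::nat. discrete_topology UNIV) UNIV) S) U \<longleftrightarrow>
    U \<subseteq> S \<and> (\<forall>f\<in>U. \<exists>n. \<forall>g\<in>S. (\<forall>i<n. g i = f i) \<longrightarrow> g \<in> U)" (is "?L \<longleftrightarrow> ?R")
proof
  assume ?L
  then obtain W where "U = W \<inter> S" "\<forall>f\<in>W. \<exists>n. \<forall>g. (\<forall>i<n. g i = f i) \<longrightarrow> g \<in> W"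
    unfolding openin_subtopology openin_sequence_space by blast
  then show ?R by (metis Int_iff inf_le2)
next
  assume R: ?R
  \<comment> \<open>The union of all cylinders around points of \<open>U\<close> whose trace on
    \<open>S\<close> stays inside \<open>U\<close>: open by construction, with trace exactly
    \<open>U\<close>.\<close>
  define W where "W = {g. \<exists>f\<in>U. \<exists>n. (\<forall>i<n. g i = f i) \<and>
      (\<forall>h\<in>S. (\<forall>i<n. h i = f i) \<longrightarrow> h \<in> U)}"
  have "\<forall>f\<in>W. \<exists>n. \<forall>g. (\<forall>i<n. g i = f i) \<longrightarrow> g \<in> W"
  proof
    fix g assume "g \<in> W"
    then obtain f n where *: "f \<in> U" "\<forall>i<n. g i = f i"
      "\<forall>h\<in>S. (\<forall>i<n. h i = f i) \<longrightarrow> h \<in> U" unfolding W_def by blast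
    then have "\<forall>h. (\<forall>i<n. h i = g i) \<longrightarrow> h \<in> W" unfolding W_def by auto
    then show "\<exists>n. \<forall>h. (\<forall>i<n. h i = g i) \<longrightarrow> h \<in> W" by blast
  qed
  moreover have "U = W \<inter> S"
    using R unfolding W_def by blast
  ultimately show ?L
    unfolding openin_subtopology openin_sequence_space by blast
qed

text \<open>A nonempty product is compact only if all its factors are, and an infinite discrete
  factor is not.\<close>

lemma not_compact_baire_space: "\<not> compact_space baire_space"
  unfolding baire_space_def
  by (auto simp: compact_space_product_topology compact_space_discrete_topology
      null_topspace_iff_trivial[symmetric] PiE_eq_empty_iff)

text \<open>The sequences \<open>t x\<close> are branches of a countable tree: \<open>t0\<close>
  gives it a single root, \<open>tS\<close> makes levels coherent, \<open>inf\<close> gives every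
  node infinitely many children, and \<open>complete\<close> realizes every branch. Through
  \<open>op\<close> and \<open>sat\<close>, the saturated open sets of \<open>Y\<close> correspond
  to the open sets of branches. Numbering the children of each node by \<omega> turns branches into
  arbitrary sequences.\<close>

lemma quotient_homeomorphic_baire_space:
  fixes Y :: "'a topology" and t :: "'a \<Rightarrow> nat \<Rightarrow> 'c::countable"
  defines "T \<equiv> topspace Y"
  assumes "T \<noteq> {}" and eq: "equiv T r"
    and r: "\<And>x y. x \<in> T \<Longrightarrow> y \<in> T \<Longrightarrow> (x, y) \<in> r \<longleftrightarrow> (\<forall>n. t x n = t y n)"
    and t0: "\<And>x y. x \<in> T \<Longrightarrow> y \<in> T \<Longrightarrow> t x 0 = t y 0"
    and tS: "\<And>x y n. x \<in> T \<Longrightarrow> y \<in> T \<Longrightarrow> t x (Suc n) = t y (Suc n) \<Longrightarrow> t x n = t y n"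
    and op: "\<And>x n. x \<in> T \<Longrightarrow> openin Y {y \<in> T. t y n = t x n}"
    and sat: "\<And>U x. openin Y U \<Longrightarrow> (\<And>y z. y \<in> U \<Longrightarrow> (y, z) \<in> r \<Longrightarrow> z \<in> U) \<Longrightarrow> x \<in> U \<Longrightarrow>
        \<exists>n. \<forall>y\<in>T. t y n = t x n \<longrightarrow> y \<in> U"
    and inf: "\<And>x n. x \<in> T \<Longrightarrow> infinite {t y (Suc n) |y. y \<in> T \<and> t y n = t x n}"
    and complete: "\<And>x. (\<And>n. x n \<in> T) \<Longrightarrow> (\<And>n. t (x (Suc n)) n = t (x n) n) \<Longrightarrow>
        \<exists>y\<in>T. \<forall>n. t y n = t (x n) n"
  shows "quotient_topology Y r homeomorphic_space baire_space"
proof -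
  define C where "C n c = {t y (Suc n) |y. y \<in> T \<and> t y n = c}" for n c
  define b where "b n c = to_nat_on (C n c)" for n c
  have b: "bij_betw (b n (t x n)) (C n (t x n)) UNIV" if "x \<in> T" for x n
  proof -
    have "infinite (C n (t x n))" unfolding C_def by (rule inf[OF that])
    then show ?thesis unfolding b_def by (rule to_nat_on_infinite[OF countableI_type])
  qed
  \<comment> \<open>The \<open>n\<close>-th value is the number of the node
    \<open>t x (Suc n)\<close> among the children of \<open>t x n\<close>.\<close>
  define F where "F x n = b n (t x n) (t x (Suc n))" for x n
  have mem: "t x (Suc n) \<in> C n (t y n)" if "x \<in> T" "t x n = t y n" for x y n
    using that unfolding C_def by blast
  \<comment> \<open>The number \<open>F x i\<close> is read relative to the node
    \<open>t x i\<close>, so the first \<open>n\<close> values trace the path from the common root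
    up to level \<open>n\<close>.\<close>
  have agree: "(\<forall>i<n. F x i = F y i) \<longleftrightarrow> t x n = t y n" if "x \<in> T" "y \<in> T" for x y n
  proof (induction n)
    case 0
    show ?case using t0[OF that] by blast
  next
    case (Suc n)
    have "(\<forall>i<Suc n. F x i = F y i) \<longleftrightarrow> t x n = t y n \<and> F x n = F y n"
      using Suc by (auto simp: less_Suc_eq)
    also have "\<dots> \<longleftrightarrow> t x (Suc n) = t y (Suc n)"
    proof
      assume *: "t x n = t y n \<and> F x n = F y n"
      then have "b n (t x n) (t x (Suc n)) = b n (t x n) (t y (Suc n))" unfolding F_def by metis
      then show "t x (Suc n) = t y (Suc n)"
        using b[OF that(1), of n] mem[of x n x] mem[of y n x] that *
        unfolding bij_betw_def by (auto dest: inj_onD)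
    next
      assume "t x (Suc n) = t y (Suc n)"
      then show "t x n = t y n \<and> F x n = F y n" using tS that unfolding F_def by metis
    qed
    finally show ?case .
  qed
  have surj: "\<exists>x\<in>T. F x = f" for f
  proof -
    \<comment> \<open>Each new point has only to agree with the previous one at level
      \<open>n\<close>; \<open>complete\<close> then merges the sequence into a single
      point.\<close>
    have "\<exists>x. \<forall>n. x n \<in> T \<and> (t (x (Suc n)) n = t (x n) n \<and>
        b n (t (x n) n) (t (x (Suc n)) (Suc n)) = f n)"
    proof (rule dependent_nat_choice)
      show "\<exists>x. x \<in> T" using \<open>T \<noteq> {}\<close> by blast
      fix x n assume "x \<in> T"
      then obtain c where "c \<in> C n (t x n)" "b n (t x n) c = f n"
        using b[of x n] unfolding bij_betw_def by (metis UNIV_I imageE)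
      then show "\<exists>y. y \<in> T \<and> t y n = t x n \<and> b n (t x n) (t y (Suc n)) = f n"
        unfolding C_def by blast
    qed
    then obtain x where x: "\<And>n. x n \<in> T" "\<And>n. t (x (Suc n)) n = t (x n) n"
      "\<And>n. b n (t (x n) n) (t (x (Suc n)) (Suc n)) = f n" by blast
    obtain y where "y \<in> T" "\<And>n. t y n = t (x n) n" using complete[of x] x by blast
    then have "F y = f" using x(3) unfolding F_def by (intro ext) metis
    then show ?thesis using \<open>y \<in> T\<close> by blast
  qed
  have F: "quotient_map Y baire_space F"
    unfolding quotient_map_def
  proof (intro conjI allI impI)
    show "F ` topspace Y = topspace baire_space"
      using surj unfolding baire_space_def T_def
      by (auto simp: image_iff PiE_UNIV_domain) (metis surj T_def)
    fix U
    show "openin Y {x \<in> topspace Y. F x \<in> U} = openin baire_space U"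
    proof
      assume o: "openin Y {x \<in> topspace Y. F x \<in> U}" (is "openin Y ?V")
      show "openin baire_space U"
        unfolding baire_space_def openin_sequence_space
      proof
        fix f assume "f \<in> U"
        obtain x where x: "x \<in> T" "F x = f" using surj by blast
        have "z \<in> ?V" if "y \<in> ?V" "(y, z) \<in> r" for y z
        proof -
          have z: "z \<in> T" using that(2) eq by (auto simp: equiv_def refl_on_def)
          then have "F z = F y" using r[of y z] that by (auto simp: F_def fun_eq_iff T_def)
          then show ?thesis using z that by (auto simp: T_def)
        qed
        moreover have "x \<in> ?V" using x \<open>f \<in> U\<close> by (auto simp: T_def)
        ultimately obtain n where n: "\<forall>y\<in>T. t y n = t x n \<longrightarrow> y \<in> ?V" using sat[OF o] by blast
        show "\<exists>n. \<forall>g. (\<forall>i<n. g i = f i) \<longrightarrow> g \<in> U"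
        proof (intro exI allI impI)
          fix g assume g: "\<forall>i<n. g i = f i"
          obtain y where "y \<in> T" "F y = g" using surj by blast
          then show "g \<in> U" using n agree[of y x n] x g by auto
        qed
      qed
    next
      assume U: "openin baire_space U"
      show "openin Y {x \<in> topspace Y. F x \<in> U}"
      proof (subst openin_subopen, intro ballI)
        fix x assume x: "x \<in> {x \<in> topspace Y. F x \<in> U}"
        then obtain n where n: "\<forall>g. (\<forall>i<n. g i = F x i) \<longrightarrow> g \<in> U"
          using U unfolding baire_space_def openin_sequence_space by blast
        have "{y \<in> T. t y n = t x n} \<subseteq> {x \<in> topspace Y. F x \<in> U}"
          using n agree[of _ x n] x by (auto simp: T_def)
        then show "\<exists>V. openin Y V \<and> x \<in> V \<and> V \<subseteq> {x \<in> topspace Y. F x \<in> U}"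
          using op[of x n] x by (intro exI[of _ "{y \<in> T. t y n = t x n}"]) (auto simp: T_def)
      qed
    qed
  qed
  have "r `` {x} = r `` {y} \<longleftrightarrow> F x = F y" if "x \<in> T" "y \<in> T" for x y
  proof -
    have "r `` {x} = r `` {y} \<longleftrightarrow> (x, y) \<in> r"
      using eq that by (simp add: eq_equiv_class_iff)
    also have "\<dots> \<longleftrightarrow> (\<forall>n. \<forall>i<n. F x i = F y i)" using r agree that by blast
    also have "\<dots> \<longleftrightarrow> F x = F y" by (auto simp: fun_eq_iff)
    finally show ?thesis .
  qed
  note F_eq = this
  \<comment> \<open>\<open>F\<close> and the projection are quotient maps with the same fibres, so
    the induced map on classes is an injective quotient map, that is, a homeomorphism.\<close>
  let ?Q = "quotient_topology Y r" and ?\<pi> = "\<lambda>x. r `` {x}"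
  note \<pi> = quotient_map_quotient_topology[of Y r]
  obtain g where g: "continuous_map ?Q baire_space g" "\<And>x. x \<in> T \<Longrightarrow> g (?\<pi> x) = F x"
    using quotient_map_lift_exists[OF \<pi> quotient_imp_continuous_map[OF F]] F_eq
    unfolding T_def by metis
  have "quotient_map Y baire_space (g \<circ> ?\<pi>)"
    using F by (rule quotient_map_eq) (simp add: g(2) T_def)
  then have "quotient_map ?Q baire_space g"
    by (rule quotient_map_from_composition[OF quotient_imp_continuous_map[OF \<pi>] g(1)])
  moreover have "inj_on g (topspace ?Q)"
    unfolding topspace_quotient_topology T_def[symmetric]
  proof (rule inj_onI)
    fix c d assume "c \<in> T // r" "d \<in> T // r" "g c = g d"
    then obtain x y where "x \<in> T" "y \<in> T" "c = r `` {x}" "d = r `` {y}"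
      by (meson quotientE)
    then show "c = d" using g(2) F_eq \<open>g c = g d\<close> by metis
  qed
  ultimately show ?thesis
    using homeomorphic_map_imp_homeomorphic_space unfolding homeomorphic_map_def by blast
qed


section \<open>Trees\<close>

definition fb_tree :: "(nat \<Rightarrow> nat) \<Rightarrow> bool" where
  "fb_tree P \<longleftrightarrow> is_tree P \<and> finite_branching P"

definition tree_root :: "(nat \<Rightarrow> nat) \<Rightarrow> nat" where
  "tree_root P = (THE r. P r = r)"

definition depth :: "(nat \<Rightarrow> nat) \<Rightarrow> nat \<Rightarrow> nat" where
  "depth P x = (LEAST n. (P ^^ n) x = tree_root P)"

lemma
  assumes "fb_tree P"
  shows root_fixed: "P (tree_root P) = tree_root P"
    and fixed_imp_root: "P x = x \<Longrightarrow> x = tree_root P"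
proof -
  obtain r where r: "P r = r" "\<And>x. x \<noteq> r \<Longrightarrow> P x \<noteq> x"
    using assms unfolding fb_tree_def is_tree_def by blast
  then have "tree_root P = r" unfolding tree_root_def by blast
  then show "P (tree_root P) = tree_root P" "P x = x \<Longrightarrow> x = tree_root P" using r by blast+
qed

lemma root_eqI: "fb_tree P \<Longrightarrow> P r = r \<Longrightarrow> tree_root P = r"
  using fixed_imp_root by metis

lemma ex_funpow_root:
  assumes "fb_tree P" shows "\<exists>n. (P ^^ n) x = tree_root P"
proof -
  obtain n where "(P ^^ Suc n) x = (P ^^ n) x"
    using assms unfolding fb_tree_def is_tree_def by blast
  then show ?thesis using fixed_imp_root[OF assms] by auto
qed

lemma depth_root: "depth P (tree_root P) = 0"
  unfolding depth_def by (rule Least_eq_0) simp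

lemma depth_nonroot:
  assumes "fb_tree P" "x \<noteq> tree_root P"
  shows "depth P x = Suc (depth P (P x))"
proof -
  obtain n where n: "(P ^^ n) x = tree_root P" using ex_funpow_root[OF assms(1)] by blast
  have "depth P x = Suc (LEAST n. (P ^^ Suc n) x = tree_root P)"
    unfolding depth_def by (rule Least_Suc[where P = "\<lambda>n. (P ^^ n) x = tree_root P", OF n])
      (use assms(2) in simp)
  then show ?thesis unfolding depth_def by (simp add: funpow_swap1)
qed

lemma depth_eq_0_iff: "fb_tree P \<Longrightarrow> depth P x = 0 \<longleftrightarrow> x = tree_root P"
  using depth_root depth_nonroot by (metis nat.simps(3))

lemma mem_children_iff:
  assumes "fb_tree P"
  shows "x \<in> immediate_successors P a \<longleftrightarrow> P x = a \<and> x \<noteq> tree_root P"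
  using root_fixed[OF assms] fixed_imp_root[OF assms] unfolding immediate_successors_def mem_Collect_eq
  by metis

lemma depth_children: "fb_tree P \<Longrightarrow> x \<in> immediate_successors P a \<Longrightarrow> depth P x = Suc (depth P a)"
  using mem_children_iff depth_nonroot by metis

lemma finite_children: "fb_tree P \<Longrightarrow> finite (immediate_successors P a)"
  unfolding fb_tree_def finite_branching_def immediate_successors_def
  by (rule finite_subset[of _ "P -` {a}"]) auto

lemma finite_depth_le:
  assumes "fb_tree P" shows "finite {x. depth P x \<le> n}"
proof (induction n)
  case 0
  then show ?case using depth_eq_0_iff[OF assms] by simp
next
  case (Suc n)
  have "{x. depth P x \<le> Suc n} \<subseteq> {x. depth P x \<le> n} \<union> (\<Union>a\<in>{x. depth P x \<le> n}. P -` {a})"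
  proof
    fix x assume x: "x \<in> {x. depth P x \<le> Suc n}"
    show "x \<in> {x. depth P x \<le> n} \<union> (\<Union>a\<in>{x. depth P x \<le> n}. P -` {a})"
    proof (cases "x = tree_root P")
      case True
      then show ?thesis using depth_root by simp
    next
      case False
      then show ?thesis using x depth_nonroot[OF assms False] by simp
    qed
  qed
  moreover have "finite (P -` {a})" for a
    using assms unfolding fb_tree_def finite_branching_def by blast
  ultimately show ?case using Suc by (auto elim!: finite_subset)
qed

text \<open>The domain is infinite while only finitely many nodes have depth at most
  \<open>n\<close>, so some node lies deeper, and its ancestors pass through every lower
  level.\<close>

lemma ex_depth:
  assumes "fb_tree P" shows "\<exists>x. depth P x = n"
proof -
  have "\<exists>x. n \<le> depth P x"
    using finite_depth_le[OF assms, of n] infinite_UNIV_nat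
    by (metis (mono_tags, lifting) UNIV_eq_I linorder_le_cases mem_Collect_eq)
  then obtain x where "n \<le> depth P x" by blast
  then show ?thesis
  proof (induction "depth P x" arbitrary: x rule: less_induct)
    case less
    show ?case
    proof (cases "depth P x = n")
      case False
      then have "x \<noteq> tree_root P" using less.prems depth_root by (metis le_zero_eq)
      then have "depth P x = Suc (depth P (P x))" using depth_nonroot[OF assms] by blast
      then show ?thesis using less False by (metis le_SucE lessI)
    qed blast
  qed
qed

text \<open>A rank that drops from each node to its predecessor forces every path to end in
  \<open>r\<close>. The rank may be any measure, for instance the depth in another tree from which
  \<open>P\<close> is built.\<close>

lemma fb_treeI:
  fixes d :: "nat \<Rightarrow> nat"
  assumes r: "P r = r" and d: "\<And>x. x \<noteq> r \<Longrightarrow> d (P x) < d x"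
    and fin: "\<And>a. finite (immediate_successors P a)"
  shows "fb_tree P"
proof -
  have "\<exists>n. (P ^^ n) x = r" for x
  proof (induction "d x" arbitrary: x rule: less_induct)
    case less
    show ?case
    proof (cases "x = r")
      case True
      then show ?thesis by (metis funpow_0)
    next
      case False
      then obtain n where "(P ^^ n) (P x) = r" using less d by blast
      then have "(P ^^ Suc n) x = r" by (simp add: funpow_swap1)
      then show ?thesis by blast
    qed
  qed
  then have "\<exists>n. (P ^^ Suc n) x = (P ^^ n) x" for x using r by (metis comp_apply funpow.simps(2))
  moreover have "P -` {a} \<subseteq> insert a (immediate_successors P a)" for a
    unfolding immediate_successors_def by auto
  ultimately show ?thesis
    unfolding fb_tree_def is_tree_def finite_branching_def
    using r d fin by (metis finite.insertI finite_subset less_irrefl)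
qed

subsection \<open>Codes of truncated subtrees\<close>

text \<open>The sorted list is a canonical representative, so the code is injective; using numbers
  keeps the types of all heights in one countable type.\<close>

definition mset_code :: "nat multiset \<Rightarrow> nat" where
  "mset_code M = list_encode (sorted_list_of_multiset M)"

definition mset_decode :: "nat \<Rightarrow> nat multiset" where
  "mset_decode c = mset (list_decode c)"

lemma mset_decode_code [simp]: "mset_decode (mset_code M) = M"
  unfolding mset_code_def mset_decode_def by simp

lemma mset_code_eq_iff [simp]: "mset_code M = mset_code N \<longleftrightarrow> M = N"
  by (metis mset_decode_code)

text \<open>\<open>ty P n x\<close> codes the isomorphism type of the subtree above \<open>x\<close>, cut off at height \<open>n\<close>.\<close>

primrec ty :: "(nat \<Rightarrow> nat) \<Rightarrow> nat \<Rightarrow> nat \<Rightarrow> nat" where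
  "ty P 0 x = 0"
| "ty P (Suc n) x = mset_code (image_mset (ty P n) (mset_set (immediate_successors P x)))"

text \<open>Cuts a code of height \<open>n + 1\<close> down to height \<open>n\<close> without
  looking at the tree, so the longer code determines the shorter one.\<close>

primrec ty_trunc :: "nat \<Rightarrow> nat \<Rightarrow> nat" where
  "ty_trunc 0 c = 0"
| "ty_trunc (Suc n) c = mset_code (image_mset (ty_trunc n) (mset_decode c))"

lemma ty_trunc: "ty P n x = ty_trunc n (ty P (Suc n) x)"
proof (induction n arbitrary: x)
  case (Suc n)
  have "image_mset (ty P n) A = image_mset (ty_trunc n) (image_mset (ty P (Suc n)) A)" for A
    unfolding multiset.map_comp comp_def by (rule image_mset_cong) (rule Suc)
  then show ?case
    unfolding ty_trunc.simps ty.simps(2)[of P "Suc n"] ty.simps(2)[of P n x] mset_decode_code by simp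
qed simp

lemma ty_Suc_eqD: "ty P (Suc n) x = ty Q (Suc n) y \<Longrightarrow> ty P n x = ty Q n y"
  using ty_trunc by metis

definition tree_type :: "(nat \<Rightarrow> nat) \<Rightarrow> nat \<Rightarrow> nat" where
  "tree_type P n = ty P n (tree_root P)"

subsection \<open>Level-by-level isomorphisms\<close>

text \<open>Read \<open>f\<close> and \<open>g\<close> as colourings: match one element of
  \<open>A\<close> with some element of \<open>B\<close> of the same colour, remove both and
  repeat.\<close>

lemma bij_betw_of_image_mset_eq:
  assumes "finite A" "finite B" "image_mset f (mset_set A) = image_mset g (mset_set B)"
  shows "\<exists>\<beta>. bij_betw \<beta> A B \<and> (\<forall>x\<in>A. g (\<beta> x) = f x)"
  using assms
proof (induction A arbitrary: B rule: finite_induct)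
  case empty
  then have "B = {}" by (simp add: mset_set_empty_iff)
  then show ?case by (simp add: bij_betw_def)
next
  case (insert a A)
  have "f a \<in># image_mset g (mset_set B)"
    using insert.prems(2) insert.hyps by (metis image_mset_add_mset mset_set.insert union_single_eq_member)
  then obtain b where b: "b \<in> B" "g b = f a" using insert.prems(1) by auto
  have "mset_set B = add_mset b (mset_set (B - {b}))"
    using b insert.prems(1) by (simp add: mset_set.remove)
  then have "image_mset f (mset_set A) = image_mset g (mset_set (B - {b}))"
    using insert.prems(2) insert.hyps b by simp
  then obtain \<beta> where \<beta>: "bij_betw \<beta> A (B - {b})" "\<forall>x\<in>A. g (\<beta> x) = f x"
    using insert.IH[of "B - {b}"] insert.prems by blast
  have "bij_betw (\<beta>(a := b)) A (B - {b})"
    using \<beta>(1) insert.hyps by (subst bij_betw_cong[of _ _ \<beta>]) auto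
  then have "bij_betw (\<beta>(a := b)) (insert a A) (insert b (B - {b}))"
    using insert.hyps notIn_Un_bij_betw[of a A "\<beta>(a := b)" "B - {b}"] by auto
  then have "bij_betw (\<beta>(a := b)) (insert a A) B" using b by (simp add: insert_absorb)
  moreover have "\<forall>x\<in>insert a A. g ((\<beta>(a := b)) x) = f x" using \<beta>(2) b insert.hyps by auto
  ultimately show ?case by blast
qed

text \<open>Here \<open>\<tau>\<close> and \<open>\<sigma>\<close> colour the nodes. Since nodes of
  equal colour at the same level have equally coloured successors, colour-preserving bijections
  between successor sets extend a matching of the roots level by level. The bound \<open>N\<close>
  is an \<open>enat\<close> so that truncations and whole trees are covered at once.\<close>

lemma level_isomorphism:
  fixes N :: enat and \<tau> \<sigma> :: "nat \<Rightarrow> 'c"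
  assumes P: "fb_tree P" and Q: "fb_tree Q"
    and rt: "\<tau> (tree_root P) = \<sigma> (tree_root Q)"
    and step: "\<And>x y. enat (depth P x) < N \<Longrightarrow> depth Q y = depth P x \<Longrightarrow> \<tau> x = \<sigma> y \<Longrightarrow>
      image_mset \<tau> (mset_set (immediate_successors P x)) =
      image_mset \<sigma> (mset_set (immediate_successors Q y))"
  shows "\<exists>h. bij_betw h {x. enat (depth P x) \<le> N} {y. enat (depth Q y) \<le> N} \<and>
    (\<forall>x. enat (depth P x) \<le> N \<longrightarrow> depth Q (h x) = depth P x \<and> h (P x) = Q (h x))"
proof -
  define good where "good x y \<beta> \<longleftrightarrow> bij_betw \<beta> (immediate_successors P x) (immediate_successors Q y) \<and>
    (\<forall>c\<in>immediate_successors P x. \<sigma> (\<beta> c) = \<tau> c)" for x y \<beta>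
  define \<beta> where "\<beta> x y = (SOME \<beta>. good x y \<beta>)" for x y
  have \<beta>: "good x y (\<beta> x y)"
    if "enat (depth P x) < N" "depth Q y = depth P x" "\<tau> x = \<sigma> y" for x y
  proof -
    have "\<exists>\<beta>. good x y \<beta>"
      unfolding good_def
      by (rule bij_betw_of_image_mset_eq[OF finite_children[OF P] finite_children[OF Q] step[OF that]])
    then show ?thesis unfolding \<beta>_def by (rule someI_ex)
  qed
  \<comment> \<open>Recursion on the level: \<open>hh d\<close> gives the images of the nodes of
    depth \<open>d\<close>, each found through the image of its predecessor.\<close>
  define hh where "hh = rec_nat (\<lambda>x. tree_root Q) (\<lambda>d h x. \<beta> (P x) (h (P x)) x)"
  define h where "h x = hh (depth P x) x" for x
  have h_root: "h (tree_root P) = tree_root Q" unfolding h_def hh_def depth_root by simp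
  have h_nonroot: "h x = \<beta> (P x) (h (P x)) x" if "x \<noteq> tree_root P" for x
    unfolding h_def depth_nonroot[OF P that] hh_def by simp
  \<comment> \<open>The invariant includes equality of colours, because only equally coloured nodes
    have a good bijection between their successors at the next level.\<close>
  have inv: "depth Q (h x) = depth P x \<and> \<tau> x = \<sigma> (h x) \<and> (x \<noteq> tree_root P \<longrightarrow> good (P x) (h (P x)) (\<beta> (P x) (h (P x))))"
    if "enat (depth P x) \<le> N" for x
    using that
  proof (induction "depth P x" arbitrary: x)
    case 0
    then show ?case using depth_eq_0_iff[OF P] rt h_root depth_root by metis
  next
    case (Suc d)
    then have x: "x \<noteq> tree_root P" using depth_root by (metis nat.simps(3))
    then have d: "depth P (P x) = d" "d < N" using Suc depth_nonroot[OF P x]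
      by (auto simp: Suc_ile_eq)
    then have g: "good (P x) (h (P x)) (\<beta> (P x) (h (P x)))"
      using Suc.hyps(1)[of "P x"] by (intro \<beta>) auto
    have "x \<in> immediate_successors P (P x)" using x mem_children_iff[OF P] by blast
    then have "h x \<in> immediate_successors Q (h (P x))" "\<sigma> (h x) = \<tau> x"
      using g unfolding good_def h_nonroot[OF x] by (auto dest: bij_betwE)
    moreover have "depth Q (h (P x)) = d" using Suc.hyps(1)[of "P x"] d by simp
    ultimately show ?case using g depth_children[OF Q] Suc.hyps(2) by metis
  qed
  have P_le: "enat (depth P (P x)) \<le> N" if "enat (depth P x) \<le> N" for x
    using that depth_nonroot[OF P, of x] root_fixed[OF P]
    by (metis Suc_ile_eq order_less_imp_le)
  have hom: "h (P x) = Q (h x)" if "enat (depth P x) \<le> N" for x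
  proof (cases "x = tree_root P")
    case True
    then show ?thesis using h_root root_fixed[OF P] root_fixed[OF Q] by simp
  next
    case False
    then have "x \<in> immediate_successors P (P x)" using mem_children_iff[OF P] by blast
    then have "h x \<in> immediate_successors Q (h (P x))"
      using inv[OF that] False unfolding good_def h_nonroot[OF False] by (auto dest: bij_betwE)
    then show ?thesis unfolding immediate_successors_def by simp
  qed
  have inj: "x = x'" if "enat (depth P x) \<le> N" "enat (depth P x') \<le> N" "h x = h x'" for x x'
    using that
  proof (induction "depth P x" arbitrary: x x')
    case 0
    then have "depth P x' = 0" using inv by metis
    then show ?case using 0 depth_eq_0_iff[OF P] by metis
  next
    case (Suc d)
    have "depth P x' = Suc d" using inv Suc by metis
    then have x: "x \<noteq> tree_root P" "x' \<noteq> tree_root P" using Suc.hyps(2) depth_root by (metis nat.simps(3))+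
    then have "P x = P x'"
      using Suc.hyps(1)[of "P x" "P x'"] Suc.prems Suc.hyps(2) P_le hom depth_nonroot[OF P] by (metis nat.inject)
    moreover have "x \<in> immediate_successors P (P x)" "x' \<in> immediate_successors P (P x')"
      using x mem_children_iff[OF P] by blast+
    moreover have "inj_on (\<beta> (P x) (h (P x))) (immediate_successors P (P x))"
      using inv[OF Suc.prems(1)] x unfolding good_def bij_betw_def by blast
    ultimately show ?case using Suc.prems(3) h_nonroot x by (metis inj_onD)
  qed
  have surj: "\<exists>x. enat (depth P x) \<le> N \<and> h x = y" if "enat (depth Q y) \<le> N" for y
    using that
  proof (induction "depth Q y" arbitrary: y)
    case 0
    then show ?case using depth_eq_0_iff[OF Q] h_root depth_root by metis
  next
    case (Suc d)
    then have y: "y \<noteq> tree_root Q" using depth_root by (metis nat.simps(3))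
    then have d: "depth Q (Q y) = d" "d < N" using Suc depth_nonroot[OF Q y]
      by (auto simp: Suc_ile_eq)
    then have "enat (depth Q (Q y)) \<le> N" by simp
    then obtain x where x: "enat (depth P x) \<le> N" "h x = Q y"
      using Suc.hyps(1)[of "Q y"] d(1) by blast
    then have dx: "depth P x = d" "\<tau> x = \<sigma> (Q y)" using inv d by metis+
    then have "good x (h x) (\<beta> x (h x))" using d x by (intro \<beta>) auto
    moreover have "y \<in> immediate_successors Q (h x)" using y x mem_children_iff[OF Q] by simp
    ultimately have "y \<in> \<beta> x (h x) ` immediate_successors P x"
      unfolding good_def bij_betw_def by blast
    then obtain c where c: "c \<in> immediate_successors P x" "\<beta> x (h x) c = y" by blast
    then have "h c = y" using h_nonroot mem_children_iff[OF P] by metis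
    moreover have "depth P c = Suc d" using depth_children[OF P c(1)] dx by simp
    ultimately show ?case using Suc by metis
  qed
  have "bij_betw h {x. enat (depth P x) \<le> N} {y. enat (depth Q y) \<le> N}"
  proof (rule bij_betw_imageI)
    show "inj_on h {x. enat (depth P x) \<le> N}" using inj by (intro inj_onI) blast
    show "h ` {x. enat (depth P x) \<le> N} = {y. enat (depth Q y) \<le> N}"
    proof (intro subset_antisym subsetI)
      fix y assume "y \<in> h ` {x. enat (depth P x) \<le> N}"
      then show "y \<in> {y. enat (depth Q y) \<le> N}" using inv by auto
    next
      fix y assume "y \<in> {y. enat (depth Q y) \<le> N}"
      then show "y \<in> h ` {x. enat (depth P x) \<le> N}" using surj by blast
    qed
  qed
  then show ?thesis using inv hom by blast
qed


subsection \<open>Trees that agree up to a level\<close>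

text \<open>The first clause keeps the nodes up to level \<open>n\<close> in place; the second stops
  other nodes from entering those levels. What hangs on nodes of level \<open>n\<close> remains
  free, and depth is measured in \<open>P\<close> alone.\<close>

definition agree :: "nat \<Rightarrow> (nat \<Rightarrow> nat) \<Rightarrow> (nat \<Rightarrow> nat) \<Rightarrow> bool" where
  "agree n P Q \<longleftrightarrow> (\<forall>x. (depth P x \<le> n \<longrightarrow> Q x = P x) \<and>
    (depth P x < n \<longrightarrow> immediate_successors Q x = immediate_successors P x))"

lemma agree_refl: "agree n P P"
  unfolding agree_def by simp

lemma agree_mono: "agree n P Q \<Longrightarrow> m \<le> n \<Longrightarrow> agree m P Q"
  unfolding agree_def by auto

text \<open>These facts make the relation usable from both sides. The last one, that no foreign node
  sinks into the first \<open>n\<close> levels of \<open>Q\<close>, rests on the clause about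
  successors.\<close>

lemma agree_depth:
  assumes P: "fb_tree P" and Q: "fb_tree Q" and a: "agree n P Q"
  shows "tree_root Q = tree_root P"
    and "depth P x \<le> n \<Longrightarrow> depth Q x = depth P x"
    and "depth Q x \<le> n \<Longrightarrow> depth P x = depth Q x"
proof -
  have "Q (tree_root P) = tree_root P" using a root_fixed[OF P] unfolding agree_def depth_root
    by (metis depth_root le0)
  then show r: "tree_root Q = tree_root P" by (rule root_eqI[OF Q])
  show "depth P x \<le> n \<Longrightarrow> depth Q x = depth P x"
  proof (induction "depth P x" arbitrary: x)
    case 0
    then show ?case using depth_eq_0_iff[OF P] r depth_root by metis
  next
    case (Suc d)
    then have x: "x \<noteq> tree_root P" using depth_root by (metis nat.simps(3))
    then have "depth P (P x) = d" using depth_nonroot[OF P x] Suc by simp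
    then have "depth Q (P x) = d" using Suc by simp
    moreover have "Q x = P x" using Suc a unfolding agree_def by blast
    ultimately show ?case using depth_nonroot[OF Q, of x] x r Suc.hyps(2) by simp
  qed
  show "depth Q x \<le> n \<Longrightarrow> depth P x = depth Q x"
  proof (induction "depth Q x" arbitrary: x)
    case 0
    then show ?case using depth_eq_0_iff[OF Q] r depth_root by metis
  next
    case (Suc d)
    then have x: "x \<noteq> tree_root Q" using depth_root by (metis nat.simps(3))
    then have "depth Q (Q x) = d" using depth_nonroot[OF Q x] Suc by simp
    then have d: "depth P (Q x) = d" using Suc by simp
    have "x \<in> immediate_successors Q (Q x)" using x mem_children_iff[OF Q] by blast
    then have "x \<in> immediate_successors P (Q x)"
      using a d Suc unfolding agree_def by (metis Suc_le_lessD)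
    then show ?case using depth_children[OF P] d Suc by metis
  qed
qed

lemma agree_trans:
  assumes "fb_tree P" "fb_tree Q" "agree n P Q" "agree n Q R" shows "agree n P R"
  using agree_depth(2)[OF assms(1-3)] assms(3,4) unfolding agree_def by (metis less_imp_le)

lemma agree_tree_type:
  assumes P: "fb_tree P" and Q: "fb_tree Q" and a: "agree n P Q"
  shows "tree_type Q n = tree_type P n"
proof -
  \<comment> \<open>Looking up by height \<open>m\<close> from a node of depth \<open>d\<close>
    stays within the shared levels as long as \<open>d + m\<close> is at most
    \<open>n\<close>.\<close>
  have "ty Q m x = ty P m x" if "depth P x + m \<le> n" for m x
    using that
  proof (induction m arbitrary: x)
    case (Suc m)
    have "depth P x < n" using Suc.prems by simp
    then have c: "immediate_successors Q x = immediate_successors P x"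
      using a unfolding agree_def by blast
    have "ty Q m y = ty P m y" if "y \<in> immediate_successors P x" for y
      using Suc depth_children[OF P that] by simp
    then show ?case unfolding ty.simps c using finite_children[OF P]
      by (intro arg_cong[of _ _ mset_code] image_mset_cong) simp
  qed simp
  from this[of "tree_root P" n] show ?thesis
    unfolding tree_type_def agree_depth(1)[OF assms] by (simp add: depth_root)
qed

section \<open>Transport of trees along permutations of the domain\<close>

lemma
  assumes Q: "fb_tree Q" and H: "bij H" "\<And>x. H (Q' x) = Q (H x)"
  shows conjugate_fb_tree: "fb_tree Q'"
    and conjugate_depth: "depth Q' x = depth Q (H x)"
    and conjugate_tree_type: "tree_type Q' = tree_type Q"
proof -
  have Hinj: "H x = H y \<longleftrightarrow> x = y" for x y using H(1) by (simp add: bij_is_inj inj_eq)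
  obtain r where r: "H r = tree_root Q" using H(1) by (metis bij_pointE)
  have c: "H ` immediate_successors Q' a = immediate_successors Q (H a)" for a
  proof -
    have "y \<in> H ` immediate_successors Q' a" if "y \<in> immediate_successors Q (H a)" for y
    proof -
      obtain x where "y = H x" using H(1) by (metis bij_pointE)
      moreover from this have "H (Q' x) = H a" "x \<noteq> a"
        using that H(2)[of x] unfolding immediate_successors_def by auto
      ultimately show ?thesis unfolding immediate_successors_def Hinj by blast
    qed
    moreover have "H x \<in> immediate_successors Q (H a)" if "x \<in> immediate_successors Q' a" for x
      using that Hinj H(2)[of x, symmetric] unfolding immediate_successors_def by auto
    ultimately show ?thesis by blast
  qed
  have Q'r: "Q' r = r" using H(2) r root_fixed[OF Q] Hinj by metis
  show Q': "fb_tree Q'"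
  \<comment> \<open>\<open>H\<close> is an isomorphism from \<open>Q'\<close> onto \<open>Q\<close>,
    so the depth of the image node serves as the rank.\<close>
  proof (rule fb_treeI[where r = r and d = "\<lambda>x. depth Q (H x)"], rule Q'r)
    fix x assume "x \<noteq> r"
    then have "H x \<noteq> tree_root Q" using r Hinj by metis
    then show "depth Q (H (Q' x)) < depth Q (H x)" using depth_nonroot[OF Q] H(2) by simp
  next
    show "finite (immediate_successors Q' a)" for a
      using finite_children[OF Q, of "H a"] c[of a] H(1) by (metis bij_is_inj finite_imageD inj_on_subset subset_UNIV)
  qed
  have r': "tree_root Q' = r" by (rule root_eqI[OF Q' Q'r])
  show "depth Q' x = depth Q (H x)" for x
  proof (induction "depth Q' x" arbitrary: x)
    case 0
    then have "H x = tree_root Q" using depth_eq_0_iff[OF Q'] r r' by metis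
    then show ?case using 0 depth_root by metis
  next
    case (Suc d)
    then have x: "x \<noteq> tree_root Q'" using depth_root by (metis nat.simps(3))
    then have "H x \<noteq> tree_root Q" using r r' Hinj by metis
    moreover have "depth Q' (Q' x) = depth Q (H (Q' x))"
      using Suc.hyps depth_nonroot[OF Q' x] by simp
    ultimately show ?case using depth_nonroot[OF Q' x] depth_nonroot[OF Q, of "H x"] H(2) by simp
  qed
  have "ty Q' n x = ty Q n (H x)" for n x
  proof (induction n arbitrary: x)
    case (Suc n)
    have "mset_set (immediate_successors Q (H x)) = image_mset H (mset_set (immediate_successors Q' x))"
      unfolding c[symmetric] using H(1)
      by (metis bij_is_inj image_mset_mset_set inj_on_subset subset_UNIV)
    moreover have "image_mset (ty Q' n) A = image_mset (\<lambda>x. ty Q n (H x)) A" for A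
      by (rule image_mset_cong) (rule Suc)
    ultimately show ?case by (simp add: multiset.map_comp comp_def)
  qed simp
  then show "tree_type Q' = tree_type Q" unfolding tree_type_def r' using r by auto
qed

text \<open>The complements of two finite sets of numbers are both countably infinite, so any
  bijection between them completes \<open>h\<close>.\<close>

lemma extend_finite_bij:
  fixes A B :: "nat set"
  assumes "finite A" "bij_betw h A B"
  shows "\<exists>H. bij H \<and> (\<forall>x\<in>A. H x = h x)"
proof -
  have "finite B" using assms bij_betw_finite by blast
  then have "infinite (- A)" "infinite (- B)" using assms(1) by (simp_all add: Compl_eq_Diff_UNIV)
  then obtain k where "bij_betw k (- A) (- B)"
    using bij_betw_trans[OF to_nat_on_infinite[OF countableI_type]
          bij_betw_from_nat_into[OF countableI_type]] by blast
  then have "bij_betw (\<lambda>x. if x \<in> A then h x else k x) (A \<union> - A) (B \<union> - B)"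
    by (intro bij_betw_disjoint_Un assms(2)) auto
  then show ?thesis by (intro exI[of _ "\<lambda>x. if x \<in> A then h x else k x"]) simp
qed

text \<open>Match the two truncations, extend the matching to a permutation of \<omega>, and pull
  \<open>Q\<close> back along it. Numbers beyond level \<open>n\<close> of \<open>P\<close> can be
  sent anywhere, so \<open>a\<close>, if it is one of them, is sent to a node of \<open>Q\<close> at
  level \<open>n + 1\<close>.\<close>

lemma agreeing_copy:
  assumes P: "fb_tree P" and Q: "fb_tree Q" and t: "tree_type P n = tree_type Q n"
  shows "\<exists>Q' H. bij H \<and> (\<forall>x. H (Q' x) = Q (H x)) \<and> fb_tree Q' \<and> agree n P Q' \<and> depth Q' a \<le> Suc n"
proof -
  \<comment> \<open>The colour of a node is its type cut at the height that remains below level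
    \<open>n\<close>; each step to a successor uses up one unit.\<close>
  define \<tau> where "\<tau> P x = ty P (n - depth P x) x" for P x
  have "\<exists>h. bij_betw h {x. enat (depth P x) \<le> enat n} {y. enat (depth Q y) \<le> enat n} \<and>
    (\<forall>x. enat (depth P x) \<le> enat n \<longrightarrow> depth Q (h x) = depth P x \<and> h (P x) = Q (h x))"
  proof (rule level_isomorphism[OF P Q, of "\<tau> P" "\<tau> Q"])
    show "\<tau> P (tree_root P) = \<tau> Q (tree_root Q)" using t unfolding \<tau>_def tree_type_def depth_root by simp
  next
    fix x y assume *: "enat (depth P x) < enat n" "depth Q y = depth P x" "\<tau> P x = \<tau> Q y"
    define m where "m = n - Suc (depth P x)"
    have "n - depth P x = Suc m" using * unfolding m_def by simp
    then have "image_mset (ty P m) (mset_set (immediate_successors P x)) =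
        image_mset (ty Q m) (mset_set (immediate_successors Q y))"
      using * unfolding \<tau>_def by simp
    moreover have "image_mset (\<tau> P) (mset_set (immediate_successors P x)) =
        image_mset (ty P m) (mset_set (immediate_successors P x))"
      by (rule image_mset_cong) (use depth_children[OF P] finite_children[OF P] in \<open>simp add: \<tau>_def m_def\<close>)
    moreover have "image_mset (\<tau> Q) (mset_set (immediate_successors Q y)) =
        image_mset (ty Q m) (mset_set (immediate_successors Q y))"
      by (rule image_mset_cong) (use depth_children[OF Q] finite_children[OF Q] * in \<open>simp add: \<tau>_def m_def\<close>)
    ultimately show "image_mset (\<tau> P) (mset_set (immediate_successors P x)) =
        image_mset (\<tau> Q) (mset_set (immediate_successors Q y))" by simp
  qed
  then obtain h where h: "bij_betw h {x. depth P x \<le> n} {y. depth Q y \<le> n}"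
    "\<And>x. depth P x \<le> n \<Longrightarrow> depth Q (h x) = depth P x"
    "\<And>x. depth P x \<le> n \<Longrightarrow> h (P x) = Q (h x)" by auto
  \<comment> \<open>If \<open>a\<close> lies beyond level \<open>n\<close>, this is \<open>a\<close>
    itself, otherwise an arbitrary node beyond that level; both cases then add one pair to the
    finite matching.\<close>
  obtain a' where a': "depth P a \<le> n \<or> a = a'" "\<not> depth P a' \<le> n"
    using ex_depth[OF P, of "Suc n"] by (metis Suc_n_not_le_n)
  obtain b where b: "depth Q b = Suc n" using ex_depth[OF Q] by blast
  let ?A = "{x. depth P x \<le> n}"
  have "bij_betw (h(a' := b)) ?A {y. depth Q y \<le> n}"
    using h(1) a' by (subst bij_betw_cong[of _ _ h]) auto
  then have hb: "bij_betw (h(a' := b)) (insert a' ?A) (insert b {y. depth Q y \<le> n})"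
    using notIn_Un_bij_betw[of a' ?A "h(a' := b)" "{y. depth Q y \<le> n}"] a' b by simp
  have "finite (insert a' ?A)" using finite_depth_le[OF P] by simp
  from extend_finite_bij[OF this hb]
  obtain H where H: "bij H" "\<And>x. x \<in> insert a' ?A \<Longrightarrow> H x = (h(a' := b)) x" by blast
  have Hh: "H x = h x" if "depth P x \<le> n" for x using H(2)[of x] that a' by auto
  have Ha: "H a' = b" using H(2)[of a'] by simp
  have Hinj: "H x = H y \<longleftrightarrow> x = y" for x y using H(1) by (simp add: bij_is_inj inj_eq)
  define Q' where "Q' x = inv_into UNIV H (Q (H x))" for x
  have HQ': "H (Q' x) = Q (H x)" for x
    unfolding Q'_def using H(1) by (simp add: bij_is_surj surj_f_inv_f)
  note c = conjugate_fb_tree[OF Q H(1) HQ'] conjugate_depth[OF Q H(1) HQ']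
  have PA: "depth P (P x) \<le> n" if "depth P x \<le> n" for x
    using that depth_nonroot[OF P, of x] root_fixed[OF P] by (cases "x = tree_root P") auto
  have Q'P: "Q' x = P x" if "depth P x \<le> n" for x
  proof -
    have "H (Q' x) = H (P x)" unfolding HQ' Hh[OF that] Hh[OF PA[OF that]] h(3)[OF that] ..
    then show ?thesis unfolding Hinj .
  qed
  have depth_eq: "depth Q' x = depth P x" if "depth P x \<le> n" for x
    using c(2) Hh h(2) that by metis
  have shallow: "depth P x \<le> n" if "depth Q' x \<le> n" for x
  proof -
    have "H x \<in> {y. depth Q y \<le> n}" using that c(2) by simp
    then have "H x \<in> h ` {x. depth P x \<le> n}" using bij_betw_imp_surj_on[OF h(1)] by blast
    then obtain y where y: "depth P y \<le> n" "H x = h y" by blast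
    then have "H x = H y" using Hh[OF y(1)] by simp
    then show ?thesis using y(1) unfolding Hinj by simp
  qed
  have "immediate_successors Q' x = immediate_successors P x" if "depth P x < n" for x
  proof (intro subset_antisym subsetI)
    fix y assume y: "y \<in> immediate_successors Q' x"
    then have "depth Q' y \<le> n" using depth_children[OF c(1) y] depth_eq[of x] that by simp
    then have "Q' y = P y" using shallow Q'P by blast
    then show "y \<in> immediate_successors P x" using y unfolding immediate_successors_def by simp
  next
    fix y assume y: "y \<in> immediate_successors P x"
    then have "depth P y \<le> n" using depth_children[OF P y] that by simp
    then have "Q' y = P y" using Q'P by blast
    then show "y \<in> immediate_successors Q' x" using y unfolding immediate_successors_def by simp
  qed
  then have "agree n P Q'" unfolding agree_def using Q'P by blast
  moreover have "depth Q' a \<le> Suc n"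
    using a' depth_eq[of a] c(2)[of a] Ha b by auto
  ultimately show ?thesis using H(1) HQ' c(1) by blast
qed

text \<open>Finitely many coherent sequences are separated by a single level. Recovering each
  sequence from its value at that level turns the equality there into one of multisets of whole
  sequences.\<close>

lemma image_mset_eq_of_all_levels:
  fixes f g :: "'a \<Rightarrow> nat \<Rightarrow> 'c"
  assumes A: "finite A" and B: "finite B"
    and eq: "\<And>n. image_mset (\<lambda>x. f x n) (mset_set A) = image_mset (\<lambda>x. g x n) (mset_set B)"
    and coh: "\<And>u v n. u \<in> f ` A \<union> g ` B \<Longrightarrow> v \<in> f ` A \<union> g ` B \<Longrightarrow> u (Suc n) = v (Suc n) \<Longrightarrow> u n = v n"
  shows "image_mset f (mset_set A) = image_mset g (mset_set B)"
proof -
  define S where "S = f ` A \<union> g ` B"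
  have S: "finite S" unfolding S_def using A B by simp
  have down: "u n = v n" if "u \<in> S" "v \<in> S" "u m = v m" "n \<le> m" for u v n m
    using \<open>n \<le> m\<close> that(3)
  proof (induction rule: dec_induct)
    case (step k)
    then show ?case using coh that(1,2) unfolding S_def by blast
  qed
  have "\<exists>n. \<forall>u\<in>S. \<forall>v\<in>S. u n = v n \<longrightarrow> u = v"
  proof -
    have "\<exists>d. u \<noteq> v \<longrightarrow> u d \<noteq> v d" for u v :: "nat \<Rightarrow> 'c" by (auto simp: fun_eq_iff)
    then obtain d where d: "\<And>u v :: nat \<Rightarrow> 'c. u \<noteq> v \<Longrightarrow> u (d u v) \<noteq> v (d u v)" by metis
    \<comment> \<open>\<open>d u v\<close> is a level at which \<open>u\<close> and \<open>v\<close>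
      differ; by coherence they still differ at every later level, so the maximum separates all
      pairs. The inserted 0 covers an empty \<open>S\<close>.\<close>
    define n where "n = Max (insert 0 ((\<lambda>(u, v). d u v) ` (S \<times> S)))"
    have "d u v \<le> n" if "u \<in> S" "v \<in> S" for u v
      unfolding n_def using S that by (intro Max_ge) auto
    then show ?thesis using d down by metis
  qed
  then obtain n where n: "inj_on (\<lambda>u. u n) S" unfolding inj_on_def by blast
  let ?k = "inv_into S (\<lambda>u. u n)"
  have "image_mset f (mset_set A) = image_mset ?k (image_mset (\<lambda>x. f x n) (mset_set A))"
    unfolding multiset.map_comp comp_def
    by (rule image_mset_cong) (use A inv_into_f_f[OF n] in \<open>auto simp: S_def\<close>)
  also have "\<dots> = image_mset ?k (image_mset (\<lambda>x. g x n) (mset_set B))" unfolding eq ..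
  also have "\<dots> = image_mset g (mset_set B)"
    unfolding multiset.map_comp comp_def
    by (rule image_mset_cong) (use B inv_into_f_f[OF n] in \<open>auto simp: S_def\<close>)
  finally show ?thesis .
qed

section \<open>Isomorphism of tree structures\<close>

lemma tree_struct_sel [simp]:
  "fun_int (tree_struct P) f xs = P (hd xs)"
  "rel_int (tree_struct P) n xs \<longleftrightarrow>
    (\<exists>S\<subseteq>immediate_successors P (hd xs). finite S \<and> card S = n)"
  by (simp_all add: tree_struct_def)

text \<open>The branching predicates are determined by the predecessor function: a bijection that
  commutes with the latter maps successor sets onto successor sets and so preserves their
  cardinalities.\<close>

lemma isomorphic_tree_structs_iff:
  "isomorphic_structs tree_sig (tree_struct P) (tree_struct Q) \<longleftrightarrow>
    (\<exists>H. bij H \<and> (\<forall>x. H (P x) = Q (H x)))" (is "?L \<longleftrightarrow> ?R")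
proof
  assume ?L
  then obtain H where H: "bij H" "\<And>f xs. fun_arity tree_sig f = Some (length xs) \<Longrightarrow>
      H (fun_int (tree_struct P) f xs) = fun_int (tree_struct Q) f (map H xs)"
    unfolding isomorphic_structs_def by blast
  have "H (P x) = Q (H x)" for x
    using H(2)[of 0 "[x]"] by (simp add: tree_sig_def)
  then show ?R using H(1) by blast
next
  assume ?R
  then obtain H where H: "bij H" "\<And>x. H (P x) = Q (H x)" by blast
  have inj: "inj_on H S" for S using H(1) by (metis bij_is_inj inj_on_subset subset_UNIV)
  have c: "immediate_successors Q (H a) = H ` immediate_successors P a" for a
  proof -
    have "y \<in> H ` immediate_successors P a" if "y \<in> immediate_successors Q (H a)" for y
    proof -
      obtain x where "y = H x" using H(1) by (metis bij_pointE)
      moreover from this have "H (P x) = H a" "x \<noteq> a"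
        using that H(2)[of x] unfolding immediate_successors_def by auto
      moreover from this have "P x = a" using injD[OF inj] by blast
      ultimately show ?thesis unfolding immediate_successors_def by blast
    qed
    moreover have "H x \<in> immediate_successors Q (H a)" if "x \<in> immediate_successors P a" for x
      using that injD[OF inj, of x a] H(2)[of x, symmetric] unfolding immediate_successors_def by auto
    ultimately show ?thesis by blast
  qed
  have B: "(\<exists>S\<subseteq>immediate_successors P a. finite S \<and> card S = n) \<longleftrightarrow>
      (\<exists>S\<subseteq>immediate_successors Q (H a). finite S \<and> card S = n)" for a n
  proof
    assume "\<exists>S\<subseteq>immediate_successors P a. finite S \<and> card S = n"
    then obtain S where "S \<subseteq> immediate_successors P a" "finite S" "card S = n" by blast
    then show "\<exists>S\<subseteq>immediate_successors Q (H a). finite S \<and> card S = n"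
      unfolding c by (intro exI[of _ "H ` S"]) (auto simp: card_image[OF inj])
  next
    assume "\<exists>S\<subseteq>immediate_successors Q (H a). finite S \<and> card S = n"
    then obtain S where "S \<subseteq> H ` immediate_successors P a" "finite S" "card S = n" unfolding c by blast
    moreover from this obtain S' where "S = H ` S'" "S' \<subseteq> immediate_successors P a"
      by (auto simp: subset_image_iff)
    ultimately show "\<exists>S\<subseteq>immediate_successors P a. finite S \<and> card S = n"
      by (intro exI[of _ S']) (auto simp: card_image[OF inj] finite_image_iff[OF inj])
  qed
  show ?L
    unfolding isomorphic_structs_def
  proof (intro exI[of _ H] conjI allI impI H(1))
    fix f and xs :: "nat list" assume "fun_arity tree_sig f = Some (length xs)"
    then obtain x where "xs = [x]"
      by (cases xs) (auto simp: tree_sig_def split: if_splits)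
    then show "H (fun_int (tree_struct P) f xs) = fun_int (tree_struct Q) f (map H xs)"
      using H(2) by simp
  next
    fix n and xs :: "nat list" assume "rel_arity tree_sig n = Some (length xs)"
    then obtain x where "xs = [x]"
      by (cases xs) (auto simp: tree_sig_def split: if_splits)
    then show "rel_int (tree_struct P) n xs = rel_int (tree_struct Q) n (map H xs)"
      using B[of x n] by simp
  qed
qed

text \<open>For the converse, each node is coloured by the whole sequence of its truncated types and
  the matching runs through all levels. Agreement of the successors at each height separately is
  lifted to agreement of these sequences by finite branching.\<close>

lemma isomorphic_trees_iff_tree_type:
  assumes P: "fb_tree P" and Q: "fb_tree Q"
  shows "isomorphic_structs tree_sig (tree_struct P) (tree_struct Q) \<longleftrightarrow> tree_type P = tree_type Q"
proof
  assume "isomorphic_structs tree_sig (tree_struct P) (tree_struct Q)"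
  then show "tree_type P = tree_type Q"
    unfolding isomorphic_tree_structs_iff using conjugate_tree_type[OF Q] by blast
next
  assume t: "tree_type P = tree_type Q"
  define \<tau> where "\<tau> P x n = ty P n x" for P x n
  have "\<exists>h. bij_betw h {x. enat (depth P x) \<le> \<infinity>} {y. enat (depth Q y) \<le> \<infinity>} \<and>
    (\<forall>x. enat (depth P x) \<le> \<infinity> \<longrightarrow> depth Q (h x) = depth P x \<and> h (P x) = Q (h x))"
  proof (rule level_isomorphism[OF P Q, of "\<tau> P" "\<tau> Q"])
    show "\<tau> P (tree_root P) = \<tau> Q (tree_root Q)"
      using t unfolding tree_type_def \<tau>_def by metis
  next
    fix x y assume "\<tau> P x = \<tau> Q y"
    then have "ty P (Suc n) x = ty Q (Suc n) y" for n unfolding \<tau>_def by metis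
    then have "image_mset (\<lambda>x. \<tau> P x n) (mset_set (immediate_successors P x)) =
        image_mset (\<lambda>x. \<tau> Q x n) (mset_set (immediate_successors Q y))" for n
      unfolding \<tau>_def by simp
    then show "image_mset (\<tau> P) (mset_set (immediate_successors P x)) =
        image_mset (\<tau> Q) (mset_set (immediate_successors Q y))"
    proof (rule image_mset_eq_of_all_levels[OF finite_children[OF P] finite_children[OF Q]])
      fix u v n
      assume "u \<in> \<tau> P ` immediate_successors P x \<union> \<tau> Q ` immediate_successors Q y"
        "v \<in> \<tau> P ` immediate_successors P x \<union> \<tau> Q ` immediate_successors Q y" "u (Suc n) = v (Suc n)"
      moreover from this obtain P1 x1 P2 x2 where "u = \<tau> P1 x1" "v = \<tau> P2 x2" by blast
      ultimately show "u n = v n" using ty_Suc_eqD unfolding \<tau>_def by metis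
    qed
  qed
  then show "isomorphic_structs tree_sig (tree_struct P) (tree_struct Q)"
    unfolding isomorphic_tree_structs_iff by auto
qed

subsection \<open>The space of diagrams\<close>

definition tree_diagram :: "(nat \<Rightarrow> nat) \<Rightarrow> nat \<Rightarrow> bool" where
  "tree_diagram P = atomic_diagram tree_sig (tree_struct P)"

lemma tree_diagrams: "diagrams tree_sig FBT_structs = tree_diagram ` {P. fb_tree P}"
  unfolding diagrams_def FBT_structs_def tree_diagram_def fb_tree_def by auto

lemma tree_diagram_inj: "tree_diagram P = tree_diagram Q \<longleftrightarrow> P = Q"
proof
  assume "tree_diagram P = tree_diagram Q"
  then have "P x = Q x" for x
    using atomic_diagram_eqD(1)[of tree_sig "tree_struct P" "tree_struct Q" 0 "[x]"]
    unfolding tree_diagram_def by (simp add: tree_sig_def)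
  then show "P = Q" by blast
qed simp

text \<open>Evaluating a term consults finitely many values of \<open>P\<close>; the bound exceeds
  those for the subterms and reaches the depth of the node to which \<open>P\<close> is finally
  applied.\<close>

lemma cterm_val_agree:
  "\<exists>n. \<forall>Q. agree n P Q \<longrightarrow> cterm_val (tree_struct Q) s = cterm_val (tree_struct P) s"
proof (induction s)
  case (App f ts)
  then obtain k where k: "\<And>s Q. s \<in> set ts \<Longrightarrow> agree (k s) P Q \<Longrightarrow>
      cterm_val (tree_struct Q) s = cterm_val (tree_struct P) s" by metis
  let ?a = "hd (map (cterm_val (tree_struct P)) ts)"
  define n where "n = Max (insert (depth P ?a) (k ` set ts))"
  have n: "depth P ?a \<le> n" "\<And>s. s \<in> set ts \<Longrightarrow> k s \<le> n" unfolding n_def by auto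
  have "cterm_val (tree_struct Q) (App f ts) = cterm_val (tree_struct P) (App f ts)"
    if "agree n P Q" for Q
  proof -
    have "map (cterm_val (tree_struct Q)) ts = map (cterm_val (tree_struct P)) ts"
      using k agree_mono[OF that] n(2) by (intro map_cong refl) blast
    moreover have "Q ?a = P ?a" using that n(1) unfolding agree_def by blast
    ultimately show ?thesis by (simp only: cterm_val.simps tree_struct_sel)
  qed
  then show ?case by blast
qed simp

lemma holds_agree:
  "\<exists>n. \<forall>Q. agree n P Q \<longrightarrow> holds (tree_struct Q) \<phi> = holds (tree_struct P) \<phi>"
proof (cases \<phi>)
  case (Eq s t)
  obtain m n where "\<And>Q. agree m P Q \<Longrightarrow> cterm_val (tree_struct Q) s = cterm_val (tree_struct P) s"
    "\<And>Q. agree n P Q \<Longrightarrow> cterm_val (tree_struct Q) t = cterm_val (tree_struct P) t"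
    using cterm_val_agree by metis
  then show ?thesis using Eq agree_mono[of "max m n" P] by (intro exI[of _ "max m n"]) auto
next
  case (Rel r ts)
  obtain k where k: "\<And>s Q. agree (k s) P Q \<Longrightarrow>
      cterm_val (tree_struct Q) s = cterm_val (tree_struct P) s" using cterm_val_agree by metis
  let ?a = "hd (map (cterm_val (tree_struct P)) ts)"
  \<comment> \<open>The successor on the depth matters: \<open>agree\<close> controls successor sets
    only strictly below level \<open>n\<close>.\<close>
  define n where "n = Max (insert (Suc (depth P ?a)) (k ` set ts))"
  have n: "Suc (depth P ?a) \<le> n" "\<And>s. s \<in> set ts \<Longrightarrow> k s \<le> n" unfolding n_def by auto
  have "holds (tree_struct Q) \<phi> = holds (tree_struct P) \<phi>" if "agree n P Q" for Q
  proof -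
    have "map (cterm_val (tree_struct Q)) ts = map (cterm_val (tree_struct P)) ts"
      using k agree_mono[OF that] n(2) by (intro map_cong refl) blast
    moreover have "immediate_successors Q ?a = immediate_successors P ?a"
      using that n(1) unfolding agree_def by simp
    ultimately show ?thesis by (simp only: Rel holds.simps tree_struct_sel)
  qed
  then show ?thesis by blast
qed

lemma tree_diagram_agree: "\<exists>n. \<forall>Q. agree n P Q \<longrightarrow> tree_diagram Q c = tree_diagram P c"
proof (cases "\<exists>\<phi>. wf_atom tree_sig \<phi> \<and> atom_code \<phi> = c")
  case True
  then show ?thesis
    using holds_agree atomic_diagram_code unfolding tree_diagram_def by metis
next
  case False
  then show ?thesis unfolding tree_diagram_def atomic_diagram_def by blast
qed

text \<open>For each node \<open>x\<close> up to level \<open>n\<close>, two atoms are inspected: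
  its predecessor equation and the first branching predicate that fails at \<open>x\<close>. The
  equations keep the old successors, and the failing predicate bounds their number, which excludes
  new ones; no finite set of predecessor equations could do that.\<close>

lemma agree_of_tree_diagram:
  assumes P: "fb_tree P"
  shows "\<exists>m. \<forall>Q. fb_tree Q \<longrightarrow> (\<forall>c<m. tree_diagram Q c = tree_diagram P c) \<longrightarrow> agree n P Q"
proof -
  let ?pred = "\<lambda>x. Eq (App 0 [Elem x]) (Elem (P x))"
  let ?br = "\<lambda>x. Rel (Suc (card (immediate_successors P x))) [Elem x]"
  let ?A = "{x. depth P x \<le> n}"
  have "finite (atom_code ` (?pred ` ?A \<union> ?br ` ?A))" using finite_depth_le[OF P] by simp
  then obtain m where m: "atom_code ` (?pred ` ?A \<union> ?br ` ?A) \<subseteq> {..<m}"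
    using finite_nat_iff_bounded by blast
  have "agree n P Q" if Q: "fb_tree Q" and c: "\<forall>c<m. tree_diagram Q c = tree_diagram P c" for Q
  proof -
    have Q_eq: "Q x = P x" if x: "depth P x \<le> n" for x
    proof -
      have "wf_atom tree_sig (?pred x)" by (simp add: tree_sig_def)
      moreover have "atom_code (?pred x) \<in> atom_code ` (?pred ` ?A \<union> ?br ` ?A)" using x by blast
      then have "atom_code (?pred x) < m" using m by blast
      ultimately have "holds (tree_struct Q) (?pred x) = holds (tree_struct P) (?pred x)"
        using c atomic_diagram_code unfolding tree_diagram_def by metis
      then show ?thesis by simp
    qed
    have "immediate_successors Q x = immediate_successors P x" if x: "depth P x < n" for x
    proof -
      have "wf_atom tree_sig (?br x)" by (simp add: tree_sig_def)
      moreover have "atom_code (?br x) \<in> atom_code ` (?pred ` ?A \<union> ?br ` ?A)"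
        using x by (intro imageI UnI2) simp
      then have "atom_code (?br x) < m" using m by blast
      ultimately have "holds (tree_struct Q) (?br x) = holds (tree_struct P) (?br x)"
        using c atomic_diagram_code unfolding tree_diagram_def by metis
      moreover have "\<not> holds (tree_struct P) (?br x)"
      proof
        assume "holds (tree_struct P) (?br x)"
        then obtain S where "S \<subseteq> immediate_successors P x" "card S = Suc (card (immediate_successors P x))"
          by auto
        then show False using card_mono[OF finite_children[OF P], of S x] by simp
      qed
      ultimately have not_holds: "\<not> holds (tree_struct Q) (?br x)" by blast
      have "\<not> Suc (card (immediate_successors P x)) \<le> card (immediate_successors Q x)"
      proof
        assume "Suc (card (immediate_successors P x)) \<le> card (immediate_successors Q x)"
        then obtain S where "S \<subseteq> immediate_successors Q x"
          "card S = Suc (card (immediate_successors P x))" "finite S"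
          by (rule obtain_subset_with_card_n)
        then show False using not_holds by auto
      qed
      then have le: "card (immediate_successors Q x) \<le> card (immediate_successors P x)" by simp
      have "immediate_successors P x \<subseteq> immediate_successors Q x"
      proof
        fix y assume y: "y \<in> immediate_successors P x"
        then have "Q y = P y" using Q_eq depth_children[OF P y] x by simp
        then show "y \<in> immediate_successors Q x" using y unfolding immediate_successors_def by simp
      qed
      from card_seteq[OF finite_children[OF Q] this le] show ?thesis ..
    qed
    then show ?thesis unfolding agree_def using Q_eq by blast
  qed
  then show ?thesis by blast
qed

text \<open>Around the diagram of a tree, cylinders and sets of trees agreeing up to a level refine
  each other, by the two preceding lemmas.\<close>

lemma openin_tree_diagrams:
  "openin (subtopology cantor_space (diagrams tree_sig FBT_structs)) U \<longleftrightarrow>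
    U \<subseteq> diagrams tree_sig FBT_structs \<and>
    (\<forall>P. fb_tree P \<longrightarrow> tree_diagram P \<in> U \<longrightarrow>
      (\<exists>n. \<forall>Q. fb_tree Q \<longrightarrow> agree n P Q \<longrightarrow> tree_diagram Q \<in> U))" (is "?L \<longleftrightarrow> _ \<and> ?R")
proof -
  have "(\<exists>m. \<forall>g\<in>diagrams tree_sig FBT_structs. (\<forall>i<m. g i = tree_diagram P i) \<longrightarrow> g \<in> U) \<longleftrightarrow>
      (\<exists>n. \<forall>Q. fb_tree Q \<longrightarrow> agree n P Q \<longrightarrow> tree_diagram Q \<in> U)" if P: "fb_tree P" for P
  proof
    assume "\<exists>m. \<forall>g\<in>diagrams tree_sig FBT_structs. (\<forall>i<m. g i = tree_diagram P i) \<longrightarrow> g \<in> U"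
    then obtain m where m': "\<forall>g\<in>diagrams tree_sig FBT_structs.
        (\<forall>i<m. g i = tree_diagram P i) \<longrightarrow> g \<in> U" by blast
    have m: "tree_diagram Q \<in> U" if "fb_tree Q" "\<forall>i<m. tree_diagram Q i = tree_diagram P i" for Q
      using bspec[OF m', of "tree_diagram Q"] that unfolding tree_diagrams by blast
    obtain k where k: "\<And>i Q. agree (k i) P Q \<Longrightarrow> tree_diagram Q i = tree_diagram P i"
      using tree_diagram_agree by metis
    define n where "n = Max (insert 0 (k ` {..<m}))"
    have "k i \<le> n" if "i < m" for i unfolding n_def using that by (intro Max_ge) auto
    then have "tree_diagram Q \<in> U" if "fb_tree Q" "agree n P Q" for Q
      using m[OF that(1)] k agree_mono[OF that(2)] by blast
    then show "\<exists>n. \<forall>Q. fb_tree Q \<longrightarrow> agree n P Q \<longrightarrow> tree_diagram Q \<in> U" by blast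
  next
    assume "\<exists>n. \<forall>Q. fb_tree Q \<longrightarrow> agree n P Q \<longrightarrow> tree_diagram Q \<in> U"
    then show "\<exists>m. \<forall>g\<in>diagrams tree_sig FBT_structs. (\<forall>i<m. g i = tree_diagram P i) \<longrightarrow> g \<in> U"
      using agree_of_tree_diagram[OF P] unfolding tree_diagrams by (metis (no_types, lifting) imageE mem_Collect_eq)
  qed
  then have 1: "(\<forall>P. fb_tree P \<longrightarrow> tree_diagram P \<in> U \<longrightarrow>
      (\<exists>m. \<forall>g\<in>diagrams tree_sig FBT_structs. (\<forall>i<m. g i = tree_diagram P i) \<longrightarrow> g \<in> U)) \<longleftrightarrow> ?R"
    by blast
  have 2: "(\<forall>f\<in>U. \<Phi> f) \<longleftrightarrow> (\<forall>P. fb_tree P \<longrightarrow> tree_diagram P \<in> U \<longrightarrow> \<Phi> (tree_diagram P))"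
    if "U \<subseteq> diagrams tree_sig FBT_structs" for \<Phi>
    using that unfolding tree_diagrams by blast
  show ?thesis
  proof (cases "U \<subseteq> diagrams tree_sig FBT_structs")
    case True
    show ?thesis
      unfolding cantor_space_def openin_subtopology_sequence_space 2[OF True] 1 ..
  next
    case False
    then show ?thesis unfolding cantor_space_def openin_subtopology_sequence_space by blast
  qed
qed

subsection \<open>Limits and splitting\<close>

lemma agree_limit:
  assumes T: "\<And>n. fb_tree (T n)" and ag: "\<And>n. agree n (T n) (T (Suc n))"
    and ex: "\<And>x. depth (T (Suc x)) x \<le> Suc x"
  shows "\<exists>P. fb_tree P \<and> (\<forall>n. agree n (T n) P)"
proof -
  have ag': "agree n (T n) (T m)" if "n \<le> m" for n m
    using that
  proof (induction rule: dec_induct)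
    case base
    then show ?case by (rule agree_refl)
  next
    case (step m)
    then show ?case using agree_trans[OF T T] agree_mono[OF ag] by (metis less_imp_le)
  qed
  define P where "P x = T (Suc x) x" for x
  have P_eq: "P x = T m x" if "depth (T n) x \<le> n" "n \<le> m" for x n m
  proof -
    \<comment> \<open>A common later stage at which both readings of the predecessor of
      \<open>x\<close> are already final.\<close>
    let ?k = "max m (Suc x)"
    have "T ?k x = T n x" using ag'[of n ?k] that unfolding agree_def by simp
    moreover have "T ?k x = P x" using ag'[of "Suc x" ?k] ex unfolding agree_def P_def by simp
    moreover have "T m x = T n x" using ag' that unfolding agree_def by simp
    ultimately show ?thesis by simp
  qed
  have depth_eq: "depth (T m) x = depth (T n) x" if "depth (T n) x \<le> n" "n \<le> m" for x n m
    using agree_depth(2)[OF T T ag'[OF that(2)] that(1)] .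
  have P_T: "P x = T m x" if "Suc x \<le> m" for x m
    using P_eq[OF ex that] .
  have succ: "immediate_successors P x = immediate_successors (T m) x" if x: "depth (T m) x < m" for x m
  proof (unfold set_eq_iff, intro allI)
    fix y
    let ?k = "max m (Suc y)"
    have "y \<in> immediate_successors P x \<longleftrightarrow> y \<in> immediate_successors (T ?k) x"
      unfolding immediate_successors_def using P_T[of y ?k] by simp
    also have "immediate_successors (T ?k) x = immediate_successors (T m) x"
      using ag'[of m ?k] x unfolding agree_def by simp
    finally show "y \<in> immediate_successors P x \<longleftrightarrow> y \<in> immediate_successors (T m) x" .
  qed
  define r where "r = tree_root (T 0)"
  have r: "tree_root (T n) = r" for n
    unfolding r_def using agree_depth(1)[OF T T ag', of 0 n] by blast
  have "fb_tree P"
  \<comment> \<open>By \<open>depth_eq\<close>, this rank is the depth of \<open>x\<close> at every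
    stage from \<open>Suc x\<close> on, so the ranks of \<open>x\<close> and \<open>P x\<close> can
    be compared at a common stage.\<close>
  proof (rule fb_treeI[where r = r and d = "\<lambda>x. depth (T (Suc x)) x"])
    show "P r = r" unfolding P_def using root_fixed[OF T] r by metis
  next
    fix x assume "x \<noteq> r"
    let ?k = "max (Suc x) (Suc (P x))"
    have "P x = T ?k x" by (rule P_T) simp
    then have "depth (T ?k) (P x) < depth (T ?k) x"
      using depth_nonroot[OF T, of x ?k] r \<open>x \<noteq> r\<close> by simp
    then show "depth (T (Suc (P x))) (P x) < depth (T (Suc x)) x"
      using depth_eq[OF ex[of x], of ?k] depth_eq[OF ex[of "P x"], of ?k] by simp
  next
    fix a
    have "depth (T (Suc (Suc a))) a < Suc (Suc a)"
      using depth_eq[OF ex[of a], of "Suc (Suc a)"] ex[of a] by simp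
    then show "finite (immediate_successors P a)" using succ finite_children[OF T] by simp
  qed
  moreover have "agree n (T n) P" for n
    unfolding agree_def using P_eq succ by blast
  ultimately show ?thesis by blast
qed

text \<open>Replacing each tree by a copy that agrees with the previous one up to level \<open>n\<close> gives a limit;
  putting the number \<open>n\<close> at level at most \<open>n + 1\<close> ensures that the limit has domain \<open>\<omega>\<close>.\<close>

lemma tree_types_complete:
  assumes T: "\<And>n. fb_tree (T n)" and t: "\<And>n. tree_type (T (Suc n)) n = tree_type (T n) n"
  shows "\<exists>P. fb_tree P \<and> (\<forall>n. tree_type P n = tree_type (T n) n)"
proof -
  have "\<exists>T'. \<forall>n. (fb_tree (T' n) \<and> tree_type (T' n) = tree_type (T n)) \<and>
      (agree n (T' n) (T' (Suc n)) \<and> depth (T' (Suc n)) n \<le> Suc n)"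
  proof (rule dependent_nat_choice)
    show "\<exists>P. fb_tree P \<and> tree_type P = tree_type (T 0)" using T by blast
    fix P n assume P: "fb_tree P \<and> tree_type P = tree_type (T n)"
    then have "tree_type P n = tree_type (T (Suc n)) n" using t by simp
    then obtain Q H where "bij H" "\<forall>x. H (Q x) = T (Suc n) (H x)" "fb_tree Q"
      "agree n P Q" "depth Q n \<le> Suc n"
      using agreeing_copy[of P "T (Suc n)" n n] P T by blast
    then show "\<exists>Q. (fb_tree Q \<and> tree_type Q = tree_type (T (Suc n))) \<and>
        (agree n P Q \<and> depth Q n \<le> Suc n)"
      using conjugate_tree_type[OF T] by blast
  qed
  then obtain T' where T': "\<And>n. fb_tree (T' n)" "\<And>n. tree_type (T' n) = tree_type (T n)"
    "\<And>n. agree n (T' n) (T' (Suc n))" "\<And>n. depth (T' (Suc n)) n \<le> Suc n" by blast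
  then obtain P where "fb_tree P" "\<And>n. agree n (T' n) P" using agree_limit[of T'] by blast
  then show ?thesis using agree_tree_type T'(1,2) by metis
qed

text \<open>Hanging \<open>k\<close> deep nodes on a node of level \<open>n\<close> preserves the
  truncation at \<open>n\<close> but puts at least \<open>k\<close> nodes into the one at
  \<open>n + 1\<close>. If only finitely many types occurred, infinitely many \<open>k\<close> would
  share one, although a type fixes the size of the truncation.\<close>

lemma infinite_tree_types:
  assumes P: "fb_tree P"
  shows "infinite {tree_type Q (Suc n) |Q. fb_tree Q \<and> tree_type Q n = tree_type P n}" (is "infinite ?S")
proof
  assume S: "finite ?S"
  obtain a where a: "depth P a = n" using ex_depth[OF P] by blast
  have "infinite (- {x. depth P x \<le> Suc n})"
    using finite_depth_le[OF P] by (simp add: Compl_eq_Diff_UNIV)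
  then have ex_deep: "\<exists>D. D \<subseteq> - {x. depth P x \<le> Suc n} \<and> finite D \<and> card D = k" for k
    using infinite_arbitrarily_large by blast
  obtain D where D: "\<And>k. D k \<subseteq> - {x. depth P x \<le> Suc n}" "\<And>k. finite (D k)" "\<And>k. card (D k) = k"
    using ex_deep by metis
  \<comment> \<open>\<open>D k\<close> consists of \<open>k\<close> nodes beyond level
    \<open>n + 1\<close>; they move to level \<open>n + 1\<close> as successors of \<open>a\<close>,
    while all other predecessors stay the same.\<close>
  define Q where "Q k x = (if x \<in> D k then a else P x)" for k x
  have rD: "tree_root P \<notin> D k" for k using D(1)[of k] depth_root[of P] by auto
  have Q: "fb_tree (Q k)" for k
  \<comment> \<open>The old depth still drops along \<open>Q k\<close>, since a moved node lies
    beyond level \<open>n + 1\<close> and its new predecessor \<open>a\<close> has depth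
    \<open>n\<close>.\<close>
  proof (rule fb_treeI[where r = "tree_root P" and d = "depth P"])
    show "Q k (tree_root P) = tree_root P" using rD root_fixed[OF P] unfolding Q_def by simp
    show "depth P (Q k x) < depth P x" if "x \<noteq> tree_root P" for x
      using depth_nonroot[OF P that] D(1)[of k] a unfolding Q_def by auto
    show "finite (immediate_successors (Q k) x)" for x
      by (rule finite_subset[of _ "immediate_successors P x \<union> D k"])
        (use finite_children[OF P] D(2) in \<open>auto simp: immediate_successors_def Q_def\<close>)
  qed
  have "immediate_successors (Q k) x = immediate_successors P x" if x: "depth P x < n" for k x
  proof -
    have "y \<notin> D k" if "y \<in> immediate_successors P x" for y
      using depth_children[OF P that] x D(1)[of k] by auto
    then show ?thesis using x a unfolding immediate_successors_def Q_def by auto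
  qed
  then have ag: "agree n P (Q k)" for k
    unfolding agree_def using D(1)[of k] by (auto simp: Q_def)
  have "range (\<lambda>k. tree_type (Q k) (Suc n)) \<subseteq> ?S"
    using Q agree_tree_type[OF P Q ag] by blast
  then have "finite (range (\<lambda>k. tree_type (Q k) (Suc n)))" using S finite_subset by blast
  then obtain k0 where k0: "infinite {k. tree_type (Q k) (Suc n) = tree_type (Q k0) (Suc n)}"
    using pigeonhole_infinite[of UNIV "\<lambda>k. tree_type (Q k) (Suc n)"] by auto
  let ?L = "\<lambda>k. {x. depth (Q k) x \<le> Suc n}"
  obtain k where k: "tree_type (Q k) (Suc n) = tree_type (Q k0) (Suc n)" "card (?L k0) < k"
    using k0 unfolding infinite_nat_iff_unbounded by blast
  have "depth (Q k) x \<le> Suc n" if "x \<in> D k" for x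
  proof -
    have "x \<noteq> tree_root (Q k)" using that rD agree_depth(1)[OF P Q ag] by metis
    moreover have "depth (Q k) a = n" using agree_depth(2)[OF P Q ag, of a] a by simp
    ultimately show ?thesis using depth_nonroot[OF Q, of x k] that unfolding Q_def by simp
  qed
  then have "k \<le> card (?L k)"
    using card_mono[OF finite_depth_le[OF Q], of "D k" k "Suc n"] D(3)[of k] by auto
  \<comment> \<open>Equal types yield a copy of \<open>Q k0\<close> agreeing with \<open>Q k\<close>
    up to level \<open>n + 1\<close>, so a permutation carries one truncation onto the
    other.\<close>
  moreover have "card (?L k) = card (?L k0)"
  proof -
    obtain Q' H where H: "bij H" "\<forall>x. H (Q' x) = Q k0 (H x)" "fb_tree Q'" "agree (Suc n) (Q k) Q'"
      using agreeing_copy[OF Q Q k(1)] by blast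
    have "depth (Q k) x \<le> Suc n \<longleftrightarrow> depth Q' x \<le> Suc n" for x
      using agree_depth(2,3)[OF Q H(3,4), of x] by auto
    then have "card (?L k) = card (H -` ?L k0)" using conjugate_depth[OF Q H(1)] H(2) by simp
    also have "\<dots> = card (?L k0)"
      using H(1) by (intro card_vimage_inj) (simp_all add: bij_is_inj bij_is_surj)
    finally show ?thesis .
  qed
  ultimately show False using k(2) by simp
qed

theorem FBT_iso_space_homeomorphic_baire_space: "FBT_iso_space homeomorphic_space baire_space"
proof -
  let ?D = "diagrams tree_sig FBT_structs"
  let ?Y = "subtopology cantor_space ?D"
  have top: "topspace ?Y = ?D" by (simp add: cantor_space_def)
  define t where "t d = tree_type (inv_into UNIV tree_diagram d)" for d
  have t: "t (tree_diagram P) = tree_type P" for P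
    unfolding t_def using tree_diagram_inj by (metis inv_into_f_f inj_def UNIV_I)
  have iso: "(tree_diagram P, tree_diagram Q) \<in> diagram_iso tree_sig FBT_structs \<longleftrightarrow> tree_type P = tree_type Q"
    if P: "fb_tree P" and Q: "fb_tree Q" for P Q
  proof -
    have "(tree_diagram P, tree_diagram Q) \<in> diagram_iso tree_sig FBT_structs \<longleftrightarrow>
        isomorphic_structs tree_sig (tree_struct P) (tree_struct Q)"
    proof
      assume "(tree_diagram P, tree_diagram Q) \<in> diagram_iso tree_sig FBT_structs"
      then obtain P' Q' where "tree_diagram P = tree_diagram P'" "tree_diagram Q = tree_diagram Q'"
        "isomorphic_structs tree_sig (tree_struct P') (tree_struct Q')"
        unfolding diagram_iso_def FBT_structs_def tree_diagram_def by auto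
      then show "isomorphic_structs tree_sig (tree_struct P) (tree_struct Q)"
        unfolding tree_diagram_inj by simp
    next
      assume "isomorphic_structs tree_sig (tree_struct P) (tree_struct Q)"
      then show "(tree_diagram P, tree_diagram Q) \<in> diagram_iso tree_sig FBT_structs"
        unfolding diagram_iso_def FBT_structs_def tree_diagram_def
        using P Q unfolding fb_tree_def by blast
    qed
    then show ?thesis using isomorphic_trees_iff_tree_type[OF P Q] by simp
  qed
  have "quotient_topology ?Y (diagram_iso tree_sig FBT_structs) homeomorphic_space baire_space"
  proof (rule quotient_homeomorphic_baire_space[where t = t], unfold top)
    \<comment> \<open>The infinite chain shows that trees exist; truncated subtraction makes 0 its
      own predecessor.\<close>
    have "fb_tree (\<lambda>x. x - 1)"
    proof (rule fb_treeI[where r = 0 and d = id])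
      show "finite (immediate_successors (\<lambda>x. x - 1) a)" for a
        by (rule finite_subset[of _ "{..Suc a}"]) (auto simp: immediate_successors_def)
    qed auto
    then show "?D \<noteq> {}" unfolding tree_diagrams by blast
    show "equiv ?D (diagram_iso tree_sig FBT_structs)" by (rule equiv_diagram_iso)
  next
    fix x y assume "x \<in> ?D" "y \<in> ?D"
    then obtain P Q where PQ: "x = tree_diagram P" "y = tree_diagram Q" "fb_tree P" "fb_tree Q"
      unfolding tree_diagrams by blast
    show "(x, y) \<in> diagram_iso tree_sig FBT_structs \<longleftrightarrow> (\<forall>n. t x n = t y n)"
      unfolding PQ(1,2) iso[OF PQ(3,4)] t by (rule fun_eq_iff)
    show "t x 0 = t y 0" unfolding PQ(1,2) t tree_type_def by simp
    show "t x n = t y n" if "t x (Suc n) = t y (Suc n)" for n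
      using that unfolding PQ(1,2) t tree_type_def by (rule ty_Suc_eqD)
  next
    fix x n assume "x \<in> ?D"
    then obtain P where P: "x = tree_diagram P" "fb_tree P" unfolding tree_diagrams by blast
    show "openin ?Y {y \<in> ?D. t y n = t x n}"
      unfolding openin_tree_diagrams
    proof (intro conjI allI impI)
      fix Q assume Q: "fb_tree Q" "tree_diagram Q \<in> {y \<in> ?D. t y n = t x n}"
      have "tree_diagram Q' \<in> {y \<in> ?D. t y n = t x n}" if "fb_tree Q'" "agree n Q Q'" for Q'
        using agree_tree_type[OF Q(1) that] Q(2) that(1) unfolding tree_diagrams by (simp add: t)
      then show "\<exists>n'. \<forall>Q'. fb_tree Q' \<longrightarrow> agree n' Q Q' \<longrightarrow>
          tree_diagram Q' \<in> {y \<in> ?D. t y n = t x n}" by blast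
    qed blast
    have "{t y (Suc n) |y. y \<in> ?D \<and> t y n = t x n} = (\<lambda>y. t y (Suc n)) ` {y \<in> ?D. t y n = t x n}"
      by blast
    also have "{y \<in> ?D. t y n = t x n} = tree_diagram ` {Q. fb_tree Q \<and> tree_type Q n = tree_type P n}"
      unfolding tree_diagrams P(1) using t by auto
    also have "(\<lambda>y. t y (Suc n)) ` \<dots> =
        {tree_type Q (Suc n) |Q. fb_tree Q \<and> tree_type Q n = tree_type P n}"
      unfolding image_image t by blast
    finally have "{t y (Suc n) |y. y \<in> ?D \<and> t y n = t x n} =
        {tree_type Q (Suc n) |Q. fb_tree Q \<and> tree_type Q n = tree_type P n}" .
    then show "infinite {t y (Suc n) |y. y \<in> ?D \<and> t y n = t x n}"
      using infinite_tree_types[OF P(2)] by simp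
  next
    fix U x
    assume U: "openin ?Y U" "\<And>y z. y \<in> U \<Longrightarrow> (y, z) \<in> diagram_iso tree_sig FBT_structs \<Longrightarrow> z \<in> U"
      and x: "x \<in> U"
    have "x \<in> ?D" using openin_subset[OF U(1)] x unfolding top by blast
    then obtain P where P: "x = tree_diagram P" "fb_tree P" unfolding tree_diagrams by blast
    then obtain n where n: "\<And>Q. fb_tree Q \<Longrightarrow> agree n P Q \<Longrightarrow> tree_diagram Q \<in> U"
      using U(1) x unfolding openin_tree_diagrams by blast
    \<comment> \<open>The copy of \<open>Q\<close> that agrees with \<open>P\<close> up to level
      \<open>n\<close> has its diagram in \<open>U\<close>; since \<open>U\<close> is closed under
      isomorphism, \<open>Q\<close> itself follows.\<close>
    have "tree_diagram Q \<in> U" if Q: "fb_tree Q" "tree_type Q n = tree_type P n" for Q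
    proof -
      obtain Q' H where H: "bij H" "\<forall>x. H (Q' x) = Q (H x)" "fb_tree Q'" "agree n P Q'"
        using agreeing_copy[OF P(2) Q(1) Q(2)[symmetric]] by blast
      have "tree_type Q' = tree_type Q" using conjugate_tree_type[OF Q(1) H(1)] H(2) by blast
      then show ?thesis using U(2)[OF n[OF H(3,4)]] iso[OF H(3) Q(1)] by blast
    qed
    then show "\<exists>n. \<forall>y\<in>?D. t y n = t x n \<longrightarrow> y \<in> U"
      unfolding tree_diagrams P(1) by (auto simp: t)
  next
    fix x :: "nat \<Rightarrow> nat \<Rightarrow> bool"
    assume x: "\<And>n. x n \<in> ?D" "\<And>n. t (x (Suc n)) n = t (x n) n"
    have "\<exists>P. x n = tree_diagram P \<and> fb_tree P" for n
      using x(1)[of n] unfolding tree_diagrams by blast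
    then obtain T where T: "\<And>n. x n = tree_diagram (T n)" "\<And>n. fb_tree (T n)" by metis
    obtain P where "fb_tree P" "\<And>n. tree_type P n = tree_type (T n) n"
      using tree_types_complete[of T] T(2) x(2) unfolding T(1) t by blast
    then show "\<exists>y\<in>?D. \<forall>n. t y n = t (x n) n"
      unfolding tree_diagrams T(1) by (auto simp: t)
  qed
  then show ?thesis unfolding FBT_iso_space_def iso_space_def .
qed

section \<open>Algebraic fields as subfields of the complex numbers\<close>

text \<open>Division by 0 yields 0, which is \<open>1 - 1\<close>, so closure under quotients may
  include zero denominators.\<close>

definition complex_subfield :: "complex set \<Rightarrow> bool" where
  "complex_subfield K \<longleftrightarrow> 1 \<in> K \<and> (\<forall>x\<in>K. \<forall>y\<in>K. x - y \<in> K \<and> x / y \<in> K)"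

lemma
  assumes "complex_subfield K"
  shows complex_subfield_0: "0 \<in> K" and complex_subfield_1: "1 \<in> K"
    and complex_subfield_diff: "x \<in> K \<Longrightarrow> y \<in> K \<Longrightarrow> x - y \<in> K"
    and complex_subfield_divide: "x \<in> K \<Longrightarrow> y \<in> K \<Longrightarrow> x / y \<in> K"
    and complex_subfield_minus: "x \<in> K \<Longrightarrow> - x \<in> K"
    and complex_subfield_add: "x \<in> K \<Longrightarrow> y \<in> K \<Longrightarrow> x + y \<in> K"
    and complex_subfield_mult: "x \<in> K \<Longrightarrow> y \<in> K \<Longrightarrow> x * y \<in> K"
proof -
  show one: "1 \<in> K" and diff: "\<And>x y. x \<in> K \<Longrightarrow> y \<in> K \<Longrightarrow> x - y \<in> K"
    and divide: "\<And>x y. x \<in> K \<Longrightarrow> y \<in> K \<Longrightarrow> x / y \<in> K"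
    using assms unfolding complex_subfield_def by blast+
  show zero: "0 \<in> K" using diff[OF one one] by simp
  show minus: "\<And>x. x \<in> K \<Longrightarrow> - x \<in> K" using diff[OF zero] by force
  show "x \<in> K \<Longrightarrow> y \<in> K \<Longrightarrow> x + y \<in> K" using diff[of x "- y"] minus by simp
  show "x \<in> K \<Longrightarrow> y \<in> K \<Longrightarrow> x * y \<in> K" using divide[of x "1 / y"] divide[OF one, of y] by simp
qed

lemma complex_subfield_of_nat: "complex_subfield K \<Longrightarrow> of_nat n \<in> K"
  by (induction n) (auto intro: complex_subfield_0 complex_subfield_1 complex_subfield_add)

definition algebraic_numbering :: "(nat \<Rightarrow> complex) \<Rightarrow> bool" where
  "algebraic_numbering \<iota> \<longleftrightarrow> inj \<iota> \<and> complex_subfield (range \<iota>) \<and> (\<forall>a. Polynomial.algebraic (\<iota> a))"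

text \<open>The structure on \<omega> for which \<open>\<iota>\<close> is an isomorphism onto its
  range. By \<open>ex_algebraic_numbering\<close> below, every field under consideration has this
  form.\<close>

definition numbered_field :: "(nat \<Rightarrow> complex) \<Rightarrow> nat ring" where
  "numbered_field \<iota> =
    \<lparr>carrier = UNIV,
     monoid.mult = (\<lambda>a b. inv_into UNIV \<iota> (\<iota> a * \<iota> b)),
     one = inv_into UNIV \<iota> 1,
     zero = inv_into UNIV \<iota> 0,
     add = (\<lambda>a b. inv_into UNIV \<iota> (\<iota> a + \<iota> b))\<rparr>"

lemma poly_Poly_snoc:
  fixes z :: "'a::comm_semiring_1"
  shows "poly (Poly (xs @ [c])) z = poly (Poly xs) z + c * z ^ length xs"
  by (simp add: Poly_snoc Polynomial.poly_monom)

text \<open>The list polynomials of \<open>R\<close> start with the leading coefficient, whereas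
  \<open>Poly\<close> expects the constant term first; hence the reversal.\<close>

lemma hom_eval:
  assumes "ring R" and x: "x \<in> carrier R" and p: "set p \<subseteq> carrier R"
    and hom_add: "\<And>a b. a \<in> carrier R \<Longrightarrow> b \<in> carrier R \<Longrightarrow> \<iota> (a \<oplus>\<^bsub>R\<^esub> b) = \<iota> a + \<iota> b"
    and hom_mult: "\<And>a b. a \<in> carrier R \<Longrightarrow> b \<in> carrier R \<Longrightarrow> \<iota> (a \<otimes>\<^bsub>R\<^esub> b) = \<iota> a * \<iota> b"
    and hom_zero: "\<iota> \<zero>\<^bsub>R\<^esub> = 0" and hom_one: "\<iota> \<one>\<^bsub>R\<^esub> = 1"
  shows "\<iota> (ring.eval R p x) = poly (Poly (rev (map \<iota> p))) (\<iota> x :: complex)"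
proof -
  interpret ring R by fact
  have pow: "\<iota> (x [^]\<^bsub>R\<^esub> n) = \<iota> x ^ n" for n :: nat
    using x by (induction n) (simp_all add: hom_one hom_mult mult.commute)
  show ?thesis
    using p
  proof (induction p)
    case (Cons a p)
    have "eval p x \<in> carrier R" using Cons.prems x by (intro eval_in_carrier) auto
    then show ?case
      using Cons x by (simp add: hom_add hom_mult pow poly_Poly_snoc add.commute)
  qed (simp add: hom_zero)
qed

context
  fixes \<iota> :: "nat \<Rightarrow> complex"
  assumes \<iota>: "algebraic_numbering \<iota>"
begin

lemma numbering_inj: "inj \<iota>" and numbering_subfield: "complex_subfield (range \<iota>)"
  and numbering_algebraic: "Polynomial.algebraic (\<iota> a)"
  using \<iota> unfolding algebraic_numbering_def by auto

lemma numbering_eq_iff: "\<iota> a = \<iota> b \<longleftrightarrow> a = b"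
  using numbering_inj by (rule inj_eq)

lemma numbering_inv: "z \<in> range \<iota> \<Longrightarrow> \<iota> (inv_into UNIV \<iota> z) = z"
  by (rule f_inv_into_f)

lemma numbered_field_sel:
  "carrier (numbered_field \<iota>) = UNIV"
  "\<iota> (a \<otimes>\<^bsub>numbered_field \<iota>\<^esub> b) = \<iota> a * \<iota> b"
  "\<iota> (a \<oplus>\<^bsub>numbered_field \<iota>\<^esub> b) = \<iota> a + \<iota> b"
  "\<iota> \<one>\<^bsub>numbered_field \<iota>\<^esub> = 1"
  "\<iota> \<zero>\<^bsub>numbered_field \<iota>\<^esub> = 0"
  unfolding numbered_field_def
  by (simp_all add: f_inv_into_f complex_subfield_mult[OF numbering_subfield]
      complex_subfield_add[OF numbering_subfield] complex_subfield_1[OF numbering_subfield]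
      complex_subfield_0[OF numbering_subfield])

lemma field_numbered_field: "field (numbered_field \<iota>)"
proof -
  let ?F = "numbered_field \<iota>"
  note sel = numbered_field_sel
  have eqI: "a = b" if "\<iota> a = \<iota> b" for a b using that by (simp add: numbering_eq_iff)
  have ex: "\<exists>b. \<iota> b = z" if "z \<in> range \<iota>" for z using that by (metis imageE)
  have "cring ?F"
  proof (rule cringI)
    show "abelian_group ?F"
    proof (rule abelian_groupI)
      fix x
      obtain y where "\<iota> y = - \<iota> x" using ex complex_subfield_minus[OF numbering_subfield] by (metis rangeI)
      then have "y \<oplus>\<^bsub>?F\<^esub> x = \<zero>\<^bsub>?F\<^esub>" by (intro eqI) (simp add: sel)
      then show "\<exists>y\<in>carrier ?F. y \<oplus>\<^bsub>?F\<^esub> x = \<zero>\<^bsub>?F\<^esub>" by (auto simp: sel)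
    qed (auto simp: sel intro!: eqI)
    show "comm_monoid ?F"
      by (rule comm_monoidI) (auto simp: sel intro!: eqI)
  qed (auto simp: sel algebra_simps intro!: eqI)
  then show ?thesis
  proof (rule cring.cring_fieldI2)
    show "\<zero>\<^bsub>?F\<^esub> \<noteq> \<one>\<^bsub>?F\<^esub>" using sel(4,5) by (metis zero_neq_one)
    fix a assume "a \<noteq> \<zero>\<^bsub>?F\<^esub>"
    then have "\<iota> a \<noteq> 0" using sel(5) eqI by metis
    obtain b where "\<iota> b = 1 / \<iota> a"
      using ex complex_subfield_divide[OF numbering_subfield complex_subfield_1[OF numbering_subfield]] by (metis rangeI)
    then have "a \<otimes>\<^bsub>?F\<^esub> b = \<one>\<^bsub>?F\<^esub>" using \<open>\<iota> a \<noteq> 0\<close> by (intro eqI) (simp add: sel)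
    then show "\<exists>b\<in>carrier ?F. a \<otimes>\<^bsub>?F\<^esub> b = \<one>\<^bsub>?F\<^esub>" by (auto simp: sel)
  qed
qed

text \<open>An integer polynomial that annihilates \<open>\<iota> x\<close> is pulled back along
  \<open>\<iota>\<close>. Its coefficients come from sums of ones and their negatives, so they land
  in the prime field.\<close>

lemma numbered_field_algebraic: "algebraic_over_rationals (numbered_field \<iota>)"
proof -
  let ?F = "numbered_field \<iota>"
  interpret F: field ?F by (rule field_numbered_field)
  note sel = numbered_field_sel
  have nat: "\<iota> (add_pow ?F n \<one>\<^bsub>?F\<^esub>) = of_nat n" for n :: nat
    by (induction n) (simp_all add: sel add.commute)
  have neg: "\<iota> (\<ominus>\<^bsub>?F\<^esub> a) = - \<iota> a" for a
  proof -
    have "\<iota> (a \<oplus>\<^bsub>?F\<^esub> (\<ominus>\<^bsub>?F\<^esub> a)) = 0" using F.r_neg[of a] sel(1,5) by simp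
    then show ?thesis unfolding sel by (simp add: eq_neg_iff_add_eq_0 add.commute)
  qed
  let ?Q = "generate_field ?F {}"
  have nat_Q: "add_pow ?F n \<one>\<^bsub>?F\<^esub> \<in> ?Q" for n :: nat
    by (induction n) (simp_all add: F.zero_in_generate generate_field.one generate_field.eng_add)
  have int_Q: "inv_into UNIV \<iota> z \<in> ?Q \<and> z \<in> range \<iota>" if z: "z \<in> \<int>" for z
  proof -
    obtain k where k: "z = of_int k" using z by (rule Ints_cases)
    define a where "a = (if 0 \<le> k then add_pow ?F (nat k) \<one>\<^bsub>?F\<^esub> else \<ominus>\<^bsub>?F\<^esub> (add_pow ?F (nat (- k)) \<one>\<^bsub>?F\<^esub>))"
    have "a \<in> ?Q" unfolding a_def using nat_Q by (auto intro: generate_field.a_inv)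
    moreover have "\<iota> a = z" unfolding a_def k using nat neg by (auto simp: of_nat_nat)
    ultimately show ?thesis using numbering_inj by (metis inv_f_f rangeI)
  qed
  show ?thesis
    unfolding algebraic_over_rationals_def
  proof (intro conjI allI impI ballI)
    fix n :: nat assume "0 < n"
    then show "add_pow ?F n \<one>\<^bsub>?F\<^esub> \<noteq> \<zero>\<^bsub>?F\<^esub>" using nat[of n] sel(5) by (metis of_nat_eq_0_iff less_irrefl)
  next
    fix x
    obtain p where p: "\<And>i. Polynomial.coeff p i \<in> \<int>" "p \<noteq> 0" "poly p (\<iota> x) = 0"
      using numbering_algebraic Polynomial.algebraicE by blast
    define l where "l = map (inv_into UNIV \<iota>) (rev (coeffs p))"
    have c: "c \<in> \<int>" if "c \<in> set (coeffs p)" for c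
      using that p(1) by (auto simp: coeffs_def split: if_splits)
    have l: "map \<iota> l = rev (coeffs p)"
      unfolding l_def map_map by (rule map_idI) (use c int_Q numbering_inv in auto)
    have "\<iota> (F.eval l x) = poly (Poly (rev (map \<iota> l))) (\<iota> x)"
      by (rule hom_eval) (simp_all add: sel F.ring_axioms)
    then have "\<iota> (F.eval l x) = 0" using p(3) by (simp add: l)
    then have "F.eval l x = \<zero>\<^bsub>?F\<^esub>" using sel(5) numbering_eq_iff by metis
    moreover have "l \<noteq> []" unfolding l_def using p(2) by simp
    moreover have "hd l \<noteq> \<zero>\<^bsub>?F\<^esub>"
    proof -
      have "\<iota> (hd l) = Polynomial.lead_coeff p"
        using l \<open>l \<noteq> []\<close> p(2) by (metis hd_map hd_rev last_coeffs_eq_coeff_degree)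
      then show ?thesis using p(2) sel(5) by (metis leading_coeff_0_iff)
    qed
    moreover have "set l \<subseteq> ?Q" unfolding l_def using c int_Q by auto
    ultimately show "((ring.algebraic ?F) over ?Q) x"
      by (intro F.algebraicI[of l]) (auto simp: univ_poly_def polynomial_def)
  qed
qed

lemma has_monic_root_numbered_field:
  "has_monic_root (numbered_field \<iota>) n as \<longleftrightarrow>
    (\<exists>x. \<iota> x ^ n + (\<Sum>i<n. \<iota> (as ! i) * \<iota> x ^ i) = 0)"
proof -
  let ?F = "numbered_field \<iota>"
  interpret F: field ?F by (rule field_numbered_field)
  note sel = numbered_field_sel
  have pow: "\<iota> (x [^]\<^bsub>?F\<^esub> n) = \<iota> x ^ n" for x and n :: nat
    by (induction n) (simp_all add: sel mult.commute)
  have sum: "\<iota> (\<Oplus>\<^bsub>?F\<^esub>i\<in>{..<n}. f i) = (\<Sum>i<n. \<iota> (f i))" for f :: "nat \<Rightarrow> nat" and n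
  proof (induction n)
    case (Suc n)
    have "(\<Oplus>\<^bsub>?F\<^esub>i\<in>{..<Suc n}. f i) = f n \<oplus>\<^bsub>?F\<^esub> (\<Oplus>\<^bsub>?F\<^esub>i\<in>{..<n}. f i)"
      unfolding lessThan_Suc by (rule F.finsum_insert) (auto simp: sel)
    then show ?case using Suc by (simp add: sel add.commute)
  qed (simp add: sel)
  have "(x [^]\<^bsub>?F\<^esub> n \<oplus>\<^bsub>?F\<^esub> (\<Oplus>\<^bsub>?F\<^esub>i\<in>{..<n}. (as ! i) \<otimes>\<^bsub>?F\<^esub> x [^]\<^bsub>?F\<^esub> i) = \<zero>\<^bsub>?F\<^esub>) \<longleftrightarrow>
      \<iota> x ^ n + (\<Sum>i<n. \<iota> (as ! i) * \<iota> x ^ i) = 0" for x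
    unfolding numbering_eq_iff[symmetric] by (simp add: sel pow sum)
  then show ?thesis unfolding has_monic_root_def by (simp add: sel)
qed

end

text \<open>Numbers that denote the same complex number are matched; a root predicate only asks for
  a root in the common range.\<close>

lemma isomorphic_numbered_fields:
  assumes \<iota>: "algebraic_numbering \<iota>" and \<kappa>: "algebraic_numbering \<kappa>" and range: "range \<iota> = range \<kappa>"
  shows "isomorphic_structs field_sig (field_struct (numbered_field \<iota>)) (field_struct (numbered_field \<kappa>))"
proof -
  define h where "h a = inv_into UNIV \<kappa> (\<iota> a)" for a
  have h: "\<kappa> (h a) = \<iota> a" for a
    unfolding h_def using numbering_inv[OF \<kappa>] range by (metis rangeI)
  note sel = numbered_field_sel[OF \<iota>] numbered_field_sel[OF \<kappa>]
  have eqI: "a = b" if "\<kappa> a = \<kappa> b" for a b using that by (simp add: numbering_eq_iff[OF \<kappa>])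
  have "inj h" by (rule injI) (metis h numbering_eq_iff[OF \<iota>])
  moreover have "surj h" by (metis eqI h range rangeE rangeI surjI surj_def)
  ultimately have bij: "bij h" by (simp add: bij_def)
  show ?thesis
    unfolding isomorphic_structs_def
  proof (intro exI[of _ h] conjI allI impI bij)
    fix f and xs :: "nat list" assume f: "fun_arity field_sig f = Some (length xs)"
    then consider "f = 0" | "f = 1" | "f \<in> {2, 3}" "length xs = 2"
      by (auto simp: field_sig_def split: if_splits)
    then show "h (fun_int (field_struct (numbered_field \<iota>)) f xs) =
        fun_int (field_struct (numbered_field \<kappa>)) f (map h xs)"
      by cases (auto intro!: eqI simp: field_struct_def h sel)
  next
    fix r and xs :: "nat list" assume "rel_arity field_sig r = Some (length xs)"
    then have "r = length xs" by (auto simp: field_sig_def split: if_splits)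
    then have "(\<Sum>i<r. \<kappa> (map h xs ! i) * z ^ i) = (\<Sum>i<r. \<iota> (xs ! i) * z ^ i)" for z
      by (intro sum.cong refl) (simp add: h)
    moreover have "(\<exists>x. \<Phi> (\<iota> x)) \<longleftrightarrow> (\<exists>x. \<Phi> (\<kappa> x))" for \<Phi>
    proof -
      have "(\<exists>x. \<Phi> (\<iota> x)) \<longleftrightarrow> (\<exists>z\<in>range \<iota>. \<Phi> z)" by blast
      then show ?thesis unfolding range by blast
    qed
    ultimately have "has_monic_root (numbered_field \<iota>) r xs \<longleftrightarrow> has_monic_root (numbered_field \<kappa>) r (map h xs)"
      unfolding has_monic_root_numbered_field[OF \<iota>] has_monic_root_numbered_field[OF \<kappa>] by simp
    then show "rel_int (field_struct (numbered_field \<iota>)) r xs =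
        rel_int (field_struct (numbered_field \<kappa>)) r (map h xs)"
      by (simp add: field_struct_def)
  qed
qed

section \<open>Embedding algebraic fields into the complex numbers\<close>

text \<open>\<open>g\<close> is the inverse of an embedding of a subring of \<open>R\<close> into
  the complex numbers, and \<open>x\<close> is the element to be adjoined. \<open>K\<close> is only
  a subring because adjoining an element produces a ring of polynomial values.\<close>

locale complex_subring_hom = field R for R (structure) +
  fixes K :: "complex set" and g :: "complex \<Rightarrow> 'a" and x :: 'a
  assumes K_1: "1 \<in> K"
    and K_diff: "z \<in> K \<Longrightarrow> w \<in> K \<Longrightarrow> z - w \<in> K"
    and K_mult: "z \<in> K \<Longrightarrow> w \<in> K \<Longrightarrow> z * w \<in> K"
    and g_closed: "z \<in> K \<Longrightarrow> g z \<in> carrier R"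
    and g_1: "g 1 = \<one>"
    and g_diff: "z \<in> K \<Longrightarrow> w \<in> K \<Longrightarrow> g (z - w) = g z \<ominus> g w"
    and g_mult: "z \<in> K \<Longrightarrow> w \<in> K \<Longrightarrow> g (z * w) = g z \<otimes> g w"
    and g_nonzero: "z \<in> K \<Longrightarrow> g z = \<zero> \<Longrightarrow> z = 0"
    and x_closed: "x \<in> carrier R"
begin

lemma K_0: "0 \<in> K" using K_diff[OF K_1 K_1] by simp

lemma g_0: "g 0 = \<zero>" using g_diff[OF K_1 K_1] by (simp add: g_1 a_minus_def r_neg)

lemma K_minus: "z \<in> K \<Longrightarrow> - z \<in> K" using K_diff[OF K_0] by force

lemma K_add: "z \<in> K \<Longrightarrow> w \<in> K \<Longrightarrow> z + w \<in> K" using K_diff[of z "- w"] K_minus by simp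

lemma g_minus: "z \<in> K \<Longrightarrow> g (- z) = \<ominus> g z"
  using g_diff[OF K_0, of z] by (simp add: g_0 a_minus_def g_closed)

lemma g_add: "z \<in> K \<Longrightarrow> w \<in> K \<Longrightarrow> g (z + w) = g z \<oplus> g w"
  using g_diff[of z "- w"] by (simp add: K_minus g_minus a_minus_def g_closed)

definition polys :: "complex poly set" where
  "polys = {q. \<forall>i. Polynomial.coeff q i \<in> K}"

lemma polys_0: "0 \<in> polys" unfolding polys_def by (simp add: K_0)

lemma pCons_polys: "pCons c q \<in> polys \<longleftrightarrow> c \<in> K \<and> q \<in> polys"
proof
  assume *: "pCons c q \<in> polys"
  have "Polynomial.coeff q i \<in> K" for i
    using * unfolding polys_def by (metis coeff_pCons_Suc mem_Collect_eq)
  moreover have "c \<in> K" using * unfolding polys_def by (metis coeff_pCons_0 mem_Collect_eq)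
  ultimately show "c \<in> K \<and> q \<in> polys" unfolding polys_def by simp
qed (auto simp: polys_def coeff_pCons split: nat.split)

lemma polys_add: "p \<in> polys \<Longrightarrow> q \<in> polys \<Longrightarrow> p + q \<in> polys"
  unfolding polys_def by (simp add: K_add)

lemma polys_diff: "p \<in> polys \<Longrightarrow> q \<in> polys \<Longrightarrow> p - q \<in> polys"
  unfolding polys_def by (simp add: K_diff)

lemma polys_smult: "c \<in> K \<Longrightarrow> q \<in> polys \<Longrightarrow> Polynomial.smult c q \<in> polys"
  unfolding polys_def by (simp add: K_mult)

lemma polys_mult: "p \<in> polys \<Longrightarrow> q \<in> polys \<Longrightarrow> p * q \<in> polys"
proof (induction p)
  case (pCons a p)
  then show ?case
    by (simp add: mult_pCons_left pCons_polys polys_add polys_smult K_0)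
qed (simp add: polys_0)

lemma polys_monom: "c \<in> K \<Longrightarrow> Polynomial.monom c n \<in> polys"
  unfolding polys_def by (simp add: K_0)

text \<open>Horner evaluation at \<open>x\<close> after the coefficients have been carried into
  \<open>R\<close> by \<open>g\<close>.\<close>

definition ev :: "complex poly \<Rightarrow> 'a" where
  "ev q = fold_coeffs (\<lambda>c v. g c \<oplus> x \<otimes> v) q \<zero>"

lemma ev_0: "ev 0 = \<zero>" unfolding ev_def by simp

lemma ev_pCons: "pCons c q \<in> polys \<Longrightarrow> ev (pCons c q) = g c \<oplus> x \<otimes> ev q"
  unfolding ev_def by (cases "c = 0 \<and> q = 0") (auto simp: g_0 x_closed)

lemma ev_closed: "q \<in> polys \<Longrightarrow> ev q \<in> carrier R"
proof (induction q)
  case (pCons c q)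
  then show ?case using ev_pCons[of c q] by (simp add: pCons_polys g_closed x_closed)
qed (simp add: ev_0)

lemma ev_const: "c \<in> K \<Longrightarrow> ev [:c:] = g c"
  using ev_pCons[of c 0] by (simp add: pCons_polys polys_0 ev_0 x_closed g_closed)

lemma ev_X: "ev [:0, 1:] = x"
  using ev_pCons[of 0 "[:1:]"] by (simp add: pCons_polys polys_0 K_0 K_1 ev_const g_0 g_1 x_closed)

lemma ev_add: "p \<in> polys \<Longrightarrow> q \<in> polys \<Longrightarrow> ev (p + q) = ev p \<oplus> ev q"
proof (induction p arbitrary: q)
  case 0
  then show ?case by (simp add: ev_0 ev_closed)
next
  case (pCons a p)
  obtain b r where q: "q = pCons b r" by (rule pCons_cases)
  have *: "a \<in> K" "p \<in> polys" "b \<in> K" "r \<in> polys" using pCons.prems unfolding q pCons_polys by auto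
  have "ev (pCons a p + q) = g (a + b) \<oplus> x \<otimes> ev (p + r)"
    unfolding q add_pCons by (rule ev_pCons) (simp add: pCons_polys * K_add polys_add)
  also have "\<dots> = (g a \<oplus> g b) \<oplus> x \<otimes> (ev p \<oplus> ev r)"
    using * pCons.IH by (simp add: g_add)
  also have "\<dots> = (g a \<oplus> x \<otimes> ev p) \<oplus> (g b \<oplus> x \<otimes> ev r)"
    using * by (simp add: r_distr a_ac g_closed ev_closed x_closed)
  finally show ?case unfolding q using pCons.prems by (simp add: ev_pCons q)
qed

lemma ev_smult: "c \<in> K \<Longrightarrow> q \<in> polys \<Longrightarrow> ev (Polynomial.smult c q) = g c \<otimes> ev q"
proof (induction q)
  case 0
  then show ?case by (simp add: ev_0 g_closed)
next
  case (pCons a q)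
  have *: "a \<in> K" "q \<in> polys" using pCons.prems unfolding pCons_polys by auto
  have "ev (Polynomial.smult c (pCons a q)) = g (c * a) \<oplus> x \<otimes> ev (Polynomial.smult c q)"
    unfolding smult_pCons by (rule ev_pCons) (simp add: pCons_polys * K_mult polys_smult pCons.prems)
  also have "\<dots> = g c \<otimes> (g a \<oplus> x \<otimes> ev q)"
    using * pCons by (simp add: g_mult r_distr m_lcomm g_closed ev_closed x_closed)
  finally show ?case using pCons.prems by (simp add: ev_pCons)
qed

lemma ev_mult: "p \<in> polys \<Longrightarrow> q \<in> polys \<Longrightarrow> ev (p * q) = ev p \<otimes> ev q"
proof (induction p)
  case 0
  then show ?case by (simp add: ev_0 ev_closed)
next
  case (pCons a p)
  have *: "a \<in> K" "p \<in> polys" using pCons.prems unfolding pCons_polys by auto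
  have pq: "pCons 0 (p * q) \<in> polys" using * pCons.prems by (simp add: pCons_polys K_0 polys_mult)
  have "ev (pCons a p * q) = g a \<otimes> ev q \<oplus> (g 0 \<oplus> x \<otimes> (ev p \<otimes> ev q))"
    using * pCons pq by (simp add: mult_pCons_left ev_add ev_smult polys_smult ev_pCons)
  also have "\<dots> = (g a \<oplus> x \<otimes> ev p) \<otimes> ev q"
    using * pCons.prems by (simp add: g_0 l_distr m_assoc g_closed ev_closed x_closed)
  finally show ?case using pCons.prems by (simp add: ev_pCons)
qed

lemma ev_diff: "p \<in> polys \<Longrightarrow> q \<in> polys \<Longrightarrow> ev (p - q) = ev p \<ominus> ev q"
proof -
  assume *: "p \<in> polys" "q \<in> polys"
  have "ev (p - q) = ev (p + Polynomial.smult (- 1) q)" by simp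
  also have "\<dots> = ev p \<oplus> g (- 1) \<otimes> ev q"
    using * K_minus[OF K_1] by (simp add: ev_add ev_smult polys_smult del: smult_minus_left)
  also have "\<dots> = ev p \<ominus> ev q"
    using * by (simp add: g_minus K_1 g_1 a_minus_def l_minus ev_closed)
  finally show ?thesis .
qed

lemma ev_monom: "c \<in> K \<Longrightarrow> ev (Polynomial.monom c n) = g c \<otimes> x [^] n"
proof (induction n)
  case 0
  then show ?case by (simp add: monom_0 ev_const g_closed)
next
  case (Suc n)
  have "ev (Polynomial.monom c (Suc n)) = g 0 \<oplus> x \<otimes> ev (Polynomial.monom c n)"
    unfolding monom_Suc by (rule ev_pCons) (simp add: pCons_polys K_0 polys_monom Suc.prems)
  then show ?case using Suc by (simp add: g_0 g_closed x_closed m_lcomm m_comm)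
qed

text \<open>Quotients may leave \<open>K\<close>, so instead of dividing by the leading coefficient
  of \<open>q\<close>, the dividend is multiplied by it at each step; \<open>c\<close> collects
  these factors.\<close>

lemma pseudo_division:
  assumes p: "p \<in> polys" and q: "q \<in> polys" "q \<noteq> 0"
  obtains c s r where "c \<in> K" "c \<noteq> 0" "s \<in> polys" "r \<in> polys"
    "Polynomial.smult c p = q * s + r" "r = 0 \<or> Polynomial.degree r < Polynomial.degree q"
proof -
  have "\<exists>c s r. c \<in> K \<and> c \<noteq> 0 \<and> s \<in> polys \<and> r \<in> polys \<and> Polynomial.smult c p = q * s + r \<and>
      (r = 0 \<or> Polynomial.degree r < Polynomial.degree q)"
    using p
  proof (induction "Polynomial.degree p" arbitrary: p rule: less_induct)
    case less
    show ?case
    proof (cases "Polynomial.degree p < Polynomial.degree q \<or> p = 0")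
      case True
      then show ?thesis using less.prems K_1 polys_0
        by (intro exI[of _ 1] exI[of _ 0] exI[of _ p]) auto
    next
      case False
      define b where "b = Polynomial.lead_coeff q"
      define m where "m = Polynomial.monom (Polynomial.lead_coeff p) (Polynomial.degree p - Polynomial.degree q)"
      \<comment> \<open>Cross-multiplication by the two leading coefficients cancels the top
        terms.\<close>
      define p' where "p' = Polynomial.smult b p - m * q"
      have b: "b \<in> K" "b \<noteq> 0" using q unfolding b_def polys_def by auto
      have m: "m \<in> polys" using less.prems unfolding m_def polys_def by (simp add: K_0)
      have p': "p' \<in> polys"
        unfolding p'_def by (intro polys_diff polys_smult polys_mult b m less.prems q)
      have "Polynomial.degree (m * q) \<le> Polynomial.degree p"
        using degree_mult_le[of m q] degree_monom_le[of "Polynomial.lead_coeff p" "Polynomial.degree p - Polynomial.degree q"]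
          False unfolding m_def by linarith
      then have "Polynomial.degree p' \<le> Polynomial.degree p"
        unfolding p'_def by (intro degree_diff_le) simp_all
      moreover have "Polynomial.coeff p' (Polynomial.degree p) = 0"
        using False unfolding p'_def m_def b_def by (simp add: coeff_monom_mult)
      ultimately consider "p' = 0" | "Polynomial.degree p' < Polynomial.degree p"
        using eq_zero_or_degree_less by blast
      then show ?thesis
      proof cases
        case 1
        then have "Polynomial.smult b p = q * m + 0" unfolding p'_def by (simp add: mult.commute)
        then show ?thesis using b m polys_0 by blast
      next
        case 2
        then obtain c s r where c: "c \<in> K" "c \<noteq> 0" "s \<in> polys" "r \<in> polys"
          "Polynomial.smult c p' = q * s + r" "r = 0 \<or> Polynomial.degree r < Polynomial.degree q"
          using less.hyps[OF _ p'] by blast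
        have "Polynomial.smult (c * b) p = Polynomial.smult c p' + Polynomial.smult c (m * q)"
          unfolding p'_def by (simp add: smult_diff_right)
        also have "\<dots> = q * (s + Polynomial.smult c m) + r"
          unfolding c(5) by (simp add: algebra_simps)
        finally have "Polynomial.smult (c * b) p = q * (s + Polynomial.smult c m) + r" .
        moreover have "c * b \<in> K" "c * b \<noteq> 0" "s + Polynomial.smult c m \<in> polys"
          using b c m by (auto intro: K_mult polys_add polys_smult)
        ultimately show ?thesis using c(4,6) by blast
      qed
    qed
  qed
  then show thesis using that by blast
qed

text \<open>Dividing by a polynomial of least degree in the kernel of \<open>ev\<close> shows that this kernel is
  contained in the kernel of evaluation at a complex root \<open>z\<close> of that polynomial; dividing it in turn
  by a polynomial of least degree vanishing at \<open>z\<close> gives the converse.\<close>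

lemma ev_eq_0_iff_poly_eq_0:
  assumes "q \<in> polys" "q \<noteq> 0" "ev q = \<zero>"
  shows "\<exists>z. \<forall>p\<in>polys. ev p = \<zero> \<longleftrightarrow> poly p z = 0"
proof -
  define S where "S = {p \<in> polys. p \<noteq> 0 \<and> ev p = \<zero>}"
  have "\<exists>m. m \<in> S \<and> (\<forall>p. p \<in> S \<longrightarrow> Polynomial.degree m \<le> Polynomial.degree p)"
    using assms unfolding S_def by (intro ex_has_least_nat) auto
  then obtain m where m: "m \<in> polys" "m \<noteq> 0" "ev m = \<zero>"
    and min: "\<And>p. p \<in> polys \<Longrightarrow> ev p = \<zero> \<Longrightarrow> p \<noteq> 0 \<Longrightarrow> Polynomial.degree m \<le> Polynomial.degree p"
    unfolding S_def by blast
  have "Polynomial.degree m \<noteq> 0"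
  proof
    assume "Polynomial.degree m = 0"
    then obtain c where c: "m = [:c:]" by (rule degree_eq_zeroE)
    then have "c \<in> K" using m(1) by (simp add: pCons_polys)
    then show False using m(2,3) g_nonzero c ev_const by auto
  qed
  then obtain z where z: "poly m z = 0" using alg_closed_imp_poly_has_root[of m] by blast
  define Z where "Z = {p \<in> polys. p \<noteq> 0 \<and> poly p z = 0}"
  have "\<exists>n. n \<in> Z \<and> (\<forall>p. p \<in> Z \<longrightarrow> Polynomial.degree n \<le> Polynomial.degree p)"
    using m z unfolding Z_def by (intro ex_has_least_nat[of _ m]) auto
  then obtain n where n: "n \<in> polys" "n \<noteq> 0" "poly n z = 0"
    and nmin: "\<And>p. p \<in> polys \<Longrightarrow> poly p z = 0 \<Longrightarrow> p \<noteq> 0 \<Longrightarrow> Polynomial.degree n \<le> Polynomial.degree p"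
    unfolding Z_def by blast
  have ev_imp: "poly p z = 0" if p: "p \<in> polys" "ev p = \<zero>" for p
  proof -
    obtain c s r where c: "c \<in> K" "c \<noteq> 0" "s \<in> polys" "r \<in> polys"
      "Polynomial.smult c p = m * s + r" "r = 0 \<or> Polynomial.degree r < Polynomial.degree m"
      using pseudo_division[OF p(1) m(1,2)] .
    have "ev (Polynomial.smult c p) = \<zero>" using ev_smult c(1) p g_closed by simp
    then have "ev m \<otimes> ev s \<oplus> ev r = \<zero>"
      unfolding c(5) using c m by (simp add: ev_add ev_mult polys_mult)
    then have "ev r = \<zero>" using m(3) c ev_closed by simp
    then have "r = 0" using min[OF c(4)] c(6) by (metis leD)
    then have "poly (Polynomial.smult c p) z = 0" unfolding c(5) using z by simp
    then show ?thesis using c(2) by simp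
  qed
  have n_dvd: "\<exists>c s. c \<in> K \<and> c \<noteq> 0 \<and> s \<in> polys \<and> Polynomial.smult c p = n * s"
    if p: "p \<in> polys" "poly p z = 0" for p
  proof -
    obtain c s r where c: "c \<in> K" "c \<noteq> 0" "s \<in> polys" "r \<in> polys"
      "Polynomial.smult c p = n * s + r" "r = 0 \<or> Polynomial.degree r < Polynomial.degree n"
      using pseudo_division[OF p(1) n(1,2)] .
    have "poly (n * s + r) z = 0" unfolding c(5)[symmetric] using p(2) by simp
    then have "poly r z = 0" using n(3) by simp
    then have "r = 0" using nmin[OF c(4)] c(6) by (metis leD)
    then show ?thesis using c by auto
  qed
  have ev_n: "ev n = \<zero>"
  proof -
    obtain c s where c: "c \<in> K" "c \<noteq> 0" "s \<in> polys" "Polynomial.smult c m = n * s"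
      using n_dvd[OF m(1) z] by blast
    have "ev (n * s) = \<zero>" unfolding c(4)[symmetric] using ev_smult[OF c(1) m(1)] m(3) g_closed[OF c(1)] by simp
    then have "ev n \<otimes> ev s = \<zero>" using ev_mult[OF n(1) c(3)] by simp
    then have "ev n = \<zero> \<or> ev s = \<zero>" using integral ev_closed n(1) c(3) by blast
    \<comment> \<open>Since \<open>n\<close> has the root \<open>z\<close>, it is not constant, so
      \<open>s\<close> has smaller degree than \<open>m\<close> and cannot lie in the kernel of
      \<open>ev\<close>.\<close>
    moreover have "ev s \<noteq> \<zero>"
    proof
      assume "ev s = \<zero>"
      have "s \<noteq> 0" using c(2,4) m(2) by auto
      then have "Polynomial.degree m \<le> Polynomial.degree s" using min[OF c(3) \<open>ev s = \<zero>\<close>] by blast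
      moreover have "Polynomial.degree m = Polynomial.degree n + Polynomial.degree s"
        using c(2,4) \<open>s \<noteq> 0\<close> n(2) by (metis degree_mult_eq degree_smult_eq)
      ultimately have "Polynomial.degree n = 0" by simp
      then obtain d where "n = [:d:]" by (rule degree_eq_zeroE)
      then show False using n(2,3) by simp
    qed
    ultimately show ?thesis by blast
  qed
  have "ev p = \<zero>" if p: "p \<in> polys" "poly p z = 0" for p
  proof -
    obtain c s where c: "c \<in> K" "c \<noteq> 0" "s \<in> polys" "Polynomial.smult c p = n * s"
      using n_dvd[OF p] by blast
    have "g c \<otimes> ev p = ev n \<otimes> ev s"
      using ev_smult[OF c(1) p(1)] ev_mult[OF n(1) c(3)] c(4) by simp
    then have "g c \<otimes> ev p = \<zero>" using ev_n ev_closed[OF c(3)] by simp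
    then show ?thesis using integral g_closed[OF c(1)] ev_closed[OF p(1)] g_nonzero[OF c(1)] c(2) by blast
  qed
  then show ?thesis using ev_imp by blast
qed

end

text \<open>A relation, so that an upper bound of a chain is simply its union. The zero condition
  together with closure under differences makes it single-valued in both directions.\<close>

definition partial_embedding :: "('a, 'b) ring_scheme \<Rightarrow> (complex \<times> 'a) set \<Rightarrow> bool" where
  "partial_embedding R G \<longleftrightarrow> (1, \<one>\<^bsub>R\<^esub>) \<in> G \<and>
    (\<forall>z a. (z, a) \<in> G \<longrightarrow> a \<in> carrier R \<and> (z = 0 \<longleftrightarrow> a = \<zero>\<^bsub>R\<^esub>)) \<and>
    (\<forall>z a w b. (z, a) \<in> G \<longrightarrow> (w, b) \<in> G \<longrightarrow>
      (z - w, a \<ominus>\<^bsub>R\<^esub> b) \<in> G \<and> (z * w, a \<otimes>\<^bsub>R\<^esub> b) \<in> G)"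

section \<open>Extension of partial embeddings and Zorn's lemma\<close>

context field
begin

context
  fixes G assumes G: "partial_embedding R G"
begin

lemma pe_1: "(1, \<one>) \<in> G" and pe_closed: "(z, a) \<in> G \<Longrightarrow> a \<in> carrier R"
  and pe_0_iff: "(z, a) \<in> G \<Longrightarrow> z = 0 \<longleftrightarrow> a = \<zero>"
  and pe_diff: "(z, a) \<in> G \<Longrightarrow> (w, b) \<in> G \<Longrightarrow> (z - w, a \<ominus> b) \<in> G"
  and pe_mult: "(z, a) \<in> G \<Longrightarrow> (w, b) \<in> G \<Longrightarrow> (z * w, a \<otimes> b) \<in> G"
  using G unfolding partial_embedding_def by blast+

lemma pe_0: "(0, \<zero>) \<in> G"
  using pe_diff[OF pe_1 pe_1] by (simp add: a_minus_def r_neg)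

lemma pe_minus: "(z, a) \<in> G \<Longrightarrow> (- z, \<ominus> a) \<in> G"
  using pe_diff[OF pe_0, of z a] pe_closed by (simp add: a_minus_def)

lemma pe_add: "(z, a) \<in> G \<Longrightarrow> (w, b) \<in> G \<Longrightarrow> (z + w, a \<oplus> b) \<in> G"
  using pe_diff[of z a "- w" "\<ominus> b"] pe_minus pe_closed by (simp add: a_minus_def)

lemma pe_unique: "(z, a) \<in> G \<Longrightarrow> (w, b) \<in> G \<Longrightarrow> z = w \<longleftrightarrow> a = b"
  using pe_0_iff[OF pe_diff[of z a w b]] pe_closed by simp

definition pe_fun :: "complex \<Rightarrow> 'a" where
  "pe_fun z = (THE a. (z, a) \<in> G)"

lemma pe_fun_eq: "(z, a) \<in> G \<Longrightarrow> pe_fun z = a"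
  unfolding pe_fun_def using pe_unique by blast

lemma pe_fun: "z \<in> Domain G \<Longrightarrow> (z, pe_fun z) \<in> G"
  using pe_fun_eq by blast

lemma pe_hom:
  assumes "x \<in> carrier R" shows "complex_subring_hom R (Domain G) pe_fun x"
proof unfold_locales
  fix z w assume zw: "z \<in> Domain G" "w \<in> Domain G"
  note zw' = pe_fun[OF zw(1)] pe_fun[OF zw(2)]
  show "z - w \<in> Domain G" "z * w \<in> Domain G" using pe_diff[OF zw'] pe_mult[OF zw'] by blast+
  show "pe_fun (z - w) = pe_fun z \<ominus> pe_fun w" "pe_fun (z * w) = pe_fun z \<otimes> pe_fun w"
    using pe_diff[OF zw'] pe_mult[OF zw'] pe_fun_eq by blast+
  show "pe_fun z \<in> carrier R" "pe_fun z = \<zero> \<Longrightarrow> z = 0" using zw'(1) pe_closed pe_0_iff by blast+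
qed (use pe_1 pe_fun_eq assms in blast)+

text \<open>For a suitable complex \<open>z\<close>, a polynomial over the domain vanishes at
  \<open>z\<close> exactly when it vanishes at \<open>x\<close>. The pairs of values at
  \<open>z\<close> and \<open>x\<close> therefore form a partial embedding, and the polynomial
  \<open>[:0, 1:]\<close> puts \<open>x\<close> into its range.\<close>

lemma pe_extend:
  assumes x: "x \<in> carrier R"
    and q: "q \<in> complex_subring_hom.polys (Domain G)" "q \<noteq> 0" "complex_subring_hom.ev R pe_fun x q = \<zero>"
  shows "\<exists>G'. G \<subseteq> G' \<and> partial_embedding R G' \<and> x \<in> Range G'"
proof -
  interpret complex_subring_hom R "Domain G" pe_fun x by (rule pe_hom[OF x])
  obtain z where z: "\<And>p. p \<in> polys \<Longrightarrow> ev p = \<zero> \<longleftrightarrow> poly p z = 0"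
    using ev_eq_0_iff_poly_eq_0[OF q] by blast
  define G' where "G' = {(poly p z, ev p) |p. p \<in> polys}"
  have G'I: "(poly p z, ev p) \<in> G'" if "p \<in> polys" for p using that unfolding G'_def by blast
  have "(w, b) \<in> G'" if "(w, b) \<in> G" for w b
  proof -
    have w: "w \<in> Domain G" using that by blast
    then have "[:w:] \<in> polys" by (simp add: pCons_polys polys_0)
    from G'I[OF this] show ?thesis using ev_const[OF w] pe_fun_eq[OF that] by simp
  qed
  then have "G \<subseteq> G'" by auto
  moreover have "partial_embedding R G'"
    unfolding partial_embedding_def
  proof (intro conjI allI impI)
    show "(1, \<one>) \<in> G'" using \<open>G \<subseteq> G'\<close> pe_1 by blast
  next
    fix w b assume "(w, b) \<in> G'"
    then show "b \<in> carrier R" "w = 0 \<longleftrightarrow> b = \<zero>" unfolding G'_def using z ev_closed by auto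
  next
    fix w b u c assume "(w, b) \<in> G'" "(u, c) \<in> G'"
    then obtain p r where "p \<in> polys" "r \<in> polys" "w = poly p z" "b = ev p" "u = poly r z" "c = ev r"
      unfolding G'_def by blast
    then show "(w - u, b \<ominus> c) \<in> G'" "(w * u, b \<otimes> c) \<in> G'"
      using G'I[OF polys_diff, of p r] G'I[OF polys_mult, of p r] by (simp_all add: ev_diff ev_mult)
  qed
  moreover have "x \<in> Range G'"
    using G'I[of "[:0, 1:]"] ev_X by (auto simp: pCons_polys polys_0 K_0 K_1)
  ultimately show ?thesis by blast
qed

end

text \<open>The starting point for Zorn's lemma: characteristic 0 keeps distinct integers apart in
  \<open>R\<close>.\<close>

lemma partial_embedding_integers:
  assumes char: "\<And>n::nat. n > 0 \<Longrightarrow> add_pow R n \<one> \<noteq> \<zero>"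
  shows "partial_embedding R (range (\<lambda>k::int. (of_int k, add_pow R k \<one>)))"
  unfolding partial_embedding_def
proof (intro conjI allI impI)
  have "add_pow R (1::int) \<one> = \<one>" by (simp add: add_pow_int_ge)
  then show "(1, \<one>) \<in> range (\<lambda>k::int. (of_int k :: complex, add_pow R k \<one>))"
    by (intro range_eqI[of _ _ 1]) simp
next
  fix z a assume "(z, a) \<in> range (\<lambda>k::int. (of_int k :: complex, add_pow R k \<one>))"
  then obtain k :: int where k: "z = of_int k" "a = add_pow R k \<one>" by blast
  then show "a \<in> carrier R" by simp
  have "add_pow R k \<one> \<noteq> \<zero>" if "k \<noteq> 0"
  proof (cases "k \<ge> 0")
    case True
    then show ?thesis using char[of "nat k"] that by (simp add: add_pow_int_ge)
  next
    case False
    then show ?thesis using char[of "nat (- k)"] that by (simp add: add_pow_int_lt)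
  qed
  moreover have "add_pow R (0::int) \<one> = \<zero>" by (simp add: add_pow_int_ge)
  ultimately show "z = 0 \<longleftrightarrow> a = \<zero>" using k by auto
next
  fix z a w b
  assume "(z, a) \<in> range (\<lambda>k::int. (of_int k :: complex, add_pow R k \<one>))"
    "(w, b) \<in> range (\<lambda>k::int. (of_int k :: complex, add_pow R k \<one>))"
  then obtain k l :: int where k: "z = of_int k" "a = add_pow R k \<one>" "w = of_int l" "b = add_pow R l \<one>" by blast
  have "a \<ominus> b = add_pow R (k - l) \<one>" unfolding k by (simp add: add.int_pow_diff a_minus_def)
  then show "(z - w, a \<ominus> b) \<in> range (\<lambda>k::int. (of_int k :: complex, add_pow R k \<one>))"
    unfolding k by (auto intro!: image_eqI[of _ _ "k - l"])
  have "a \<otimes> b = add_pow R k (add_pow R l \<one>)" unfolding k by (simp add: add_pow_ldistr_int)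
  then have "a \<otimes> b = add_pow R (k * l) \<one>" by (simp add: add.int_pow_pow mult.commute)
  then show "(z * w, a \<otimes> b) \<in> range (\<lambda>k::int. (of_int k :: complex, add_pow R k \<one>))"
    unfolding k by (auto intro!: image_eqI[of _ _ "k * l"])
qed

text \<open>By \<open>pe_extend\<close>, the range of a maximal partial embedding contains every
  element annihilated by a nonzero polynomial over its domain. Applied to inverses this captures the
  prime field, and then all elements algebraic over it.\<close>

lemma ex_total_embedding:
  assumes alg: "algebraic_over_rationals R"
  shows "\<exists>G. partial_embedding R G \<and> Range G = carrier R"
proof -
  let ?\<A> = "{G. partial_embedding R G}"
  have "\<exists>M\<in>?\<A>. \<forall>G\<in>?\<A>. M \<subseteq> G \<longrightarrow> G = M"
  proof (rule subset_Zorn_nonempty)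
    show "?\<A> \<noteq> {}" using partial_embedding_integers alg unfolding algebraic_over_rationals_def by blast
  next
    fix \<C> assume \<C>: "\<C> \<noteq> {}" "subset.chain ?\<A> \<C>"
    have pe: "partial_embedding R G" if "G \<in> \<C>" for G using \<C>(2) that unfolding subset.chain_def by blast
    have two: "\<exists>G\<in>\<C>. u \<in> G \<and> v \<in> G" if uv: "u \<in> \<Union>\<C>" "v \<in> \<Union>\<C>" for u v
    proof -
      obtain G H where GH: "G \<in> \<C>" "H \<in> \<C>" "u \<in> G" "v \<in> H" using uv by blast
      then have "G \<subseteq> H \<or> H \<subseteq> G" using \<C>(2) unfolding subset_chain_def by blast
      then show ?thesis using GH by blast
    qed
    have "partial_embedding R (\<Union>\<C>)"
      unfolding partial_embedding_def
    proof (intro conjI allI impI)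
      show "(1, \<one>) \<in> \<Union>\<C>" using \<C>(1) pe pe_1 by blast
    next
      fix z a assume "(z, a) \<in> \<Union>\<C>"
      then show "a \<in> carrier R" "z = 0 \<longleftrightarrow> a = \<zero>" using pe pe_closed pe_0_iff by blast+
    next
      fix z a w b assume "(z, a) \<in> \<Union>\<C>" "(w, b) \<in> \<Union>\<C>"
      then obtain G where "G \<in> \<C>" "(z, a) \<in> G" "(w, b) \<in> G" using two by blast
      then show "(z - w, a \<ominus> b) \<in> \<Union>\<C>" "(z * w, a \<otimes> b) \<in> \<Union>\<C>" using pe pe_diff pe_mult by blast+
    qed
    then show "\<Union>\<C> \<in> ?\<A>" by simp
  qed
  then obtain G where G: "partial_embedding R G"
    and max: "\<And>G'. partial_embedding R G' \<Longrightarrow> G \<subseteq> G' \<Longrightarrow> G' = G" by blast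
  let ?g = "pe_fun G"
  have in_range: "x \<in> Range G"
    if "x \<in> carrier R" "q \<in> complex_subring_hom.polys (Domain G)" "q \<noteq> 0"
      "complex_subring_hom.ev R ?g x q = \<zero>" for x q
    using pe_extend[OF G that] max by metis
  let ?Q = "generate_field R {}"
  have Q: "h \<in> Range G" if "h \<in> ?Q" for h
    using that
  proof (induction rule: generate_field.induct)
    case one
    then show ?case using pe_1[OF G] by blast
  next
    case (incl h)
    then show ?case by simp
  next
    case (a_inv h)
    then show ?case using pe_minus[OF G] by blast
  next
    case (m_inv h)
    then obtain z where z: "(z, h) \<in> G" by blast
    have h: "h \<in> carrier R" "inv h \<in> carrier R"
      using pe_closed[OF G z] m_inv(2) by (auto simp: field_Units)
    interpret E: complex_subring_hom R "Domain G" ?g "inv h" by (rule pe_hom[OF G h(2)])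
    have zG: "z \<in> Domain G" using z by blast
    \<comment> \<open>With \<open>z\<close> the complex partner of \<open>h\<close>, this linear
      polynomial has \<open>inv h\<close> as its root on the side of \<open>R\<close>.\<close>
    have "[:- 1, z:] \<in> E.polys" using E.K_minus[OF E.K_1] zG by (simp add: E.pCons_polys E.polys_0)
    moreover have "[:- 1, z:] \<noteq> 0" by simp
    moreover have "E.ev [:- 1, z:] = \<zero>"
    proof -
      have "E.ev [:- 1, z:] = \<ominus> \<one> \<oplus> inv h \<otimes> h"
        using calculation(1) E.ev_pCons[of "- 1" "[:z:]"] pe_fun_eq[OF G z]
        by (simp add: E.g_minus E.K_1 E.g_1 E.ev_const[OF zG])
      also have "inv h \<otimes> h = \<one>" using h(1) m_inv(2) by (intro Units_l_inv) (simp add: field_Units)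
      finally show ?thesis by (simp add: l_neg)
    qed
    ultimately show ?case using in_range h(2) by blast
  next
    case (eng_add h1 h2)
    then show ?case using pe_add[OF G] by blast
  next
    case (eng_mult h1 h2)
    then show ?case using pe_mult[OF G] by blast
  qed
  have "x \<in> Range G" if x: "x \<in> carrier R" for x
  proof -
    interpret E: complex_subring_hom R "Domain G" ?g x by (rule pe_hom[OF G x])
    have "subring ?Q R" using generate_field_is_subfield[of "{}"] subfieldE(1) by blast
    then obtain p where p: "p \<in> carrier (?Q[X])" "p \<noteq> []" "eval p x = \<zero>"
      using algebraicE[OF _ x] alg x unfolding algebraic_over_rationals_def by blast
    have pQ: "set p \<subseteq> ?Q" "hd p \<noteq> \<zero>" using p(1,2) by (auto simp: univ_poly_def polynomial_def)
    have "\<forall>a\<in>?Q. \<exists>z. (z, a) \<in> G" using Q by blast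
    from bchoice[OF this] obtain f where f: "\<And>a. a \<in> ?Q \<Longrightarrow> (f a, a) \<in> G" by blast
    \<comment> \<open>Replacing each coefficient by its complex partner carries an annihilating list
      over the prime field to a polynomial over the domain of \<open>G\<close>.\<close>
    have ev: "Poly (rev (map f r)) \<in> E.polys \<and> E.ev (Poly (rev (map f r))) = eval r x"
      if "set r \<subseteq> ?Q" for r
      using that
    proof (induction r)
      case Nil
      then show ?case by (simp add: E.polys_0 E.ev_0)
    next
      case (Cons a r)
      have a: "(f a, a) \<in> G" "f a \<in> Domain G" using f[of a] Cons.prems by auto
      then show ?case
        using Cons pe_fun_eq[OF G a(1)] E.ev_closed[of "Poly (rev (map f r))"] pe_closed[OF G a(1)] x
        by (simp add: Poly_snoc E.polys_add E.polys_monom E.ev_add E.ev_monom a_comm)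
    qed
    have "Poly (rev (map f p)) \<noteq> 0"
    proof
      assume "Poly (rev (map f p)) = 0"
      \<comment> \<open>After the reversal, position \<open>length p - 1\<close> holds the head of
        the list, which is the leading coefficient.\<close>
      then have "Polynomial.coeff (Poly (rev (map f p))) (length p - 1) = 0" by simp
      then have "f (hd p) = 0"
        using p(2) by (simp add: nth_default_def rev_nth hd_conv_nth)
      then show False using f[of "hd p"] pQ p(2) pe_0_iff[OF G] by (metis hd_in_set subsetD)
    qed
    then show ?thesis using in_range[OF x] ev[OF pQ(1)] p(3) by metis
  qed
  then show ?thesis using G pe_closed[OF G] by blast
qed

end


text \<open>The converse of a total embedding is a function on all of \<omega>. As the carrier is
  everything, the operations of \<open>F\<close> are determined on every argument and the equality
  with the numbered field is literal.\<close>

lemma ex_algebraic_numbering: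
  fixes F :: "nat ring"
  assumes "field F" and UNIV: "carrier F = UNIV" and alg: "algebraic_over_rationals F"
  shows "\<exists>\<iota>. algebraic_numbering \<iota> \<and> F = numbered_field \<iota>"
proof -
  interpret field F by fact
  obtain G where G: "partial_embedding F G" "Range G = UNIV"
    using ex_total_embedding[OF alg] UNIV by blast
  have "\<exists>z. (z, a) \<in> G" for a using G(2) by blast
  then obtain \<iota> where \<iota>: "\<And>a. (\<iota> a, a) \<in> G" by metis
  have eq: "\<iota> a = z" if "(z, a) \<in> G" for z a using pe_unique[OF G(1) \<iota> that] by blast
  have hom: "\<iota> (a \<oplus>\<^bsub>F\<^esub> b) = \<iota> a + \<iota> b" "\<iota> (a \<otimes>\<^bsub>F\<^esub> b) = \<iota> a * \<iota> b" "\<iota> (a \<ominus>\<^bsub>F\<^esub> b) = \<iota> a - \<iota> b"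
    "\<iota> \<one>\<^bsub>F\<^esub> = 1" "\<iota> \<zero>\<^bsub>F\<^esub> = 0" "\<iota> (\<ominus>\<^bsub>F\<^esub> a) = - \<iota> a" for a b
    by (intro eq pe_add[OF G(1)] pe_mult[OF G(1)] pe_diff[OF G(1)] pe_1[OF G(1)] pe_0[OF G(1)]
        pe_minus[OF G(1)] \<iota>)+
  have inj: "inj \<iota>" using pe_unique[OF G(1) \<iota> \<iota>] by (intro injI) blast
  have inv: "\<iota> (inv\<^bsub>F\<^esub> a) = 1 / \<iota> a" if "a \<noteq> \<zero>\<^bsub>F\<^esub>" for a
  proof -
    have "a \<in> Units F" using that UNIV by (simp add: field_Units)
    then have "inv\<^bsub>F\<^esub> a \<otimes>\<^bsub>F\<^esub> a = \<one>\<^bsub>F\<^esub>" by (rule Units_l_inv)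
    then have "\<iota> (inv\<^bsub>F\<^esub> a) * \<iota> a = 1" using hom(2,4) by metis
    then show ?thesis by (metis div_by_0 eq_divide_imp mult_zero_right zero_neq_one)
  qed
  have "complex_subfield (range \<iota>)"
    unfolding complex_subfield_def
  proof (intro conjI ballI)
    show "1 \<in> range \<iota>" using hom(4) by (metis rangeI)
    fix z w assume "z \<in> range \<iota>" "w \<in> range \<iota>"
    then obtain a b where ab: "z = \<iota> a" "w = \<iota> b" by blast
    show "z - w \<in> range \<iota>" unfolding ab using hom(3) by (metis rangeI)
    show "z / w \<in> range \<iota>"
    proof (cases "b = \<zero>\<^bsub>F\<^esub>")
      case True
      then have "z / w = \<iota> \<zero>\<^bsub>F\<^esub>" unfolding ab by (simp add: hom)
      then show ?thesis by simp
    next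
      case False
      then have "z / w = \<iota> (a \<otimes>\<^bsub>F\<^esub> inv\<^bsub>F\<^esub> b)" unfolding ab by (simp add: hom inv)
      then show ?thesis by simp
    qed
  qed
  moreover have "Polynomial.algebraic (\<iota> x)" for x
  proof -
    let ?Q = "generate_field F {}"
    have "subring ?Q F" using generate_field_is_subfield[of "{}"] subfieldE(1) by blast
    then obtain p where p: "p \<in> carrier (?Q[X]\<^bsub>F\<^esub>)" "p \<noteq> []" "eval p x = \<zero>\<^bsub>F\<^esub>"
      using algebraicE[of ?Q x] alg UNIV unfolding algebraic_over_rationals_def by blast
    have pQ: "set p \<subseteq> ?Q" "hd p \<noteq> \<zero>\<^bsub>F\<^esub>" using p(1,2) by (auto simp: univ_poly_def polynomial_def)
    \<comment> \<open>The prime field is generated from one by field operations, so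
      \<open>\<iota>\<close> maps it into the rationals.\<close>
    have rat: "\<iota> a \<in> \<rat>" if "a \<in> ?Q" for a
      using that by induction (simp_all add: hom inv)
    let ?p = "Poly (rev (map \<iota> p))"
    have "\<iota> (eval p x) = poly ?p (\<iota> x)"
      by (rule hom_eval) (simp_all add: hom ring_axioms UNIV)
    then have "poly ?p (\<iota> x) = 0" using p(3) hom(5) by simp
    moreover have "Polynomial.coeff ?p i \<in> \<rat>" for i
      using pQ(1) by (auto simp: nth_default_def rev_nth intro!: rat)
    moreover have "?p \<noteq> 0"
    proof
      assume "?p = 0"
      then have "Polynomial.coeff ?p (length p - 1) = 0" by simp
      then have "\<iota> (hd p) = 0" using p(2) by (simp add: nth_default_def rev_nth hd_conv_nth)
      then show False using pQ(2) pe_0_iff[OF G(1) \<iota>] by blast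
    qed
    ultimately show ?thesis by (intro Polynomial.algebraicI')
  qed
  ultimately have "algebraic_numbering \<iota>" using inj unfolding algebraic_numbering_def by blast
  moreover have "F = numbered_field \<iota>"
    unfolding numbered_field_def
    by (rule ring.equality) (simp_all add: UNIV inj fun_eq_iff flip: hom)
  ultimately show ?thesis by blast
qed

section \<open>Compactness of the space of algebraic fields\<close>

lemma countable_algebraic: "countable {z::complex. Polynomial.algebraic z}"
proof -
  have "inj (coeffs :: int poly \<Rightarrow> int list)" by (rule injI) (simp add: coeffs_eq_iff)
  then have "countable (UNIV :: int poly set)"
    using countable_image_inj_eq[of coeffs "UNIV :: int poly set"] by simp
  then have "countable (\<Union>p\<in>UNIV - {0 :: int poly}. {z::complex. poly (map_poly of_int p) z = 0})"
    by (intro countable_UN countable_Diff) (auto intro!: countable_finite poly_roots_finite simp: poly_eq_iff coeff_map_poly)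
  moreover have "{z::complex. Polynomial.algebraic z} \<subseteq>
      (\<Union>p\<in>UNIV - {0 :: int poly}. {z::complex. poly (map_poly of_int p) z = 0})"
    by (auto elim!: Polynomial.algebraicE')
  ultimately show ?thesis using countable_subset by blast
qed

lemma algebraic_of_nat: "Polynomial.algebraic (of_nat n :: complex)"
  by (rule Polynomial.algebraicI[of "[:- of_nat n, 1:]"])
    (auto simp: coeff_pCons split: nat.split)

lemma infinite_algebraic: "infinite {z::complex. Polynomial.algebraic z}"
proof -
  have "range (of_nat :: nat \<Rightarrow> complex) \<subseteq> {z. Polynomial.algebraic z}"
    using algebraic_of_nat by blast
  moreover have "infinite (range (of_nat :: nat \<Rightarrow> complex))"
    by (rule range_inj_infinite) (rule inj_of_nat)
  ultimately show ?thesis using finite_subset by blast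
qed

definition alg_enum :: "nat \<Rightarrow> complex" where
  "alg_enum = from_nat_into {z. Polynomial.algebraic z}"

lemma bij_alg_enum: "bij_betw alg_enum UNIV {z. Polynomial.algebraic z}"
  unfolding alg_enum_def by (rule bij_betw_from_nat_into[OF countable_algebraic infinite_algebraic])

lemma inj_alg_enum: "inj alg_enum"
  using bij_alg_enum by (rule bij_betw_imp_inj_on)

lemma algebraic_alg_enum: "Polynomial.algebraic (alg_enum n)"
  using bij_betw_apply[OF bij_alg_enum] by blast

lemma ex_alg_enum: "Polynomial.algebraic z \<Longrightarrow> \<exists>n. alg_enum n = z"
  using bij_betw_imp_surj_on[OF bij_alg_enum] by (metis imageE mem_Collect_eq)

definition subfield_codes :: "(nat \<Rightarrow> bool) set" where
  "subfield_codes = {D. complex_subfield (alg_enum ` Collect D)}"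

text \<open>In increasing order, the element at position \<open>a\<close> is decided by finitely
  many bits of the code.\<close>

definition code_numbering :: "(nat \<Rightarrow> bool) \<Rightarrow> nat \<Rightarrow> complex" where
  "code_numbering D a = alg_enum (enumerate (Collect D) a)"

lemma infinite_subfield_code: "D \<in> subfield_codes \<Longrightarrow> infinite (Collect D)"
proof
  assume "D \<in> subfield_codes" "finite (Collect D)"
  then have "range (of_nat :: nat \<Rightarrow> complex) \<subseteq> alg_enum ` Collect D"
    unfolding subfield_codes_def using complex_subfield_of_nat by blast
  then show False using \<open>finite (Collect D)\<close>
    by (metis finite_imageI finite_subset inj_of_nat range_inj_infinite)
qed

lemma range_code_numbering: "D \<in> subfield_codes \<Longrightarrow> range (code_numbering D) = alg_enum ` Collect D"
proof -
  assume "D \<in> subfield_codes"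
  then have "range (enumerate (Collect D)) = Collect D"
    by (intro range_enumerate infinite_subfield_code)
  then show ?thesis unfolding code_numbering_def image_image[symmetric] by simp
qed

lemma algebraic_code_numbering:
  assumes "D \<in> subfield_codes" shows "algebraic_numbering (code_numbering D)"
  unfolding algebraic_numbering_def
proof (intro conjI allI)
  have "inj (alg_enum \<circ> enumerate (Collect D))"
    using inj_alg_enum inj_enumerate[OF infinite_subfield_code[OF assms]] by (rule inj_compose)
  then show "inj (code_numbering D)" unfolding code_numbering_def comp_def .
  show "complex_subfield (range (code_numbering D))"
    unfolding range_code_numbering[OF assms] using assms unfolding subfield_codes_def by simp
  show "Polynomial.algebraic (code_numbering D a)" for a
    unfolding code_numbering_def by (rule algebraic_alg_enum)
qed


subsection \<open>Locally constant functions of a code\<close>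

text \<open>Continuity into a discrete space, expressed through initial segments of codes.\<close>

definition locally_const :: "((nat \<Rightarrow> bool) \<Rightarrow> 'a) \<Rightarrow> bool" where
  "locally_const g \<longleftrightarrow> (\<forall>D\<in>subfield_codes. \<exists>N. \<forall>E\<in>subfield_codes. (\<forall>i<N. E i = D i) \<longrightarrow> g E = g D)"

lemma locally_constD:
  assumes "locally_const g" "D \<in> subfield_codes"
  shows "\<exists>N. \<forall>E\<in>subfield_codes. (\<forall>i<N. E i = D i) \<longrightarrow> g E = g D"
  using assms(1)[unfolded locally_const_def] assms(2) by (rule bspec)

lemma locally_const_const: "locally_const (\<lambda>_. c)"
  unfolding locally_const_def by blast

text \<open>Near \<open>D\<close> the value \<open>g D\<close> is frozen, so only a fixed instance
  of \<open>h\<close> varies; compound expressions can thus be treated one subexpression at a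
  time.\<close>

lemma locally_const_bind:
  assumes g: "locally_const g" and h: "\<And>v. locally_const (h v)"
  shows "locally_const (\<lambda>D. h (g D) D)"
  unfolding locally_const_def
proof
  fix D assume D: "D \<in> subfield_codes"
  obtain M where M: "\<forall>E\<in>subfield_codes. (\<forall>i<M. E i = D i) \<longrightarrow> g E = g D"
    using locally_constD[OF g D] by blast
  obtain N where N: "\<forall>E\<in>subfield_codes. (\<forall>i<N. E i = D i) \<longrightarrow> h (g D) E = h (g D) D"
    using locally_constD[OF h D] by blast
  show "\<exists>N. \<forall>E\<in>subfield_codes. (\<forall>i<N. E i = D i) \<longrightarrow> h (g E) E = h (g D) D"
    using M N by (intro exI[of _ "max M N"]) auto
qed

text \<open>The bits up to and including the element at position \<open>a\<close> fix all elements
  at positions up to \<open>a\<close>: the minimality that defines each of them concerns only those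
  bits.\<close>

lemma locally_const_code_numbering: "locally_const (\<lambda>D. code_numbering D a)"
  unfolding locally_const_def
proof
  fix D assume D: "D \<in> subfield_codes"
  note infD = infinite_subfield_code[OF D]
  have "enumerate (Collect E) b = enumerate (Collect D) b"
    if E: "E \<in> subfield_codes" "\<forall>i<Suc (enumerate (Collect D) a). E i = D i" and "b \<le> a" for E b
    using \<open>b \<le> a\<close>
  proof (induction b)
    case 0
    have "enumerate (Collect D) 0 \<le> enumerate (Collect D) a" using infD by simp
    then have eq: "E i = D i" if "i \<le> enumerate (Collect D) 0" for i using E(2) that by simp
    have "E (enumerate (Collect D) 0)"
      using enumerate_in_set[OF infD, of 0] eq[of "enumerate (Collect D) 0"] by simp
    moreover have "enumerate (Collect D) 0 \<le> i" if "E i" for i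
      using that eq[of i] unfolding enumerate_0 by (metis Least_le linorder_le_cases mem_Collect_eq)
    ultimately show ?case unfolding enumerate_0[of "Collect E"] by (intro Least_equality) auto
  next
    case (Suc b)
    let ?d = "enumerate (Collect D) (Suc b)"
    have "?d \<le> enumerate (Collect D) a" using infD Suc.prems by simp
    then have eq: "E i = D i" if "i \<le> ?d" for i using E(2) that by simp
    have IH: "enumerate (Collect E) b = enumerate (Collect D) b" using Suc by simp
    have "E ?d" using enumerate_in_set[OF infD, of "Suc b"] eq[of ?d] by simp
    moreover have "?d \<le> i" if "E i" "enumerate (Collect D) b < i" for i
    proof (rule ccontr)
      assume *: "\<not> ?d \<le> i"
      then have "D i" using eq that by simp
      then have "?d \<le> i" unfolding enumerate_Suc''[OF infD] using that by (intro Least_le) simp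
      then show False using * by simp
    qed
    ultimately show ?case
      unfolding enumerate_Suc''[OF infinite_subfield_code[OF E(1)]] IH
      using enumerate_step[OF infD, of b] by (intro Least_equality) auto
  qed
  then show "\<exists>N. \<forall>E\<in>subfield_codes. (\<forall>i<N. E i = D i) \<longrightarrow> code_numbering E a = code_numbering D a"
    unfolding code_numbering_def by (metis order_refl)
qed

text \<open>If \<open>k\<close> is the index of \<open>w D\<close>, then both \<open>w\<close> and
  the number with index \<open>k\<close> are constant near \<open>D\<close>; by injectivity
  \<open>k\<close> remains the index.\<close>

lemma locally_const_inv_code_numbering:
  assumes w: "locally_const w" and mem: "\<And>D. D \<in> subfield_codes \<Longrightarrow> w D \<in> range (code_numbering D)"
  shows "locally_const (\<lambda>D. inv_into UNIV (code_numbering D) (w D))"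
  unfolding locally_const_def
proof
  fix D assume D: "D \<in> subfield_codes"
  define k where "k = inv_into UNIV (code_numbering D) (w D)"
  have k: "code_numbering D k = w D" unfolding k_def by (rule f_inv_into_f[OF mem[OF D]])
  obtain M where M: "\<forall>E\<in>subfield_codes. (\<forall>i<M. E i = D i) \<longrightarrow> w E = w D"
    using locally_constD[OF w D] by blast
  obtain N where N: "\<forall>E\<in>subfield_codes. (\<forall>i<N. E i = D i) \<longrightarrow>
      code_numbering E k = code_numbering D k"
    using locally_constD[OF locally_const_code_numbering D] by blast
  have "inv_into UNIV (code_numbering E) (w E) = k"
    if E: "E \<in> subfield_codes" "\<forall>i<max M N. E i = D i" for E
  proof -
    have "code_numbering E k = w E" using bspec[OF M E(1)] bspec[OF N E(1)] E(2) k by simp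
    then show ?thesis using numbering_inj[OF algebraic_code_numbering[OF E(1)]] by (metis inv_f_f)
  qed
  then show "\<exists>N. \<forall>E\<in>subfield_codes. (\<forall>i<N. E i = D i) \<longrightarrow>
      inv_into UNIV (code_numbering E) (w E) = inv_into UNIV (code_numbering D) (w D)"
    unfolding k_def by blast
qed

abbreviation code_struct :: "(nat \<Rightarrow> bool) \<Rightarrow> struct" where
  "code_struct D \<equiv> field_struct (numbered_field (code_numbering D))"

lemma locally_const_fun_int: "locally_const (\<lambda>D. fun_int (code_struct D) f v)"
proof -
  note sub = numbering_subfield[OF algebraic_code_numbering]
  have op: "locally_const (\<lambda>D. h (code_numbering D a) (code_numbering D b))" for h :: "complex \<Rightarrow> complex \<Rightarrow> complex" and a b
  proof -
    have "locally_const (\<lambda>D. h c (code_numbering D b))" for c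
      using locally_const_bind[OF locally_const_code_numbering, of "\<lambda>d _. h c d" b]
      by (simp add: locally_const_const)
    then show ?thesis
      using locally_const_bind[OF locally_const_code_numbering, of "\<lambda>c D. h c (code_numbering D b)" a] by simp
  qed
  have "locally_const (\<lambda>D. inv_into UNIV (code_numbering D) 0)"
    by (rule locally_const_inv_code_numbering[OF locally_const_const]) (rule complex_subfield_0[OF sub])
  moreover have "locally_const (\<lambda>D. inv_into UNIV (code_numbering D) 1)"
    by (rule locally_const_inv_code_numbering[OF locally_const_const]) (rule complex_subfield_1[OF sub])
  moreover have "locally_const (\<lambda>D. inv_into UNIV (code_numbering D) (code_numbering D (v ! 0) + code_numbering D (v ! 1)))"
    by (rule locally_const_inv_code_numbering[OF op]) (rule complex_subfield_add[OF sub], auto)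
  moreover have "locally_const (\<lambda>D. inv_into UNIV (code_numbering D) (code_numbering D (v ! 0) * code_numbering D (v ! 1)))"
    by (rule locally_const_inv_code_numbering[OF op]) (rule complex_subfield_mult[OF sub], auto)
  ultimately show ?thesis
    by (cases "f = 0"; cases "f = 1"; cases "f = 2"; simp add: field_struct_def numbered_field_def)
qed

lemma locally_const_map:
  assumes "\<And>t. t \<in> set ts \<Longrightarrow> locally_const (\<lambda>D. f D t)"
  shows "locally_const (\<lambda>D. map (f D) ts)"
  using assms
proof (induction ts)
  case Nil
  then show ?case by (simp add: locally_const_const)
next
  case (Cons t ts)
  have "locally_const (\<lambda>D. v # map (f D) ts)" for v
    using locally_const_bind[of "\<lambda>D. map (f D) ts" "\<lambda>w _. v # w"] Cons
    by (simp add: locally_const_const)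
  then show ?case
    using locally_const_bind[of "\<lambda>D. f D t" "\<lambda>v D. v # map (f D) ts"] Cons.prems by simp
qed

lemma locally_const_cterm_val: "locally_const (\<lambda>D. cterm_val (code_struct D) t)"
proof (induction t)
  case (Elem a)
  then show ?case by (simp add: locally_const_const)
next
  case (App f ts)
  then have "locally_const (\<lambda>D. map (cterm_val (code_struct D)) ts)" by (intro locally_const_map)
  then show ?case
    using locally_const_bind[of "\<lambda>D. map (cterm_val (code_struct D)) ts" "\<lambda>v D. fun_int (code_struct D) f v"]
      locally_const_fun_int by simp
qed

lemma finite_monic_roots: "finite {z::complex. z ^ n + (\<Sum>i<n. c i * z ^ i) = 0}"
proof -
  define p where "p = Polynomial.monom 1 n + (\<Sum>i<n. Polynomial.monom (c i) i)"
  have "Polynomial.coeff p n = 1" unfolding p_def by (simp add: coeff_sum)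
  then have "p \<noteq> 0" by auto
  then have "finite {z. poly p z = 0}" by (rule poly_roots_finite)
  then show ?thesis unfolding p_def by (simp add: poly_sum Polynomial.poly_monom)
qed

text \<open>Near \<open>D\<close> the coefficients, and hence the finite set \<open>Z\<close> of
  complex roots, are the same. With \<open>M\<close> above the indices of all roots, the bits below
  \<open>M\<close> decide whether the field contains one.\<close>

lemma locally_const_has_monic_root:
  "locally_const (\<lambda>D. has_monic_root (numbered_field (code_numbering D)) n v)"
  unfolding locally_const_def
proof
  fix D assume D: "D \<in> subfield_codes"
  define Z where "Z = {z. z ^ n + (\<Sum>i<n. code_numbering D (v ! i) * z ^ i) = 0}"
  have "finite {k. alg_enum k \<in> Z}"
    using finite_vimageI[OF finite_monic_roots inj_alg_enum] unfolding Z_def vimage_def by simp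
  then obtain M where M: "{k. alg_enum k \<in> Z} \<subseteq> {..<M}" using finite_nat_iff_bounded by blast
  have "locally_const (\<lambda>D. map (\<lambda>i. code_numbering D (v ! i)) [0..<n])"
    by (rule locally_const_map) (rule locally_const_code_numbering)
  from locally_constD[OF this D]
  obtain N where N: "\<forall>E\<in>subfield_codes. (\<forall>i<N. E i = D i) \<longrightarrow>
      map (\<lambda>i. code_numbering E (v ! i)) [0..<n] = map (\<lambda>i. code_numbering D (v ! i)) [0..<n]"
    by blast
  have root_iff: "has_monic_root (numbered_field (code_numbering E)) n v \<longleftrightarrow> (\<exists>k. E k \<and> alg_enum k \<in> Z)"
    if E: "E \<in> subfield_codes" "\<forall>i<N. E i = D i" for E
  proof -
    have "code_numbering E (v ! i) = code_numbering D (v ! i)" if "i < n" for i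
      using bspec[OF N E(1)] E(2) that by (simp add: map_eq_conv)
    then have "has_monic_root (numbered_field (code_numbering E)) n v \<longleftrightarrow> (\<exists>x. code_numbering E x \<in> Z)"
      unfolding has_monic_root_numbered_field[OF algebraic_code_numbering[OF E(1)]] Z_def by simp
    also have "\<dots> \<longleftrightarrow> (\<exists>z\<in>range (code_numbering E). z \<in> Z)" by blast
    also have "\<dots> \<longleftrightarrow> (\<exists>k. E k \<and> alg_enum k \<in> Z)"
      unfolding range_code_numbering[OF E(1)] by blast
    finally show ?thesis .
  qed
  have "has_monic_root (numbered_field (code_numbering E)) n v =
      has_monic_root (numbered_field (code_numbering D)) n v"
    if E: "E \<in> subfield_codes" "\<forall>i<max M N. E i = D i" for E
  proof -
    have "E k = D k" if "alg_enum k \<in> Z" for k using that M E(2) by auto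
    then show ?thesis using root_iff[OF E(1)] root_iff[OF D] E(2) by auto
  qed
  then show "\<exists>N. \<forall>E\<in>subfield_codes. (\<forall>i<N. E i = D i) \<longrightarrow>
      has_monic_root (numbered_field (code_numbering E)) n v =
      has_monic_root (numbered_field (code_numbering D)) n v" by blast
qed

lemma rel_int_field_struct: "rel_int (field_struct F) r v = has_monic_root F r v"
  by (simp add: field_struct_def)

lemma locally_const_holds: "locally_const (\<lambda>D. holds (code_struct D) \<phi>)"
proof (cases \<phi>)
  case (Eq s t)
  have "locally_const (\<lambda>D. v = cterm_val (code_struct D) t)" for v
    using locally_const_bind[OF locally_const_cterm_val, of "\<lambda>w _. v = w" t]
    by (simp add: locally_const_const)
  then show ?thesis
    using locally_const_bind[OF locally_const_cterm_val, of "\<lambda>v D. v = cterm_val (code_struct D) t" s] Eq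
    by simp
next
  case (Rel r ts)
  have "locally_const (\<lambda>D. map (cterm_val (code_struct D)) ts)"
    by (intro locally_const_map locally_const_cterm_val)
  moreover have "locally_const (\<lambda>D. rel_int (code_struct D) r v)" for v
    unfolding rel_int_field_struct by (rule locally_const_has_monic_root)
  ultimately show ?thesis
    using locally_const_bind[of "\<lambda>D. map (cterm_val (code_struct D)) ts" "\<lambda>v D. rel_int (code_struct D) r v"] Rel
    by simp
qed

lemma locally_const_atomic_diagram: "locally_const (\<lambda>D. atomic_diagram field_sig (code_struct D) c)"
proof (cases "\<exists>\<phi>. wf_atom field_sig \<phi> \<and> atom_code \<phi> = c")
  case True
  then obtain \<phi> where \<phi>: "wf_atom field_sig \<phi>" "c = atom_code \<phi>" by blast
  show ?thesis unfolding \<phi>(2) atomic_diagram_code[OF \<phi>(1)] by (rule locally_const_holds)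
next
  case False
  then have "atomic_diagram field_sig A c = False" for A unfolding atomic_diagram_def by blast
  then show ?thesis by (simp add: locally_const_const)
qed

section \<open>Compactness of the codes and of their continuous image\<close>

lemma closedin_subfield_codes: "closedin cantor_space subfield_codes"
proof -
  have "\<exists>N. \<forall>E. (\<forall>i<N. E i = D i) \<longrightarrow> E \<notin> subfield_codes" if D: "D \<notin> subfield_codes" for D
  proof -
    \<comment> \<open>A failure of the subfield conditions is finite: either 1 is missing, or two
      members have a missing difference or quotient. \<open>I\<close> holds the indices of those
      members and \<open>w\<close> is the missing number that they force.\<close>
    obtain I w where I: "finite I" "\<And>i. i \<in> I \<Longrightarrow> D i" "w \<notin> alg_enum ` Collect D"
      and w: "\<And>E. complex_subfield (alg_enum ` Collect E) \<Longrightarrow> (\<And>i. i \<in> I \<Longrightarrow> E i) \<Longrightarrow> w \<in> alg_enum ` Collect E"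
    proof (cases "1 \<in> alg_enum ` Collect D")
      case False
      then show ?thesis using that[of "{}" 1] complex_subfield_1 by blast
    next
      case True
      then obtain i j where ij: "D i" "D j"
        "alg_enum i - alg_enum j \<notin> alg_enum ` Collect D \<or> alg_enum i / alg_enum j \<notin> alg_enum ` Collect D"
        using D unfolding subfield_codes_def complex_subfield_def by blast
      have mem: "alg_enum i \<in> alg_enum ` Collect E" "alg_enum j \<in> alg_enum ` Collect E"
        if "\<And>k. k \<in> {i, j} \<Longrightarrow> E k" for E using that by auto
      show ?thesis
      proof (cases "alg_enum i - alg_enum j \<in> alg_enum ` Collect D")
        case True
        show ?thesis
          by (rule that[of "{i, j}" "alg_enum i / alg_enum j"])
            (use ij True complex_subfield_divide mem in auto)
      next
        case False
        show ?thesis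
          by (rule that[of "{i, j}" "alg_enum i - alg_enum j"])
            (use ij False complex_subfield_diff mem in auto)
      qed
    qed
    \<comment> \<open>\<open>w\<close> has at most one index; if it has none, no code contains it
      and fixing \<open>I\<close> suffices.\<close>
    have "finite (I \<union> {k. alg_enum k = w})"
      using I(1) finite_vimageI[OF _ inj_alg_enum, of "{w}"] by (simp add: vimage_def)
    then obtain N where N: "I \<union> {k. alg_enum k = w} \<subseteq> {..<N}" using finite_nat_iff_bounded by blast
    have "E \<notin> subfield_codes" if E: "\<forall>i<N. E i = D i" for E
    proof
      assume "E \<in> subfield_codes"
      moreover have "E i" if "i \<in> I" for i using that N E I(2) by auto
      ultimately obtain k where "E k" "alg_enum k = w" using w[of E] unfolding subfield_codes_def by blast
      moreover from this have "D k" using N E by auto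
      ultimately show False using I(3) by blast
    qed
    then show ?thesis by blast
  qed
  then have "openin cantor_space (- subfield_codes)"
    unfolding cantor_space_def openin_sequence_space by simp
  then show ?thesis
    unfolding closedin_def by (simp add: cantor_space_def Compl_eq_Diff_UNIV)
qed

lemma compact_subfield_codes: "compact_space (subtopology cantor_space subfield_codes)"
proof -
  have "compact_space cantor_space"
    unfolding cantor_space_def by (simp add: compact_space_product_topology compact_space_discrete_topology)
  then have "compactin cantor_space subfield_codes"
    using closedin_compact_space closedin_subfield_codes by blast
  then show ?thesis by (rule compact_space_subtopology)
qed

lemma continuous_map_locally_const:
  assumes "locally_const g"
  shows "continuous_map (subtopology cantor_space subfield_codes) (discrete_topology UNIV) g"
proof -
  have "openin (subtopology cantor_space subfield_codes) {D \<in> subfield_codes. g D \<in> U}" for U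
    unfolding cantor_space_def openin_subtopology_sequence_space
  proof (intro conjI ballI)
    fix D assume D: "D \<in> {D \<in> subfield_codes. g D \<in> U}"
    then have "D \<in> subfield_codes" by simp
    from locally_constD[OF assms this] obtain N
      where N: "\<forall>E\<in>subfield_codes. (\<forall>i<N. E i = D i) \<longrightarrow> g E = g D" by blast
    have "E \<in> {D \<in> subfield_codes. g D \<in> U}" if E: "E \<in> subfield_codes" "\<forall>i<N. E i = D i" for E
    proof -
      have "g E = g D" using N E by blast
      then show ?thesis using D E(1) by simp
    qed
    then show "\<exists>N. \<forall>E\<in>subfield_codes. (\<forall>i<N. E i = D i) \<longrightarrow> E \<in> {D \<in> subfield_codes. g D \<in> U}"
      by blast
  qed blast
  then show ?thesis unfolding continuous_map_def by (simp add: cantor_space_def)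
qed

lemma continuous_map_code_diagram:
  "continuous_map (subtopology cantor_space subfield_codes)
     (subtopology cantor_space (diagrams field_sig ALG0_structs)) (\<lambda>D. atomic_diagram field_sig (code_struct D))"
proof -
  have "atomic_diagram field_sig (code_struct D) \<in> diagrams field_sig ALG0_structs"
    if "D \<in> subfield_codes" for D
    unfolding diagrams_def ALG0_structs_def
    using field_numbered_field numbered_field_algebraic numbered_field_sel(1)
      algebraic_code_numbering[OF that] by blast
  then show ?thesis
    unfolding continuous_map_in_subtopology
    unfolding cantor_space_def continuous_map_componentwise_UNIV
    using continuous_map_locally_const[OF locally_const_atomic_diagram]
    by (auto simp: cantor_space_def)
qed


theorem compact_ALG0_iso_space: "compact_space ALG0_iso_space"
proof -
  let ?X = "subtopology cantor_space subfield_codes"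
  let ?D = "diagrams field_sig ALG0_structs"
  let ?Y = "subtopology cantor_space ?D"
  let ?r = "diagram_iso field_sig ALG0_structs"
  let ?\<Phi> = "\<lambda>D. atomic_diagram field_sig (code_struct D)"
  have Y: "topspace ?Y = ?D" by (simp add: cantor_space_def)
  have "continuous_map ?Y ALG0_iso_space (\<lambda>x. ?r `` {x})"
    unfolding ALG0_iso_space_def iso_space_def
    by (rule quotient_imp_continuous_map[OF quotient_map_quotient_topology])
  then have cont: "continuous_map ?X ALG0_iso_space ((\<lambda>x. ?r `` {x}) \<circ> ?\<Phi>)"
    by (rule continuous_map_compose[OF continuous_map_code_diagram])
  have "topspace ALG0_iso_space \<subseteq> ((\<lambda>x. ?r `` {x}) \<circ> ?\<Phi>) ` subfield_codes"
  proof
    fix c assume "c \<in> topspace ALG0_iso_space"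
    then obtain d where "d \<in> ?D" "c = ?r `` {d}"
      unfolding ALG0_iso_space_def iso_space_def topspace_quotient_topology Y by (rule quotientE)
    then obtain F where F: "field F" "carrier F = UNIV" "algebraic_over_rationals F"
      "c = ?r `` {atomic_diagram field_sig (field_struct F)}"
      unfolding diagrams_def ALG0_structs_def by blast
    then obtain \<iota> where \<iota>: "algebraic_numbering \<iota>" "F = numbered_field \<iota>"
      using ex_algebraic_numbering by blast
    \<comment> \<open>The code of the range of \<open>\<iota>\<close>. Listing that subfield in
      increasing order gives another numbering with the same range, hence an isomorphic
      field.\<close>
    define D where "D k \<longleftrightarrow> alg_enum k \<in> range \<iota>" for k
    have D: "alg_enum ` Collect D = range \<iota>"
    proof (intro subset_antisym subsetI)
      fix z assume "z \<in> range \<iota>"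
      moreover from this obtain k where "alg_enum k = z"
        using ex_alg_enum numbering_algebraic[OF \<iota>(1)] by blast
      ultimately show "z \<in> alg_enum ` Collect D" by (intro image_eqI[of _ _ k]) (simp_all add: D_def)
    qed (auto simp: D_def)
    then have code: "D \<in> subfield_codes"
      unfolding subfield_codes_def using numbering_subfield[OF \<iota>(1)] by simp
    have "isomorphic_structs field_sig (code_struct D) (field_struct F)"
      unfolding \<iota>(2)
      by (rule isomorphic_numbered_fields[OF algebraic_code_numbering[OF code] \<iota>(1)])
        (simp add: range_code_numbering[OF code] D)
    moreover have "code_struct D \<in> ALG0_structs"
      unfolding ALG0_structs_def
      using field_numbered_field numbered_field_algebraic numbered_field_sel(1)
        algebraic_code_numbering[OF code] by blast
    moreover have "field_struct F \<in> ALG0_structs" unfolding ALG0_structs_def using F by blast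
    ultimately have "(?\<Phi> D, atomic_diagram field_sig (field_struct F)) \<in> ?r"
      unfolding diagram_iso_def by blast
    then have "?r `` {?\<Phi> D} = c" unfolding F(4) by (rule equiv_class_eq[OF equiv_diagram_iso])
    then show "c \<in> ((\<lambda>x. ?r `` {x}) \<circ> ?\<Phi>) ` subfield_codes" using code by auto
  qed
  moreover have "topspace ?X = subfield_codes" by (simp add: cantor_space_def)
  ultimately have "((\<lambda>x. ?r `` {x}) \<circ> ?\<Phi>) ` topspace ?X = topspace ALG0_iso_space"
    using continuous_map_image_subset_topspace[OF cont] by auto
  then show ?thesis
    using image_compactin[OF compact_subfield_codes[unfolded compact_space_def] cont]
    unfolding compact_space_def by simp
qed

theorem theorem5p1:
  shows "FBT_iso_space homeomorphic_space baire_space \<and>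
         \<not> compact_space FBT_iso_space \<and>
         \<not> FBT_iso_space homeomorphic_space ALG0_iso_space"
proof (intro conjI notI)
  show FBT: "FBT_iso_space homeomorphic_space baire_space"
    by (rule FBT_iso_space_homeomorphic_baire_space)
  show not_compact: False if "compact_space FBT_iso_space"
    using that not_compact_baire_space homeomorphic_compact_space[OF FBT] by simp
  show False if "FBT_iso_space homeomorphic_space ALG0_iso_space"
    using not_compact compact_ALG0_iso_space homeomorphic_compact_space[OF that] by simp
qed

end
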